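(* Let $\mathcal{P}=\mathcal{T}(V)/(R_{\mathcal{P}})$ be an operad and $\mathcal{C}=(C_n)_{n\ge1}$ an $\mathbb{S}$-invariant configuration. (a) There is a morphism of operads $\mathcal{C}\mathrm{Sp}(\mathcal{P})\to\mathcal{C}\mathrm{RB}(\mathcal{P})$ which extends the map $\xi$ given on generators by $\binom{\omega}{e_I}\mapsto\omega\circ P^{\otimes n,I}$, $\omega\in V(n)$, $I\in C_n$. (b) Let $A$ be a $\mathcal{P}$-algebra and let $P:A\to A$ be a $\mathcal{C}$-Rota-Baxter operator (of weight one) on $A$. Then the operations $$\binom{\omega}{e_I}(x_1,\dots,x_n):=\omega\circ P^{\otimes n,I}(x_1,\dots,x_n),\qquad x_1,\dots,x_n\in A,\ \omega\in V(n),\ I\in C_n,$$ make $A$ into a $\mathcal{C}\mathrm{Sp}(\mathcal{P})$-algebra.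
   Context: $\mathbf{k}$ is the base field and $[n]=\{1,\dots,n\}$. Trees. Consider planar rooted reduced trees (every vertex has at least one input), including the trivial tree $|$ with one leaf and no vertex. A labeled tree over a graded set $\Omega=\coprod_n\Omega_n$ is such a tree with each vertex having $\ell$ inputs decorated by an element of $\Omega_\ell$ and the leaves decorated by distinct positive integers; $\mathrm{Lin}(\tau)$ is the set of leaf labels. Inputs of a vertex are numbered $1,\dots,\ell$ from left to right. A nontrivial $\tau$ is uniquely a grafting $\tau=\omega(\tau_1\vee\cdots\vee\tau_\ell)$ with root vertex $\omega$. For $\emptyset\ne J\subseteq\mathrm{Lin}(\tau)$ and a vertex $\omega$ whose subtree in $\tau$ is $\omega(\sigma_1\vee\cdots\vee\sigma_\ell)$, put $J\sqcap\omega=\{i\in[\ell]: J\cap\mathrm{Lin}(\sigma_i)\neq\emptyset\}$. Configurations. $B_n$ is the set of nonempty subsets of $[n]$. A configuration is a sequence $\mathcal{C}=(C_n)_{n\ge1}$, $C_n\subseteq B_n$, such that for every labeled tree $\tau$ with $n$ leaves, every $J\in C_n$ (viewed as a set of leaves by numbering the leaves left to right) and every vertex $\omega$ with $\ell$ inputs, $J\sqcap\omega\in C_\ell$ whenever $J\sqcap\omega\ne\emptyset$. It is $\mathbb{S}$-invariant if each $C_n$ is stable under $\mathbb{S}_n$. Splitting. $V=\bigoplus_{n\ge1}V(n)$ is an $\mathbb{S}$-module with basis $\mathcal{V}=\coprod_n\mathcal{V}(n)$, $\mathcal{V}(n)$ invariant under $\mathbb{S}_n$, and $V(1)=\mathbf{k}\,\mathrm{id}$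 (the only unary generator is the identity operation, identified with the operadic unit, i.e. the trivial tree). $\mathcal{C}\mathrm{Sp}(V)(n)=V(n)\otimes\bigoplus_{I\in C_n}\mathbf{k}e_I$, with $\binom{\omega}{e_I}=\omega\otimes e_I$, $\binom{\omega}{*}=\sum_{I\in C_n}\binom{\omega}{e_I}$ and action $\binom{\omega}{e_I}^\sigma=\binom{\omega^\sigma}{e_{\sigma(I)}}$ (and $\binom{\mathrm{id}}{e_{\{1\}}}$ is identified with the unit). For a labeled tree $\tau$ over $\mathcal{V}$, $\mathcal{C}\mathrm{Sp}(\tau)=\mathcal{C}\mathrm{Sp}_\emptyset(\tau)$ is obtained by replacing every vertex $\omega$ by $\binom{\omega}{*}$; for $J\in C_{|\mathrm{Lin}(\tau)|}$, $\mathcal{C}\mathrm{Sp}_J(|)=|$ and, for $\tau=\omega(\tau_1\vee\cdots\vee\tau_\ell)$, $\mathcal{C}\mathrm{Sp}_J(\tau)=\binom{\omega}{e_{J\sqcap\omega}}(\mathcal{C}\mathrm{Sp}_{J\cap\mathrm{Lin}(\tau_1)}(\tau_1)\vee\cdots\vee\mathcal{C}\mathrm{Sp}_{J\cap\mathrm{Lin}(\tau_\ell)}(\tau_\ell))$. The free operad is $\mathcal{T}(V)\cong\bigoplus_{t\in\mathfrak{R}}t[V]$, $\mathfrak{R}$ a set of planar representatives of isomorphism classes of reduced leaf-labeled trees. $R_{\mathcal{P}}$ consists of locally homogeneous elements $r_s=\sum_ic_{s,i}\tau_{s,i}$ ($\mathrm{Lin}(\tau_{s,i})=:\mathrm{Lin}(r_s)$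 independent of $i$). Then $\mathcal{C}\mathrm{Sp}(\mathcal{P})=\mathcal{T}(\mathcal{C}\mathrm{Sp}(V))/(\sum_ic_{s,i}\mathcal{C}\mathrm{Sp}_J(\tau_{s,i}):\ s,\ J\in C_{|\mathrm{Lin}(r_s)|})$. Rota-Baxter operators. Let $V_P$ be the $\mathbb{S}$-module with $V_P(1)=\mathbf{k}P$, $P$ a new symbol ($P\ne\mathrm{id}$), and $V_P(n)=V(n)$ for $n\ge2$. $P^{\otimes n,I}$ denotes the $n$-th tensor power of $P$ with the components indexed by $I$ replaced by the identity. The operad of $\mathcal{C}$-Rota-Baxter $\mathcal{P}$-algebras is $\mathcal{C}\mathrm{RB}(\mathcal{P})=\mathcal{T}(V_P)/(R_{\mathcal{P}},\mathcal{C}\mathrm{RB}_{\mathcal{P}})$, where $\mathcal{C}\mathrm{RB}_{\mathcal{P}}(n)=\{\omega\circ P^{\otimes n}-\sum_{I\in C_n}P\circ\omega\circ P^{\otimes n,I}:\omega\in V(n)\}$. A $\mathcal{C}$-Rota-Baxter operator (of weight one) on a $\mathcal{P}$-algebra $A$ is a linear map $P:A\to A$ with $\omega(P(x_1),\dots,P(x_n))=P\big(\sum_{I\in C_n}\omega\circ P^{\otimes n,I}(x_1,\dots,x_n)\big)$ for all $n$, $\omega\in V(n)$, $x_j\in A$. *)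

theory Defs
  imports
    Complex_Main
    "HOL-Algebra.Module"
    "HOL-Algebra.AbelCoset"
    "HOL-Library.Poly_Mapping"
    "HOL-Combinatorics.Permutations"
begin

section \<open>Formal linear combinations\<close>

text \<open>
  The base field is the type \<^typ>\<open>'k::field\<close>.  Vector spaces whose carrier is a set (the components
  of an operad) are modules of HOL-Algebra over \<open>base_field\<close>.  The vector space with basis \<open>X\<close> is
  \<open>free_module X\<close>, made of finitely supported functions.
\<close>

definition base_field :: "'k::field ring" where
  "base_field = \<lparr>carrier = UNIV, monoid.mult = (*), one = 1, zero = 0, add = (+)\<rparr>"

definition scal :: "'k::field \<Rightarrow> ('b \<Rightarrow>\<^sub>0 'k) \<Rightarrow> ('b \<Rightarrow>\<^sub>0 'k)" where
  "scal c f = Poly_Mapping.map ((*) c) f"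

abbreviation vec :: "'b \<Rightarrow> ('b \<Rightarrow>\<^sub>0 'k::field)" where
  "vec b \<equiv> Poly_Mapping.single b 1"

definition free_module :: "'b set \<Rightarrow> ('k::field, 'b \<Rightarrow>\<^sub>0 'k) module" where
  "free_module X = \<lparr>carrier = {f. Poly_Mapping.keys f \<subseteq> X}, monoid.mult = undefined, one = undefined,
     zero = 0, add = (+), smult = scal\<rparr>"

definition lin_ext :: "('b \<Rightarrow> ('c \<Rightarrow>\<^sub>0 'k)) \<Rightarrow> ('b \<Rightarrow>\<^sub>0 'k) \<Rightarrow> ('c \<Rightarrow>\<^sub>0 'k::field)" where
  "lin_ext g f = (\<Sum>b\<in>Poly_Mapping.keys f. scal (Poly_Mapping.lookup f b) (g b))"

definition quot_module :: "('k, 'a) module \<Rightarrow> 'a set \<Rightarrow> ('k, 'a set) module" where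
  "quot_module M N = \<lparr>carrier = a_rcosets\<^bsub>M\<^esub> N, monoid.mult = undefined, one = undefined,
     zero = N, add = set_add M, smult = (\<lambda>c X. \<Union>x\<in>X. N +>\<^bsub>M\<^esub> (c \<odot>\<^bsub>M\<^esub> x))\<rparr>"


section \<open>Symmetric operads\<close>

text \<open>
  Operads are linear, symmetric and concentrated in positive arities, and are given by partial
  compositions: \<open>pcomp \<O> m n i \<mu> \<nu>\<close> is \<open>\<mu> \<circ>\<^sub>i \<nu>\<close> for \<open>\<mu>\<close> of arity \<open>m\<close> and \<open>\<nu>\<close> of arity \<open>n\<close>.
  Inputs are numbered from 1, and \<open>sact \<O> n \<sigma> \<mu>\<close> is \<open>\<mu>\<^sup>\<sigma>\<close> for \<open>\<sigma>\<close> a permutation of \<open>{1..n}\<close>.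

  The convention for the action is \<open>\<mu>\<^sup>\<sigma>(x\<^sub>1, \<dots>, x\<^sub>n) = \<mu>(x\<^bsub>\<sigma>(1)\<^esub>, \<dots>, x\<^bsub>\<sigma>(n)\<^esub>)\<close>, so that
  \<open>(\<mu>\<^sup>\<tau>)\<^sup>\<sigma> = \<mu>\<^bsup>\<sigma>\<tau>\<^esup>\<close> when permutations are composed as functions.  It is the convention for which
  \<open>(\<omega>, e\<^sub>I) \<mapsto> (\<omega>\<^sup>\<sigma>, e\<^bsub>\<sigma>(I)\<^esub>)\<close> is compatible with reading \<open>I\<close> as a set of inputs of \<open>\<omega>\<close>:
  the \<open>i\<close>-th input of \<open>\<omega>\<close> receives the argument number \<open>\<sigma>(i)\<close> of \<open>\<omega>\<^sup>\<sigma>\<close>.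
\<close>

record ('k, 'a) operad =
  comps :: "nat \<Rightarrow> ('k, 'a) module"
  pcomp :: "nat \<Rightarrow> nat \<Rightarrow> nat \<Rightarrow> 'a \<Rightarrow> 'a \<Rightarrow> 'a"
  sact :: "nat \<Rightarrow> (nat \<Rightarrow> nat) \<Rightarrow> 'a \<Rightarrow> 'a"
  unit :: "'a"

text \<open>
  In \<open>\<mu> \<circ>\<^sub>i \<nu>\<close>, with \<open>\<nu>\<close> of arity \<open>n\<close>, the input \<open>j \<noteq> i\<close> of \<open>\<mu>\<close> becomes the input \<open>outer i n j\<close>, and the
  input \<open>l\<close> of \<open>\<nu>\<close> becomes the input \<open>inner i l\<close>.
\<close>

definition outer :: "nat \<Rightarrow> nat \<Rightarrow> nat \<Rightarrow> nat" where
  "outer i n j = (if j < i then j else j + n - 1)"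

definition inner :: "nat \<Rightarrow> nat \<Rightarrow> nat" where
  "inner i l = i + l - 1"

text \<open>
  The block permutations with \<open>\<mu>\<^sup>\<sigma> \<circ>\<^bsub>\<sigma>(i)\<^esub> \<nu> = (\<mu> \<circ>\<^sub>i \<nu>)\<^bsup>outer_perm i n \<sigma>\<^esup>\<close> and
  \<open>\<mu> \<circ>\<^sub>i \<nu>\<^sup>\<tau> = (\<mu> \<circ>\<^sub>i \<nu>)\<^bsup>inner_perm i n \<tau>\<^esup>\<close>.
\<close>

definition outer_perm :: "nat \<Rightarrow> nat \<Rightarrow> (nat \<Rightarrow> nat) \<Rightarrow> nat \<Rightarrow> nat" where
  "outer_perm i n \<sigma> q =
     (if q < i then outer (\<sigma> i) n (\<sigma> q)
      else if q < i + n then inner (\<sigma> i) (q + 1 - i)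
      else outer (\<sigma> i) n (\<sigma> (q + 1 - n)))"

definition inner_perm :: "nat \<Rightarrow> nat \<Rightarrow> (nat \<Rightarrow> nat) \<Rightarrow> nat \<Rightarrow> nat" where
  "inner_perm i n \<tau> q = (if i \<le> q \<and> q < i + n then inner i (\<tau> (q + 1 - i)) else q)"

locale operad =
  fixes \<O> :: "('k::field, 'a) operad"
  assumes module: "n \<ge> 1 \<Longrightarrow> Module.module base_field (comps \<O> n)"
    and pcomp_closed: "\<lbrakk>n \<ge> 1; i \<in> {1..m}; \<mu> \<in> carrier (comps \<O> m); \<nu> \<in> carrier (comps \<O> n)\<rbrakk>
      \<Longrightarrow> pcomp \<O> m n i \<mu> \<nu> \<in> carrier (comps \<O> (m + n - 1))"
    and pcomp_add_left: "\<lbrakk>n \<ge> 1; i \<in> {1..m}; \<mu> \<in> carrier (comps \<O> m); \<mu>' \<in> carrier (comps \<O> m);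
        \<nu> \<in> carrier (comps \<O> n)\<rbrakk>
      \<Longrightarrow> pcomp \<O> m n i (\<mu> \<oplus>\<^bsub>comps \<O> m\<^esub> \<mu>') \<nu> =
          pcomp \<O> m n i \<mu> \<nu> \<oplus>\<^bsub>comps \<O> (m + n - 1)\<^esub> pcomp \<O> m n i \<mu>' \<nu>"
    and pcomp_add_right: "\<lbrakk>n \<ge> 1; i \<in> {1..m}; \<mu> \<in> carrier (comps \<O> m); \<nu> \<in> carrier (comps \<O> n);
        \<nu>' \<in> carrier (comps \<O> n)\<rbrakk>
      \<Longrightarrow> pcomp \<O> m n i \<mu> (\<nu> \<oplus>\<^bsub>comps \<O> n\<^esub> \<nu>') =
          pcomp \<O> m n i \<mu> \<nu> \<oplus>\<^bsub>comps \<O> (m + n - 1)\<^esub> pcomp \<O> m n i \<mu> \<nu>'"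
    and pcomp_smult_left: "\<lbrakk>n \<ge> 1; i \<in> {1..m}; \<mu> \<in> carrier (comps \<O> m); \<nu> \<in> carrier (comps \<O> n)\<rbrakk>
      \<Longrightarrow> pcomp \<O> m n i (c \<odot>\<^bsub>comps \<O> m\<^esub> \<mu>) \<nu> = c \<odot>\<^bsub>comps \<O> (m + n - 1)\<^esub> pcomp \<O> m n i \<mu> \<nu>"
    and pcomp_smult_right: "\<lbrakk>n \<ge> 1; i \<in> {1..m}; \<mu> \<in> carrier (comps \<O> m); \<nu> \<in> carrier (comps \<O> n)\<rbrakk>
      \<Longrightarrow> pcomp \<O> m n i \<mu> (c \<odot>\<^bsub>comps \<O> n\<^esub> \<nu>) = c \<odot>\<^bsub>comps \<O> (m + n - 1)\<^esub> pcomp \<O> m n i \<mu> \<nu>"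
    and unit_closed: "unit \<O> \<in> carrier (comps \<O> 1)"
    and unit_left: "\<lbrakk>n \<ge> 1; \<nu> \<in> carrier (comps \<O> n)\<rbrakk> \<Longrightarrow> pcomp \<O> 1 n 1 (unit \<O>) \<nu> = \<nu>"
    and unit_right: "\<lbrakk>i \<in> {1..m}; \<mu> \<in> carrier (comps \<O> m)\<rbrakk> \<Longrightarrow> pcomp \<O> m 1 i \<mu> (unit \<O>) = \<mu>"
    and assoc_seq: "\<lbrakk>n \<ge> 1; i \<in> {1..l}; j \<in> {1..m}; \<kappa> \<in> carrier (comps \<O> l);
        \<mu> \<in> carrier (comps \<O> m); \<nu> \<in> carrier (comps \<O> n)\<rbrakk>
      \<Longrightarrow> pcomp \<O> (l + m - 1) n (inner i j) (pcomp \<O> l m i \<kappa> \<mu>) \<nu> =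
          pcomp \<O> l (m + n - 1) i \<kappa> (pcomp \<O> m n j \<mu> \<nu>)"
    and assoc_par: "\<lbrakk>m \<ge> 1; n \<ge> 1; 1 \<le> i; i < j; j \<le> l; \<kappa> \<in> carrier (comps \<O> l);
        \<mu> \<in> carrier (comps \<O> m); \<nu> \<in> carrier (comps \<O> n)\<rbrakk>
      \<Longrightarrow> pcomp \<O> (l + m - 1) n (outer i m j) (pcomp \<O> l m i \<kappa> \<mu>) \<nu> =
          pcomp \<O> (l + n - 1) m i (pcomp \<O> l n j \<kappa> \<nu>) \<mu>"
    and sact_closed: "\<lbrakk>n \<ge> 1; \<sigma> permutes {1..n}; \<mu> \<in> carrier (comps \<O> n)\<rbrakk>
      \<Longrightarrow> sact \<O> n \<sigma> \<mu> \<in> carrier (comps \<O> n)"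
    and sact_add: "\<lbrakk>n \<ge> 1; \<sigma> permutes {1..n}; \<mu> \<in> carrier (comps \<O> n); \<nu> \<in> carrier (comps \<O> n)\<rbrakk>
      \<Longrightarrow> sact \<O> n \<sigma> (\<mu> \<oplus>\<^bsub>comps \<O> n\<^esub> \<nu>) = sact \<O> n \<sigma> \<mu> \<oplus>\<^bsub>comps \<O> n\<^esub> sact \<O> n \<sigma> \<nu>"
    and sact_smult: "\<lbrakk>n \<ge> 1; \<sigma> permutes {1..n}; \<mu> \<in> carrier (comps \<O> n)\<rbrakk>
      \<Longrightarrow> sact \<O> n \<sigma> (c \<odot>\<^bsub>comps \<O> n\<^esub> \<mu>) = c \<odot>\<^bsub>comps \<O> n\<^esub> sact \<O> n \<sigma> \<mu>"
    and sact_id: "\<lbrakk>n \<ge> 1; \<mu> \<in> carrier (comps \<O> n)\<rbrakk> \<Longrightarrow> sact \<O> n id \<mu> = \<mu>"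
    and sact_comp: "\<lbrakk>n \<ge> 1; \<sigma> permutes {1..n}; \<tau> permutes {1..n}; \<mu> \<in> carrier (comps \<O> n)\<rbrakk>
      \<Longrightarrow> sact \<O> n \<sigma> (sact \<O> n \<tau> \<mu>) = sact \<O> n (\<sigma> \<circ> \<tau>) \<mu>"
    and equivariant_outer: "\<lbrakk>n \<ge> 1; i \<in> {1..m}; \<sigma> permutes {1..m}; \<mu> \<in> carrier (comps \<O> m);
        \<nu> \<in> carrier (comps \<O> n)\<rbrakk>
      \<Longrightarrow> pcomp \<O> m n (\<sigma> i) (sact \<O> m \<sigma> \<mu>) \<nu> =
          sact \<O> (m + n - 1) (outer_perm i n \<sigma>) (pcomp \<O> m n i \<mu> \<nu>)"
    and equivariant_inner: "\<lbrakk>n \<ge> 1; i \<in> {1..m}; \<tau> permutes {1..n}; \<mu> \<in> carrier (comps \<O> m);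
        \<nu> \<in> carrier (comps \<O> n)\<rbrakk>
      \<Longrightarrow> pcomp \<O> m n i \<mu> (sact \<O> n \<tau> \<nu>) =
          sact \<O> (m + n - 1) (inner_perm i n \<tau>) (pcomp \<O> m n i \<mu> \<nu>)"

locale operad_hom = source: operad \<P> + target: operad \<Q>
  for \<P> :: "('k::field, 'a) operad" and \<Q> :: "('k, 'b) operad" +
  fixes f :: "nat \<Rightarrow> 'a \<Rightarrow> 'b"
  assumes hom_closed: "\<lbrakk>n \<ge> 1; \<mu> \<in> carrier (comps \<P> n)\<rbrakk> \<Longrightarrow> f n \<mu> \<in> carrier (comps \<Q> n)"
    and hom_add: "\<lbrakk>n \<ge> 1; \<mu> \<in> carrier (comps \<P> n); \<nu> \<in> carrier (comps \<P> n)\<rbrakk>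
      \<Longrightarrow> f n (\<mu> \<oplus>\<^bsub>comps \<P> n\<^esub> \<nu>) = f n \<mu> \<oplus>\<^bsub>comps \<Q> n\<^esub> f n \<nu>"
    and hom_smult: "\<lbrakk>n \<ge> 1; \<mu> \<in> carrier (comps \<P> n)\<rbrakk>
      \<Longrightarrow> f n (c \<odot>\<^bsub>comps \<P> n\<^esub> \<mu>) = c \<odot>\<^bsub>comps \<Q> n\<^esub> f n \<mu>"
    and hom_unit: "f 1 (unit \<P>) = unit \<Q>"
    and hom_pcomp: "\<lbrakk>n \<ge> 1; i \<in> {1..m}; \<mu> \<in> carrier (comps \<P> m); \<nu> \<in> carrier (comps \<P> n)\<rbrakk>
      \<Longrightarrow> f (m + n - 1) (pcomp \<P> m n i \<mu> \<nu>) = pcomp \<Q> m n i (f m \<mu>) (f n \<nu>)"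
    and hom_sact: "\<lbrakk>n \<ge> 1; \<sigma> permutes {1..n}; \<mu> \<in> carrier (comps \<P> n)\<rbrakk>
      \<Longrightarrow> f n (sact \<P> n \<sigma> \<mu>) = sact \<Q> n \<sigma> (f n \<mu>)"

text \<open>The operadic ideal generated by \<open>S n \<subseteq> \<O>(n)\<close>, \<open>n \<ge> 1\<close>.\<close>

inductive in_op_ideal :: "('k::field, 'a) operad \<Rightarrow> (nat \<Rightarrow> 'a set) \<Rightarrow> nat \<Rightarrow> 'a \<Rightarrow> bool"
  for \<O> :: "('k, 'a) operad" and S :: "nat \<Rightarrow> 'a set" where
  gen: "\<lbrakk>n \<ge> 1; \<mu> \<in> S n\<rbrakk> \<Longrightarrow> in_op_ideal \<O> S n \<mu>"
| zero: "n \<ge> 1 \<Longrightarrow> in_op_ideal \<O> S n \<zero>\<^bsub>comps \<O> n\<^esub>"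
| add: "\<lbrakk>in_op_ideal \<O> S n \<mu>; in_op_ideal \<O> S n \<nu>\<rbrakk> \<Longrightarrow> in_op_ideal \<O> S n (\<mu> \<oplus>\<^bsub>comps \<O> n\<^esub> \<nu>)"
| smult: "in_op_ideal \<O> S n \<mu> \<Longrightarrow> in_op_ideal \<O> S n (c \<odot>\<^bsub>comps \<O> n\<^esub> \<mu>)"
| sact: "\<lbrakk>in_op_ideal \<O> S n \<mu>; \<sigma> permutes {1..n}\<rbrakk> \<Longrightarrow> in_op_ideal \<O> S n (sact \<O> n \<sigma> \<mu>)"
| pcomp_left: "\<lbrakk>in_op_ideal \<O> S m \<mu>; n \<ge> 1; \<nu> \<in> carrier (comps \<O> n); i \<in> {1..m}\<rbrakk>
    \<Longrightarrow> in_op_ideal \<O> S (m + n - 1) (pcomp \<O> m n i \<mu> \<nu>)"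
| pcomp_right: "\<lbrakk>in_op_ideal \<O> S n \<nu>; \<mu> \<in> carrier (comps \<O> m); i \<in> {1..m}\<rbrakk>
    \<Longrightarrow> in_op_ideal \<O> S (m + n - 1) (pcomp \<O> m n i \<mu> \<nu>)"

definition op_ideal :: "('k::field, 'a) operad \<Rightarrow> (nat \<Rightarrow> 'a set) \<Rightarrow> nat \<Rightarrow> 'a set" where
  "op_ideal \<O> S n = {\<mu>. in_op_ideal \<O> S n \<mu>}"

definition quotient_operad :: "('k::field, 'a) operad \<Rightarrow> (nat \<Rightarrow> 'a set) \<Rightarrow> ('k, 'a set) operad" where
  "quotient_operad \<O> N = \<lparr>
     comps = (\<lambda>n. quot_module (comps \<O> n) (N n)),
     pcomp = (\<lambda>m n i X Y. \<Union>\<mu>\<in>X. \<Union>\<nu>\<in>Y.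
       N (m + n - 1) +>\<^bsub>comps \<O> (m + n - 1)\<^esub> pcomp \<O> m n i \<mu> \<nu>),
     sact = (\<lambda>n \<sigma> X. \<Union>\<mu>\<in>X. N n +>\<^bsub>comps \<O> n\<^esub> sact \<O> n \<sigma> \<mu>),
     unit = N 1 +>\<^bsub>comps \<O> 1\<^esub> unit \<O>\<rparr>"

text \<open>For \<open>\<nu> 1, \<dots>, \<nu> n\<close> of arity 1, \<open>comp_unary \<O> n \<mu> \<nu>\<close> is \<open>\<mu> \<circ> (\<nu> 1 \<otimes> \<dots> \<otimes> \<nu> n)\<close>.\<close>

definition comp_unary :: "('k::field, 'a) operad \<Rightarrow> nat \<Rightarrow> 'a \<Rightarrow> (nat \<Rightarrow> 'a) \<Rightarrow> 'a" where
  "comp_unary \<O> n \<mu> \<nu> = fold (\<lambda>i \<kappa>. pcomp \<O> n 1 i \<kappa> (\<nu> i)) [1..<Suc n] \<mu>"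

text \<open>\<open>P\<^bsup>\<otimes>n,I\<^esup>\<close> as the family of its tensor components.\<close>

definition tensor_pow :: "('k::field, 'a) operad \<Rightarrow> 'a \<Rightarrow> nat set \<Rightarrow> nat \<Rightarrow> 'a" where
  "tensor_pow \<O> p I = (\<lambda>i. if i \<in> I then unit \<O> else p)"


section \<open>Algebras over an operad\<close>

text \<open>
  A map \<open>A\<^sup>n \<rightarrow> A\<close> is encoded as a map on sequences \<open>x\<close> that only depends on \<open>x 1, \<dots>, x n\<close>.
\<close>

definition multilinear :: "('k::field \<Rightarrow> 'a::ab_group_add \<Rightarrow> 'a) \<Rightarrow> nat \<Rightarrow> ((nat \<Rightarrow> 'a) \<Rightarrow> 'a) \<Rightarrow> bool" where
  "multilinear scale n f \<longleftrightarrow>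
     (\<forall>x y. (\<forall>j\<in>{1..n}. x j = y j) \<longrightarrow> f x = f y) \<and>
     (\<forall>x. \<forall>j\<in>{1..n}. Vector_Spaces.linear scale scale (\<lambda>a. f (x(j := a))))"

definition End_operad :: "('k::field \<Rightarrow> 'a::ab_group_add \<Rightarrow> 'a) \<Rightarrow> ('k, (nat \<Rightarrow> 'a) \<Rightarrow> 'a) operad" where
  "End_operad scale = \<lparr>
     comps = (\<lambda>n. \<lparr>carrier = {f. multilinear scale n f}, monoid.mult = undefined, one = undefined,
       zero = (\<lambda>x. 0), add = (\<lambda>f g x. f x + g x), smult = (\<lambda>c f x. scale c (f x))\<rparr>),
     pcomp = (\<lambda>m n i f g x. f (\<lambda>j. if j = i then g (\<lambda>l. x (inner i l)) else x (outer i n j))),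
     sact = (\<lambda>n \<sigma> f x. f (x \<circ> \<sigma>)),
     unit = (\<lambda>x. x 1)\<rparr>"

definition operad_algebra ::
  "('k::field, 'p) operad \<Rightarrow> ('k \<Rightarrow> 'a::ab_group_add \<Rightarrow> 'a) \<Rightarrow> (nat \<Rightarrow> 'p \<Rightarrow> (nat \<Rightarrow> 'a) \<Rightarrow> 'a) \<Rightarrow> bool" where
  "operad_algebra \<P> scale \<phi> \<longleftrightarrow> vector_space scale \<and> operad_hom \<P> (End_operad scale) \<phi>"


section \<open>Labeled trees and the free operad\<close>

datatype 'v tree = Leaf nat | Node 'v "'v tree list"

text \<open>Leaf labels, from left to right.\<close>

primrec leaves :: "'v tree \<Rightarrow> nat list" where
  "leaves (Leaf i) = [i]"
| "leaves (Node w ts) = concat (map leaves ts)"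

abbreviation Lin :: "'v tree \<Rightarrow> nat set" where
  "Lin t \<equiv> set (leaves t)"

fun subtrees :: "'v tree \<Rightarrow> 'v tree set" where
  "subtrees (Leaf i) = {Leaf i}"
| "subtrees (Node w ts) = insert (Node w ts) (\<Union>t\<in>set ts. subtrees t)"

primrec subst :: "(nat \<Rightarrow> 'v tree) \<Rightarrow> 'v tree \<Rightarrow> 'v tree" where
  "subst s (Leaf i) = s i"
| "subst s (Node w ts) = Node w (map (subst s) ts)"

definition relabel :: "(nat \<Rightarrow> nat) \<Rightarrow> 'v tree \<Rightarrow> 'v tree" where
  "relabel \<sigma> = subst (\<lambda>i. Leaf (\<sigma> i))"

fun decorated :: "(nat \<Rightarrow> 'v set) \<Rightarrow> 'v tree \<Rightarrow> bool" where
  "decorated \<Omega> (Leaf i) \<longleftrightarrow> True"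
| "decorated \<Omega> (Node w ts) \<longleftrightarrow>
     ts \<noteq> [] \<and> w \<in> \<Omega> (length ts) \<and> (\<forall>t\<in>set ts. decorated \<Omega> t)"

text \<open>The (reduced, planar) labeled trees over \<open>\<Omega>\<close> with leaf labels \<open>1, \<dots>, n\<close>, in any order.\<close>

definition labeled_trees :: "(nat \<Rightarrow> 'v set) \<Rightarrow> nat \<Rightarrow> 'v tree set" where
  "labeled_trees \<Omega> n = {t. decorated \<Omega> t \<and> distinct (leaves t) \<and> Lin t = {1..n}}"

text \<open>
  A set-theoretic action of the symmetric groups on a graded set, i.e. an \<open>\<S>\<close>-module with an
  invariant basis: \<open>\<Omega> n\<close> is the basis in arity \<open>n\<close> and \<open>act n \<sigma> w\<close> is \<open>w\<^sup>\<sigma>\<close>.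
\<close>

definition sym_action :: "(nat \<Rightarrow> 'v set) \<Rightarrow> (nat \<Rightarrow> (nat \<Rightarrow> nat) \<Rightarrow> 'v \<Rightarrow> 'v) \<Rightarrow> bool" where
  "sym_action \<Omega> act \<longleftrightarrow> (\<forall>n\<ge>1. \<forall>w\<in>\<Omega> n.
     act n id w = w \<and>
     (\<forall>\<sigma>. \<sigma> permutes {1..n} \<longrightarrow> act n \<sigma> w \<in> \<Omega> n) \<and>
     (\<forall>\<sigma> \<tau>. \<sigma> permutes {1..n} \<longrightarrow> \<tau> permutes {1..n} \<longrightarrow> act n \<sigma> (act n \<tau> w) = act n (\<sigma> \<circ> \<tau>) w))"

text \<open>
  Isomorphism of decorated trees: up to isomorphism of the subtrees, it is the identification of
  \<open>w\<^sup>\<sigma>(t\<^sub>1 \<or> \<dots> \<or> t\<^sub>n)\<close> with \<open>w(t\<^bsub>\<sigma>(1)\<^esub> \<or> \<dots> \<or> t\<^bsub>\<sigma>(n)\<^esub>)\<close>.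
\<close>

inductive tree_iso ::
  "(nat \<Rightarrow> 'v set) \<Rightarrow> (nat \<Rightarrow> (nat \<Rightarrow> nat) \<Rightarrow> 'v \<Rightarrow> 'v) \<Rightarrow> 'v tree \<Rightarrow> 'v tree \<Rightarrow> bool"
  for \<Omega> :: "nat \<Rightarrow> 'v set" and act :: "nat \<Rightarrow> (nat \<Rightarrow> nat) \<Rightarrow> 'v \<Rightarrow> 'v" where
  "tree_iso \<Omega> act (Leaf i) (Leaf i)"
| "\<lbrakk>n \<ge> 1; length ts = n; length us = n; w \<in> \<Omega> n; \<sigma> permutes {1..n};
     \<And>i. i \<in> {1..n} \<Longrightarrow> tree_iso \<Omega> act (ts ! (\<sigma> i - 1)) (us ! (i - 1))\<rbrakk>
   \<Longrightarrow> tree_iso \<Omega> act (Node (act n \<sigma> w) ts) (Node w us)"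

definition iso_class ::
  "(nat \<Rightarrow> 'v set) \<Rightarrow> (nat \<Rightarrow> (nat \<Rightarrow> nat) \<Rightarrow> 'v \<Rightarrow> 'v) \<Rightarrow> 'v tree \<Rightarrow> 'v tree set" where
  "iso_class \<Omega> act t = {u. tree_iso \<Omega> act t u}"

definition representative :: "'v tree set \<Rightarrow> 'v tree" where
  "representative X = (SOME t. t \<in> X)"

definition tree_comp :: "nat \<Rightarrow> nat \<Rightarrow> 'v tree \<Rightarrow> 'v tree \<Rightarrow> 'v tree" where
  "tree_comp n i t u = subst (\<lambda>j. if j = i then relabel (inner i) u else Leaf (outer i n j)) t"

text \<open>
  The free operad on the \<open>\<S>\<close>-module with invariant basis \<open>\<Omega>\<close>; its component of arity \<open>n\<close> has as basis
  the isomorphism classes of decorated trees with leaf labels \<open>1, \<dots>, n\<close>.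
\<close>

definition free_operad ::
  "(nat \<Rightarrow> 'v set) \<Rightarrow> (nat \<Rightarrow> (nat \<Rightarrow> nat) \<Rightarrow> 'v \<Rightarrow> 'v) \<Rightarrow> ('k::field, 'v tree set \<Rightarrow>\<^sub>0 'k) operad" where
  "free_operad \<Omega> act = \<lparr>
     comps = (\<lambda>n. free_module (iso_class \<Omega> act ` labeled_trees \<Omega> n)),
     pcomp = (\<lambda>m n i f g. lin_ext (\<lambda>X. lin_ext (\<lambda>Y.
       vec (iso_class \<Omega> act (tree_comp n i (representative X) (representative Y)))) g) f),
     sact = (\<lambda>n \<sigma>. lin_ext (\<lambda>X. vec (iso_class \<Omega> act (relabel \<sigma> (representative X))))),
     unit = vec (iso_class \<Omega> act (Leaf 1))\<rparr>"

text \<open>The element of the free operad represented by a combination of planar labeled trees.\<close>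

definition tree_elem ::
  "(nat \<Rightarrow> 'v set) \<Rightarrow> (nat \<Rightarrow> (nat \<Rightarrow> nat) \<Rightarrow> 'v \<Rightarrow> 'v) \<Rightarrow> ('v tree \<Rightarrow>\<^sub>0 'k) \<Rightarrow> ('v tree set \<Rightarrow>\<^sub>0 'k::field)" where
  "tree_elem \<Omega> act = lin_ext (\<lambda>t. vec (iso_class \<Omega> act t))"

text \<open>\<open>\<T>(\<Omega>)/(S)\<close>, and the class in it of an element of arity \<open>n\<close> of \<open>\<T>(\<Omega>)\<close>.\<close>

definition presented_operad ::
  "(nat \<Rightarrow> 'v set) \<Rightarrow> (nat \<Rightarrow> (nat \<Rightarrow> nat) \<Rightarrow> 'v \<Rightarrow> 'v) \<Rightarrow> (nat \<Rightarrow> ('v tree set \<Rightarrow>\<^sub>0 'k::field) set)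
    \<Rightarrow> ('k, ('v tree set \<Rightarrow>\<^sub>0 'k) set) operad" where
  "presented_operad \<Omega> act S = quotient_operad (free_operad \<Omega> act) (op_ideal (free_operad \<Omega> act) S)"

definition presented_class ::
  "(nat \<Rightarrow> 'v set) \<Rightarrow> (nat \<Rightarrow> (nat \<Rightarrow> nat) \<Rightarrow> 'v \<Rightarrow> 'v) \<Rightarrow> (nat \<Rightarrow> ('v tree set \<Rightarrow>\<^sub>0 'k::field) set)
    \<Rightarrow> nat \<Rightarrow> ('v tree set \<Rightarrow>\<^sub>0 'k) \<Rightarrow> ('v tree set \<Rightarrow>\<^sub>0 'k) set" where
  "presented_class \<Omega> act S n f =
     op_ideal (free_operad \<Omega> act) S n +>\<^bsub>comps (free_operad \<Omega> act) n\<^esub> f"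


section \<open>The generating operations\<close>

text \<open>
  The \<open>\<S>\<close>-module \<open>V\<close> is given by its invariant basis \<open>\<V>\<close>, and \<open>V(n)\<close> is the set of formal combinations
  of \<open>\<V> n\<close>.  Since \<open>V(1) = k id\<close> and \<open>id\<close> is identified with the trivial tree, trees over \<open>\<V>\<close> only have
  vertices of arity at least 2, and \<open>\<T>(V)\<close> is the free operad on the \<open>\<V> n\<close> with \<open>n \<ge> 2\<close>.
\<close>

definition above_one :: "(nat \<Rightarrow> 'v set) \<Rightarrow> nat \<Rightarrow> 'v set" where
  "above_one \<V> n = (if n \<ge> 2 then \<V> n else {})"

definition gen_tree :: "nat \<Rightarrow> 'v \<Rightarrow> 'v tree" where
  "gen_tree n w = (if n = 1 then Leaf 1 else Node w (map Leaf [1..<Suc n]))"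

text \<open>The element of \<open>\<T>(V)(n)\<close> defined by an element of \<open>V(n)\<close>.\<close>

definition gen_elem ::
  "(nat \<Rightarrow> 'v set) \<Rightarrow> (nat \<Rightarrow> (nat \<Rightarrow> nat) \<Rightarrow> 'v \<Rightarrow> 'v) \<Rightarrow> nat \<Rightarrow> ('v \<Rightarrow>\<^sub>0 'k) \<Rightarrow> ('v tree set \<Rightarrow>\<^sub>0 'k::field)" where
  "gen_elem \<Omega> act n v = tree_elem \<Omega> act (lin_ext (\<lambda>w. vec (gen_tree n w)) v)"

text \<open>
  The relations \<open>R n\<close> are combinations of planar labeled trees with leaf labels \<open>1, \<dots>, n\<close>, so that they
  are locally homogeneous.
\<close>

definition locally_homogeneous ::
  "(nat \<Rightarrow> 'v set) \<Rightarrow> (nat \<Rightarrow> ('v tree \<Rightarrow>\<^sub>0 'k::field) set) \<Rightarrow> bool" where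
  "locally_homogeneous \<V> R \<longleftrightarrow>
     (\<forall>n\<ge>1. \<forall>r\<in>R n. Poly_Mapping.keys r \<subseteq> labeled_trees (above_one \<V>) n)"

definition P_rel ::
  "(nat \<Rightarrow> 'v set) \<Rightarrow> (nat \<Rightarrow> (nat \<Rightarrow> nat) \<Rightarrow> 'v \<Rightarrow> 'v) \<Rightarrow> (nat \<Rightarrow> ('v tree \<Rightarrow>\<^sub>0 'k::field) set)
    \<Rightarrow> nat \<Rightarrow> ('v tree set \<Rightarrow>\<^sub>0 'k) set" where
  "P_rel \<V> act R n = tree_elem (above_one \<V>) act ` R n"

definition P_operad where
  "P_operad \<V> act R = presented_operad (above_one \<V>) act (P_rel \<V> act R)"

definition P_gen where
  "P_gen \<V> act R n v =
     presented_class (above_one \<V>) act (P_rel \<V> act R) n (gen_elem (above_one \<V>) act n v)"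


section \<open>Configurations and splitting\<close>

text \<open>\<open>J \<sqinter> \<omega>\<close> for the root \<open>\<omega>\<close> of \<open>\<omega>(t\<^sub>1 \<or> \<dots> \<or> t\<^sub>l)\<close>.\<close>

definition meet :: "nat set \<Rightarrow> 'v tree list \<Rightarrow> nat set" where
  "meet J ts = {i \<in> {1..length ts}. J \<inter> Lin (ts ! (i - 1)) \<noteq> {}}"

text \<open>
  The decorations play no role in the definition of a configuration, so they are taken in \<^typ>\<open>unit\<close>;
  numbering the leaves from left to right amounts to requiring that their labels are \<open>1, \<dots>, n\<close> in this
  order.
\<close>

definition configuration :: "(nat \<Rightarrow> nat set set) \<Rightarrow> bool" where
  "configuration C \<longleftrightarrow>
     (\<forall>n\<ge>1. C n \<subseteq> {I. I \<subseteq> {1..n} \<and> I \<noteq> {}}) \<and>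
     (\<forall>n\<ge>1. \<forall>t\<in>labeled_trees (\<lambda>_. UNIV :: unit set) n. leaves t = [1..<Suc n] \<longrightarrow>
       (\<forall>J\<in>C n. \<forall>w ts. Node w ts \<in> subtrees t \<longrightarrow> meet J ts \<noteq> {} \<longrightarrow> meet J ts \<in> C (length ts)))"

definition S_invariant :: "(nat \<Rightarrow> nat set set) \<Rightarrow> bool" where
  "S_invariant C \<longleftrightarrow> (\<forall>n\<ge>1. \<forall>\<sigma> I. \<sigma> permutes {1..n} \<longrightarrow> I \<in> C n \<longrightarrow> \<sigma> ` I \<in> C n)"

text \<open>The basis elements \<open>(\<omega>, I)\<close> stand for \<open>\<omega> \<otimes> e\<^sub>I\<close>.\<close>

definition CSp_basis :: "(nat \<Rightarrow> 'v set) \<Rightarrow> (nat \<Rightarrow> nat set set) \<Rightarrow> nat \<Rightarrow> ('v \<times> nat set) set" where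
  "CSp_basis \<V> C n = \<V> n \<times> C n"

definition CSp_act ::
  "(nat \<Rightarrow> (nat \<Rightarrow> nat) \<Rightarrow> 'v \<Rightarrow> 'v) \<Rightarrow> nat \<Rightarrow> (nat \<Rightarrow> nat) \<Rightarrow> 'v \<times> nat set \<Rightarrow> 'v \<times> nat set" where
  "CSp_act act n \<sigma> = (\<lambda>(w, I). (act n \<sigma> w, \<sigma> ` I))"

definition tensor_e :: "('v \<Rightarrow>\<^sub>0 'k) \<Rightarrow> nat set \<Rightarrow> ('v \<times> nat set \<Rightarrow>\<^sub>0 'k::field)" where
  "tensor_e v I = lin_ext (\<lambda>w. vec (w, I)) v"

definition tensor_star :: "(nat \<Rightarrow> nat set set) \<Rightarrow> nat \<Rightarrow> ('v \<Rightarrow>\<^sub>0 'k) \<Rightarrow> ('v \<times> nat set \<Rightarrow>\<^sub>0 'k::field)" where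
  "tensor_star C n v = (\<Sum>I\<in>C n. tensor_e v I)"

text \<open>The multilinear extension of \<open>w, t\<^sub>1, \<dots>, t\<^sub>l \<mapsto> w(t\<^sub>1 \<or> \<dots> \<or> t\<^sub>l)\<close>.\<close>

definition graft :: "('w \<Rightarrow>\<^sub>0 'k) \<Rightarrow> ('w tree \<Rightarrow>\<^sub>0 'k) list \<Rightarrow> ('w tree \<Rightarrow>\<^sub>0 'k::field)" where
  "graft v fs = (\<Sum>w\<in>Poly_Mapping.keys v. \<Sum>ts\<in>listset (map Poly_Mapping.keys fs).
     Poly_Mapping.single (Node w ts)
       (Poly_Mapping.lookup v w * prod_list (map2 Poly_Mapping.lookup fs ts)))"

text \<open>\<open>CSp_tree C t J\<close> is \<open>CSp\<^sub>J(t)\<close>, including the case \<open>J = {}\<close>.\<close>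

fun CSp_tree :: "(nat \<Rightarrow> nat set set) \<Rightarrow> 'v tree \<Rightarrow> nat set \<Rightarrow> (('v \<times> nat set) tree \<Rightarrow>\<^sub>0 'k::field)" where
  "CSp_tree C (Leaf i) J = vec (Leaf i)"
| "CSp_tree C (Node w ts) J =
     graft (if J = {} then tensor_star C (length ts) (vec w) else tensor_e (vec w) (meet J ts))
       (map (\<lambda>t. CSp_tree C t (J \<inter> Lin t)) ts)"

definition CSp_rel ::
  "(nat \<Rightarrow> 'v set) \<Rightarrow> (nat \<Rightarrow> (nat \<Rightarrow> nat) \<Rightarrow> 'v \<Rightarrow> 'v) \<Rightarrow> (nat \<Rightarrow> ('v tree \<Rightarrow>\<^sub>0 'k::field) set)
    \<Rightarrow> (nat \<Rightarrow> nat set set) \<Rightarrow> nat \<Rightarrow> (('v \<times> nat set) tree set \<Rightarrow>\<^sub>0 'k) set" where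
  "CSp_rel \<V> act R C n =
     {tree_elem (above_one (CSp_basis \<V> C)) (CSp_act act) (lin_ext (\<lambda>t. CSp_tree C t J) r) |r J.
        r \<in> R n \<and> J \<in> C n}"

definition CSp_operad where
  "CSp_operad \<V> act R C =
     presented_operad (above_one (CSp_basis \<V> C)) (CSp_act act) (CSp_rel \<V> act R C)"

definition CSp_gen where
  "CSp_gen \<V> act R C n v =
     presented_class (above_one (CSp_basis \<V> C)) (CSp_act act) (CSp_rel \<V> act R C) n
       (gen_elem (above_one (CSp_basis \<V> C)) (CSp_act act) n v)"


section \<open>Rota-Baxter operators\<close>

datatype 'v rb = Op 'v | RB

text \<open>The basis of \<open>V\<^sub>P\<close>: here the unary generator is the new symbol \<open>P\<close>, called \<^const>\<open>RB\<close>.\<close>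

definition rb_basis :: "(nat \<Rightarrow> 'v set) \<Rightarrow> nat \<Rightarrow> 'v rb set" where
  "rb_basis \<V> n = (if n = 1 then {RB} else Op ` above_one \<V> n)"

primrec rb_act :: "(nat \<Rightarrow> (nat \<Rightarrow> nat) \<Rightarrow> 'v \<Rightarrow> 'v) \<Rightarrow> nat \<Rightarrow> (nat \<Rightarrow> nat) \<Rightarrow> 'v rb \<Rightarrow> 'v rb" where
  "rb_act act n \<sigma> (Op w) = Op (act n \<sigma> w)"
| "rb_act act n \<sigma> RB = RB"

text \<open>The elements of \<open>\<T>(V\<^sub>P)\<close> defined by \<open>v \<in> V(n)\<close> (for \<open>n = 1\<close>, a multiple of the unit) and by \<open>P\<close>.\<close>

definition rb_op ::
  "(nat \<Rightarrow> 'v set) \<Rightarrow> (nat \<Rightarrow> (nat \<Rightarrow> nat) \<Rightarrow> 'v \<Rightarrow> 'v) \<Rightarrow> nat \<Rightarrow> ('v \<Rightarrow>\<^sub>0 'k)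
    \<Rightarrow> ('v rb tree set \<Rightarrow>\<^sub>0 'k::field)" where
  "rb_op \<V> act n v = gen_elem (rb_basis \<V>) (rb_act act) n (lin_ext (\<lambda>w. vec (Op w)) v)"

definition rb_P ::
  "(nat \<Rightarrow> 'v set) \<Rightarrow> (nat \<Rightarrow> (nat \<Rightarrow> nat) \<Rightarrow> 'v \<Rightarrow> 'v) \<Rightarrow> ('v rb tree set \<Rightarrow>\<^sub>0 'k::field)" where
  "rb_P \<V> act = vec (iso_class (rb_basis \<V>) (rb_act act) (Node RB [Leaf 1]))"

definition RB_rel ::
  "(nat \<Rightarrow> 'v set) \<Rightarrow> (nat \<Rightarrow> (nat \<Rightarrow> nat) \<Rightarrow> 'v \<Rightarrow> 'v) \<Rightarrow> (nat \<Rightarrow> nat set set) \<Rightarrow> nat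
    \<Rightarrow> ('v rb tree set \<Rightarrow>\<^sub>0 'k::field) set" where
  "RB_rel \<V> act C n = (let F = free_operad (rb_basis \<V>) (rb_act act); p = rb_P \<V> act in
     {comp_unary F n (rb_op \<V> act n v) (tensor_pow F p {}) -
        (\<Sum>I\<in>C n. pcomp F 1 n 1 p (comp_unary F n (rb_op \<V> act n v) (tensor_pow F p I))) |v.
      Poly_Mapping.keys v \<subseteq> \<V> n})"

definition CRB_rel ::
  "(nat \<Rightarrow> 'v set) \<Rightarrow> (nat \<Rightarrow> (nat \<Rightarrow> nat) \<Rightarrow> 'v \<Rightarrow> 'v) \<Rightarrow> (nat \<Rightarrow> ('v tree \<Rightarrow>\<^sub>0 'k::field) set)
    \<Rightarrow> (nat \<Rightarrow> nat set set) \<Rightarrow> nat \<Rightarrow> ('v rb tree set \<Rightarrow>\<^sub>0 'k) set" where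
  "CRB_rel \<V> act R C n =
     (\<lambda>r. tree_elem (rb_basis \<V>) (rb_act act) (lin_ext (\<lambda>t. vec (map_tree Op t)) r)) ` R n \<union>
     RB_rel \<V> act C n"

definition CRB_operad where
  "CRB_operad \<V> act R C = presented_operad (rb_basis \<V>) (rb_act act) (CRB_rel \<V> act R C)"

definition CRB_op where
  "CRB_op \<V> act R C n v =
     presented_class (rb_basis \<V>) (rb_act act) (CRB_rel \<V> act R C) n (rb_op \<V> act n v)"

definition CRB_P where
  "CRB_P \<V> act R C =
     presented_class (rb_basis \<V>) (rb_act act) (CRB_rel \<V> act R C) 1 (rb_P \<V> act)"

text \<open>
  \<open>C\<close>-Rota-Baxter operators of weight one on a space \<open>A\<close> with operations \<open>opn n v\<close>, \<open>v \<in> V(n)\<close>.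
\<close>

definition rota_baxter ::
  "(nat \<Rightarrow> 'v set) \<Rightarrow> (nat \<Rightarrow> nat set set) \<Rightarrow> ('k::field \<Rightarrow> 'a::ab_group_add \<Rightarrow> 'a)
    \<Rightarrow> (nat \<Rightarrow> ('v \<Rightarrow>\<^sub>0 'k) \<Rightarrow> (nat \<Rightarrow> 'a) \<Rightarrow> 'a) \<Rightarrow> ('a \<Rightarrow> 'a) \<Rightarrow> bool" where
  "rota_baxter \<V> C scale opn P \<longleftrightarrow>
     Vector_Spaces.linear scale scale P \<and>
     (\<forall>n\<ge>1. \<forall>v. Poly_Mapping.keys v \<subseteq> \<V> n \<longrightarrow>
       (\<forall>x. opn n v (\<lambda>j. P (x j)) =
          P (\<Sum>I\<in>C n. opn n v (\<lambda>j. if j \<in> I then x j else P (x j)))))"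

end

theory Submission
  imports Defs
begin

text \<open>
  Let \<open>P\<close> be a Rota-Baxter operator.  By induction on a tree \<open>\<tau>\<close>, evaluating the splitting with
  \<open>(\<omega>, e\<^sub>I) \<mapsto> \<omega> \<circ> P\<^bsup>\<otimes>n,I\<^esup>\<close> sends \<open>CSp\<^sub>J(\<tau>)\<close> to \<open>\<tau>\<close> with \<open>P\<close> applied to the inputs outside \<open>J\<close>; the inputs of a
  vertex that \<open>J\<close> does not meet carry \<open>P(CSp\<^sub>\<emptyset>(\<sigma>))\<close>, which the Rota-Baxter identity turns into \<open>\<sigma>\<close> with
  \<open>P\<close> applied to all inputs.  Hence a relation of \<open>\<P>\<close> kills all its splittings.

  For algebras this is a computation with evaluated trees.  For operads the same computation is made with
  planar trees over \<open>V\<^sub>P\<close>, with arbitrary leaf labels, modulo the subspace spanned by the relations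
  substituted into contexts.  What remains is that the part of this subspace with leaf labels \<open>1, \<dots>, n\<close>
  maps into the operadic ideal, because substitution and plugging into a context are iterated partial
  compositions followed by a permutation of the inputs.
\<close>

text \<open>The induction needs a single space on which all vertices act. The subtrees at a vertex
  have different arities, and their label sets need not be intervals, so they do not live in one
  component of an operad. Combinations of planar trees with unrestricted labels form such a space:
  grafting is multilinear on it and \<open>P\<close> adds a unary vertex. The Rota-Baxter identity
  holds there only modulo the consequences of the relations, so these have to be stable under
  grafting; this dictates that relations are substituted into arbitrary trees and arbitrary
  contexts. The two closure properties of \<open>C\<close> serve different purposes. Stability under
  meets keeps every decoration of \<open>CSp_tree\<close> inside the basis of the split operad.
  Invariance under permutations extends this from labels in increasing order to all labelings, and
  keeps the split basis stable under the action.\<close>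

abbreviation (input) keys :: "('b \<Rightarrow>\<^sub>0 'k::zero) \<Rightarrow> 'b set" where
  "keys \<equiv> Poly_Mapping.keys"

abbreviation (input) lookup :: "('b \<Rightarrow>\<^sub>0 'k::zero) \<Rightarrow> 'b \<Rightarrow> 'k" where
  "lookup \<equiv> Poly_Mapping.lookup"

section \<open>Linear algebra of finitely supported functions\<close>

lemma lookup_scal [simp]: "lookup (scal c f) b = c * lookup f b"
  unfolding scal_def by (simp add: Poly_Mapping.map.rep_eq when_def)

lemma vector_space_scal: "vector_space (scal :: 'k::field \<Rightarrow> ('b \<Rightarrow>\<^sub>0 'k) \<Rightarrow> _)"
  by standard (auto intro!: poly_mapping_eqI simp: lookup_add algebra_simps)

interpretation PM: vector_space "scal :: 'k::field \<Rightarrow> ('b \<Rightarrow>\<^sub>0 'k) \<Rightarrow> _"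
  by (rule vector_space_scal)

lemma keys_scal: "keys (scal c f) \<subseteq> keys f"
  by (auto simp: in_keys_iff)

lemma vec_expand: "f = (\<Sum>b\<in>keys f. scal (lookup f b) (vec b))"
proof (rule poly_mapping_eqI)
  fix a
  have "(\<Sum>b\<in>keys f. lookup f b * (1 when b = a)) =
    (\<Sum>b\<in>keys f. if b = a then lookup f a else 0)"
    by (rule sum.cong) (auto simp: when_def)
  also have "\<dots> = lookup f a"
    by (simp add: in_keys_iff)
  finally show "lookup f a =
    lookup (\<Sum>b\<in>keys f. scal (lookup f b) (vec b)) a"
    by (simp add: lookup_sum lookup_single)
qed

lemma in_span_vec: "keys f \<subseteq> X \<Longrightarrow> f \<in> PM.span (vec ` X)"
proof -
  assume "keys f \<subseteq> X"
  then have "(\<Sum>b\<in>keys f. scal (lookup f b) (vec b)) \<in> PM.span (vec ` X)"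
    by (intro PM.span_sum PM.span_scale PM.span_base) auto
  then show ?thesis by (simp only: vec_expand[symmetric])
qed

lemma in_span_vec_UNIV: "f \<in> PM.span (range vec)"
  by (rule in_span_vec) simp

text \<open>\<open>lin_ext\<close> takes values in a free module only. Evaluating combinations of
  trees in an algebra requires a target with its own scalar multiplication.\<close>

definition lin_to ::
  "('k::field \<Rightarrow> 'a::ab_group_add \<Rightarrow> 'a) \<Rightarrow> ('b \<Rightarrow> 'a) \<Rightarrow> ('b \<Rightarrow>\<^sub>0 'k) \<Rightarrow> 'a" where
  "lin_to scale g f = (\<Sum>b\<in>keys f. scale (lookup f b) (g b))"

lemma lin_ext_eq_lin_to: "lin_ext g = lin_to scal g"
  by (simp add: lin_ext_def lin_to_def fun_eq_iff)

context vector_space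
begin

text \<open>The supports of \<open>f\<close>, \<open>f'\<close> and \<open>f + f'\<close> differ, so
  linearity is compared on a common finite set containing them; the additional summands have
  coefficient zero.\<close>

lemma lin_to_superset:
  assumes "finite S" "keys f \<subseteq> S"
  shows "lin_to scale g f = (\<Sum>b\<in>S. scale (lookup f b) (g b))"
  unfolding lin_to_def
  by (rule sum.mono_neutral_left) (use assms in \<open>auto simp: in_keys_iff\<close>)

lemma lin_to_vec [simp]: "lin_to scale g (vec b) = g b"
  by (simp add: lin_to_def)

lemma lin_to_add: "lin_to scale g (f + f') = lin_to scale g f + lin_to scale g f'"
proof -
  let ?S = "keys f \<union> keys f'"
  have "keys (f + f') \<subseteq> ?S" by (rule Poly_Mapping.keys_add)
  then show ?thesis
    by (simp add: lin_to_superset[of ?S] lookup_add scale_left_distrib sum.distrib)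
qed

lemma lin_to_scale: "lin_to scale g (scal c f) = scale c (lin_to scale g f)"
  by (simp add: lin_to_superset[of "keys f", OF _ keys_scal]
      lin_to_superset[of "keys f" f] scale_sum_right)

lemma linear_lin_to: "Vector_Spaces.linear scal scale (lin_to scale g)"
  by (simp add: Vector_Spaces.linear_iff vector_space_scal vector_space_axioms lin_to_add lin_to_scale)

end

lemmas lin_ext_vec [simp] =
  PM.lin_to_vec[folded lin_ext_eq_lin_to]
lemmas linear_lin_ext = PM.linear_lin_to[folded lin_ext_eq_lin_to]

lemmas linear_add = Vector_Spaces.linear_iff[THEN iffD1, THEN conjunct2, THEN conjunct2, THEN conjunct1, rule_format]
lemmas linear_scale = Vector_Spaces.linear_iff[THEN iffD1, THEN conjunct2, THEN conjunct2, THEN conjunct2, rule_format]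

lemma linear_comp: "Vector_Spaces.linear s2 s3 g \<Longrightarrow> Vector_Spaces.linear s1 s2 f \<Longrightarrow>
    Vector_Spaces.linear s1 s3 (\<lambda>x. g (f x))"
  using Vector_Spaces.linear_compose[of s1 s2 f s3 g] by (simp add: o_def)

lemma linear_sub:
  "Vector_Spaces.linear s1 s2 f \<Longrightarrow> Vector_Spaces.linear s1 s2 g \<Longrightarrow> Vector_Spaces.linear s1 s2 (\<lambda>x. f x - g x)"
  by (rule vector_space_pair.linear_compose_sub)
    (auto simp: Vector_Spaces.linear_iff vector_space_pair_def)

text \<open>Used for the second argument of a partial composition, which enters through the images
  of the basis elements.\<close>

lemma linear_lin_ext_arg:
  assumes "\<And>b. Vector_Spaces.linear s scal (\<lambda>x. g x b)" "vector_space s"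
  shows "Vector_Spaces.linear s scal (\<lambda>x. lin_ext (g x) f)"
  using assms unfolding Vector_Spaces.linear_iff lin_ext_def
  by (simp add: PM.scale_right_distrib sum.distrib PM.scale_sum_right mult.commute)

text \<open>Identities in the free operad hold for trees with the labels of a given arity, so
  agreement is asked on \<open>X\<close> and concluded for combinations supported in
  \<open>X\<close>.\<close>

lemma linear_eq_on_keys:
  fixes f g :: "('b \<Rightarrow>\<^sub>0 'k::field) \<Rightarrow> 'a::ab_group_add"
  assumes "Vector_Spaces.linear scal s f" "Vector_Spaces.linear scal s g"
    "\<And>b. b \<in> X \<Longrightarrow> f (vec b) = g (vec b)" "keys v \<subseteq> X"
  shows "f v = g v"
proof -
  interpret vector_space_pair "scal :: 'k \<Rightarrow> ('b \<Rightarrow>\<^sub>0 'k) \<Rightarrow> _" s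
    using assms(1) unfolding Vector_Spaces.linear_iff by (intro vector_space_pair.intro) blast+
  show ?thesis
    by (rule linear_eq_on[OF assms(1,2) in_span_vec[OF assms(4)]]) (use assms(3) in auto)
qed

lemma linear_in_subspace:
  assumes "Vector_Spaces.linear scal s f" "Modules.module.subspace s K"
    "\<And>b. b \<in> X \<Longrightarrow> f (vec b) \<in> K" "keys v \<subseteq> X"
  shows "f v \<in> K"
proof -
  interpret Vector_Spaces.linear scal s f by fact
  have "f v = (\<Sum>b\<in>keys v. s (lookup v b) (f (vec b)))"
    by (subst vec_expand) (simp add: sum scale)
  also have "\<dots> \<in> K"
    using assms by (auto intro!: vs2.subspace_sum vs2.subspace_scale)
  finally show ?thesis .
qed

lemma keys_lin_ext:
  assumes "\<And>b. b \<in> keys f \<Longrightarrow> keys (g b) \<subseteq> Y"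
  shows "keys (lin_ext g f) \<subseteq> Y"
proof -
  have "keys (lin_ext g f) \<subseteq>
      (\<Union>b\<in>keys f. keys (scal (lookup f b) (g b)))"
    unfolding lin_ext_def by (rule keys_sum)
  also have "\<dots> \<subseteq> Y"
  proof (rule UN_least)
    fix b assume "b \<in> keys f"
    then show "keys (scal (lookup f b) (g b)) \<subseteq> Y"
      using keys_scal[of "lookup f b" "g b"] assms by (meson order_trans)
  qed
  finally show ?thesis .
qed

definition map_basis :: "('b \<Rightarrow> 'c) \<Rightarrow> ('b \<Rightarrow>\<^sub>0 'k) \<Rightarrow> ('c \<Rightarrow>\<^sub>0 'k::field)" where
  "map_basis g = lin_ext (\<lambda>t. vec (g t))"

lemma linear_map_basis: "Vector_Spaces.linear scal scal (map_basis g)"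
  unfolding map_basis_def by (rule linear_lin_ext)

lemma map_basis_vec [simp]: "map_basis g (vec t) = vec (g t)"
  by (simp add: map_basis_def)

lemma map_basis_add: "map_basis g (f + f') = map_basis g f + map_basis g f'"
  and map_basis_scal: "map_basis g (scal c f) = scal c (map_basis g f)"
  using linear_map_basis[of g] unfolding Vector_Spaces.linear_iff by blast+

lemma map_basis_cong:
  "(\<And>t. t \<in> keys f \<Longrightarrow> g t = g' t) \<Longrightarrow> map_basis g f = map_basis g' f"
  by (simp add: map_basis_def lin_ext_def)

lemma map_basis_map_basis: "map_basis g (map_basis g' f) = map_basis (\<lambda>t. g (g' t)) f"
  by (rule linear_eq_on_keys[OF linear_comp[OF linear_map_basis linear_map_basis] linear_map_basis, of UNIV])
    simp_all

lemma keys_map_basis: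
  "keys f \<subseteq> X \<Longrightarrow> (\<And>t. t \<in> X \<Longrightarrow> g t \<in> Y) \<Longrightarrow> keys (map_basis g f) \<subseteq> Y"
  unfolding map_basis_def by (intro keys_lin_ext) auto

section \<open>Multilinear maps\<close>

text \<open>Source and target may carry different scalar multiplications, as in the evaluation of a
  graft, which leads from combinations of trees to an algebra.\<close>

definition multilin ::
  "('k::field \<Rightarrow> 'b::ab_group_add \<Rightarrow> 'b) \<Rightarrow> ('k \<Rightarrow> 'a::ab_group_add \<Rightarrow> 'a) \<Rightarrow> nat \<Rightarrow> ((nat \<Rightarrow> 'b) \<Rightarrow> 'a) \<Rightarrow> bool" where
  "multilin s1 s2 n f \<longleftrightarrow>
     (\<forall>x y. (\<forall>j\<in>{1..n}. x j = y j) \<longrightarrow> f x = f y) \<and>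
     (\<forall>x. \<forall>j\<in>{1..n}. Vector_Spaces.linear s1 s2 (\<lambda>a. f (x(j := a))))"

lemma multilinear_eq_multilin: "multilinear s n f = multilin s s n f"
  by (simp add: multilinear_def multilin_def)

lemma multilin_cong: "multilin s1 s2 n f \<Longrightarrow> (\<And>j. j \<in> {1..n} \<Longrightarrow> x j = y j) \<Longrightarrow> f x = f y"
  unfolding multilin_def by blast

text \<open>The arguments are freed one at a time: after \<open>m\<close> rounds the first
  \<open>m\<close> range over the spans, the others still over the generators. The generating set
  \<open>B i\<close> may depend on the argument, so that one slot can run through generators of an
  ideal and the other slots through trees.\<close>

lemma multilin_span_induct:
  assumes f: "multilin s1 s2 n f" and "vector_space s1"
    and K: "Modules.module.subspace s2 K"
    and x: "\<And>i. i \<in> {1..n} \<Longrightarrow> x i \<in> Modules.module.span s1 (B i)"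
    and B: "\<And>y. (\<And>i. i \<in> {1..n} \<Longrightarrow> y i \<in> B i) \<Longrightarrow> f y \<in> K"
  shows "f x \<in> K"
proof -
  interpret v1: vector_space s1 by fact
  have "m \<le> n \<Longrightarrow> (\<And>i. i \<in> {1..m} \<Longrightarrow> x i \<in> v1.span (B i)) \<Longrightarrow>
    (\<And>i. i \<in> {m+1..n} \<Longrightarrow> x i \<in> B i) \<Longrightarrow> f x \<in> K" for m x
  proof (induction m arbitrary: x)
    case 0
    then show ?case by (intro B) auto
  next
    case (Suc m)
    let ?L = "\<lambda>a. f (x(Suc m := a))"
    interpret L: Vector_Spaces.linear s1 s2 ?L
      using f Suc.prems(1) unfolding multilin_def by auto
    have "x (Suc m) \<in> v1.span (B (Suc m))" using Suc.prems by auto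
    then have "?L (x (Suc m)) \<in> K"
    proof (induction rule: v1.span_induct_alt)
      case base
      have "?L 0 \<in> K" unfolding L.zero using K by (rule L.vs2.subspace_0)
      then show ?case .
    next
      case (step c a b)
      have "?L a \<in> K"
        by (rule Suc.IH) (use Suc.prems step in auto)
      then have "s2 c (?L a) + ?L b \<in> K"
        using step K by (intro L.vs2.subspace_add L.vs2.subspace_scale)
      then show ?case by (simp only: L.add L.scale)
    qed
    then show ?case by simp
  qed
  from this[of n x] x show ?thesis by auto
qed

lemma multilin_diff:
  assumes "multilin s1 s2 n f" "multilin s1 s2 n g" "vector_space s1" "vector_space s2"
  shows "multilin s1 s2 n (\<lambda>x. f x - g x)"
proof -
  interpret vector_space_pair s1 s2 using assms by (intro vector_space_pair.intro)
  show ?thesis unfolding multilin_def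
  proof safe
    fix x y :: "nat \<Rightarrow> 'b" assume "\<forall>j\<in>{1..n}. x j = y j"
    then show "f x - g x = f y - g y"
      using multilin_cong[OF assms(1), of x y] multilin_cong[OF assms(2), of x y] by auto
  next
    fix x :: "nat \<Rightarrow> 'b" and j assume "j \<in> {1..n}"
    then show "Vector_Spaces.linear s1 s2 (\<lambda>a. f (x(j := a)) - g (x(j := a)))"
      using assms(1,2) unfolding multilin_def by (intro linear_compose_sub) auto
  qed
qed

lemma multilin_sum:
  assumes "vector_space s1" "vector_space s2" "\<And>i. i \<in> A \<Longrightarrow> multilin s1 s2 n (f i)"
  shows "multilin s1 s2 n (\<lambda>x. \<Sum>i\<in>A. f i x)"
proof -
  interpret s2: vector_space s2 by fact
  have "f i x = f i y" if "i \<in> A" "\<forall>j\<in>{1..n}. x j = y j" for i x y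
    using assms(3)[OF that(1)] that(2) unfolding multilin_def by blast
  moreover have "Vector_Spaces.linear s1 s2 (\<lambda>a. f i (x(j := a)))" if "i \<in> A" "j \<in> {1..n}" for i x j
    using assms(3)[OF that(1)] that(2) unfolding multilin_def by blast
  ultimately show ?thesis
    unfolding multilin_def Vector_Spaces.linear_iff
    using assms(1,2) by (auto intro!: sum.cong simp: sum.distrib s2.scale_sum_right)
qed

lemma multilin_eq:
  fixes f g :: "(nat \<Rightarrow> 'b \<Rightarrow>\<^sub>0 'k::field) \<Rightarrow> 'a::ab_group_add"
  assumes f: "multilin scal s n f" "multilin scal s n g" and "vector_space s"
    and B: "\<And>t. f (\<lambda>i. vec (t i)) = g (\<lambda>i. vec (t i))"
  shows "f x = g x"
proof -
  interpret vector_space s by fact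
  \<comment> \<open>Equality is membership of the difference in the zero subspace, to which the
    induction over spanning sets applies.\<close>
  have "f x - g x \<in> {0}"
  proof (rule multilin_span_induct[where B = "\<lambda>_. range vec"])
    show "multilin scal s n (\<lambda>x. f x - g x)" using assms vector_space_scal
      by (intro multilin_diff) auto
    fix y assume y: "\<And>i. i \<in> {1..n} \<Longrightarrow> y i \<in> (range vec :: ('b \<Rightarrow>\<^sub>0 'k) set)"
    then have "\<forall>i. \<exists>t. i \<in> {1..n} \<longrightarrow> y i = vec t" by blast
    from choice[OF this] obtain t where t: "\<And>i. i \<in> {1..n} \<Longrightarrow> y i = vec (t i)" by blast
    have "f y = f (\<lambda>i. vec (t i))" "g y = g (\<lambda>i. vec (t i))"
      using t by (auto intro: multilin_cong f)
    then show "f y - g y \<in> {0}" using B by simp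
  qed (rule vector_space_scal subspace_single_0 in_span_vec_UNIV)+
  then show ?thesis by simp
qed

lemma multilin_compose:
  assumes f: "multilin s2 s3 n f" and g: "\<And>i. Vector_Spaces.linear s1 s2 (g i)"
  shows "multilin s1 s3 n (\<lambda>x. f (\<lambda>i. g i (x i)))"
  unfolding multilin_def
proof safe
  fix x y :: "nat \<Rightarrow> 'd" assume "\<forall>j\<in>{1..n}. x j = y j"
  then show "f (\<lambda>i. g i (x i)) = f (\<lambda>i. g i (y i))" by (intro multilin_cong[OF f]) auto
next
  fix x :: "nat \<Rightarrow> 'd" and j assume "j \<in> {1..n}"
  then have "Vector_Spaces.linear s2 s3 (\<lambda>a. f ((\<lambda>i. g i (x i))(j := a)))"
    using f unfolding multilin_def by blast
  from Vector_Spaces.linear_compose[OF g[of j] this]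
  have "Vector_Spaces.linear s1 s3 (\<lambda>a. f ((\<lambda>i. g i (x i))(j := g j a)))" by (simp add: o_def)
  moreover have "(\<lambda>i. g i (x i))(j := g j a) = (\<lambda>i. g i ((x(j := a)) i))" for a by auto
  ultimately show "Vector_Spaces.linear s1 s3 (\<lambda>a. f (\<lambda>i. g i ((x(j := a)) i)))" by simp
qed

lemma linear_multilin_compose:
  assumes g: "Vector_Spaces.linear s2 s3 g" and f: "multilin s1 s2 n f"
  shows "multilin s1 s3 n (\<lambda>x. g (f x))"
  unfolding multilin_def
proof (intro conjI allI impI ballI)
  fix x y :: "nat \<Rightarrow> 'd" assume "\<forall>j\<in>{1..n}. x j = y j"
  then show "g (f x) = g (f y)" using multilin_cong[OF f, of x y] by auto
next
  fix x :: "nat \<Rightarrow> 'd" and j assume "j \<in> {1..n}"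
  then have "Vector_Spaces.linear s1 s2 (\<lambda>a. f (x(j := a)))"
    using f unfolding multilin_def by blast
  from Vector_Spaces.linear_compose[OF this g]
  show "Vector_Spaces.linear s1 s3 (\<lambda>a. g (f (x(j := a))))" by (simp add: o_def)
qed

section \<open>Grafting\<close>

lemma lookup_graft_Leaf [simp]: "lookup (graft v fs) (Leaf i) = 0"
  by (simp add: graft_def lookup_sum lookup_single)

lemma finite_listset: "(\<And>A. A \<in> set As \<Longrightarrow> finite A) \<Longrightarrow> finite (listset As)"
  by (induction As) (auto simp: set_Cons_def intro!: finite_image_set2)

lemma in_listset_iff: "xs \<in> listset As \<longleftrightarrow> list_all2 (\<in>) xs As"
  by (induction As arbitrary: xs) (auto simp: set_Cons_def list_all2_Cons2)

lemma lookup_graft_Node: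
  "lookup (graft v fs) (Node w ts) =
     (if length ts = length fs
      then lookup v w * prod_list (map2 lookup fs ts) else 0)"
proof -
  let ?L = "listset (map keys fs)"
  let ?c = "\<lambda>w ts. lookup v w * prod_list (map2 lookup fs ts)"
  have fin: "finite ?L" by (rule finite_listset) auto
  have "lookup (graft v fs) (Node w ts) =
    (\<Sum>w'\<in>keys v. \<Sum>ts'\<in>?L. if w' = w then if ts' = ts then ?c w ts else 0 else 0)"
    by (simp add: graft_def lookup_sum lookup_single when_def) (intro sum.cong refl, auto)
  also have "\<dots> = (\<Sum>w'\<in>keys v. if w' = w then (if ts \<in> ?L then ?c w ts else 0) else 0)"
    using fin by (intro sum.cong refl) (simp add: sum.delta)
  also have "\<dots> = (if w \<in> keys v \<and> ts \<in> ?L then ?c w ts else 0)"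
    by (simp add: sum.delta)
  also have "\<dots> = (if length ts = length fs then ?c w ts else 0)"
  proof -
    have "ts \<in> ?L \<longleftrightarrow> length ts = length fs \<and> (\<forall>i<length fs. lookup (fs ! i) (ts ! i) \<noteq> 0)"
      by (auto simp: in_listset_iff list_all2_conv_all_nth in_keys_iff)
    moreover have "prod_list (map2 lookup fs ts) \<noteq> 0 \<longleftrightarrow>
        (\<forall>i<length fs. lookup (fs ! i) (ts ! i) \<noteq> 0)" if "length ts = length fs"
      using that by (auto simp: prod_list_zero_iff set_zip image_iff)
    ultimately show ?thesis by (auto simp: in_keys_iff)
  qed
  finally show ?thesis .
qed

text \<open>Inputs are numbered from 1 and lists from 0, whence the shift between
  \<open>x (Suc i)\<close> and \<open>! i\<close>.\<close>

definition args :: "nat \<Rightarrow> (nat \<Rightarrow> 'b) \<Rightarrow> 'b list" where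
  "args n x = map x [1..<Suc n]"

lemma length_args [simp]: "length (args n x) = n"
  by (simp add: args_def)

lemma nth_args [simp]: "i < n \<Longrightarrow> args n x ! i = x (Suc i)"
  by (simp add: args_def del: upt_Suc)

lemma map_nth_args: "map f ts = args (length ts) (\<lambda>j. f (ts ! (j - 1)))"
  by (rule nth_equalityI) auto

lemma map_nth_eq: "j \<in> {1..length ts} \<Longrightarrow> map f ts ! (j - 1) = f (ts ! (j - 1))"
  by (intro nth_map) auto

lemma map_args: "map f (args n x) = args n (\<lambda>j. f (x j))"
  by (simp add: args_def)

lemma args_cong: "(\<And>j. j \<in> {1..n} \<Longrightarrow> x j = y j) \<Longrightarrow> args n x = args n y"
  by (simp add: args_def del: upt_Suc)

lemma lookup_graft_args:
  "lookup (graft v (args n x)) (Node w ts) =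
     (if length ts = n
      then lookup v w * (\<Prod>j\<in>{1..n}. lookup (x j) (ts ! (j - 1))) else 0)"
proof (cases "length ts = n")
  case True
  have "prod_list (map2 lookup (args n x) ts) =
    prod_list (map (\<lambda>j. lookup (x j) (ts ! (j - 1))) [1..<Suc n])"
    by (rule arg_cong[where f = prod_list], rule nth_equalityI)
      (use True in \<open>auto simp del: upt_Suc\<close>)
  also have "\<dots> = (\<Prod>j\<in>{1..n}. lookup (x j) (ts ! (j - 1)))"
    by (subst prod.distinct_set_conv_list[symmetric])
      (auto simp del: upt_Suc simp: atLeastLessThanSuc_atLeastAtMost intro!: prod.cong)
  finally show ?thesis using True by (simp add: lookup_graft_Node)
qed (simp add: lookup_graft_Node)

text \<open>Each coefficient at a node is a product with exactly one factor from the argument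
  \<open>j\<close>; coefficients at leaves vanish.\<close>

lemma multilin_graft: "multilin scal scal n (\<lambda>x. graft v (args n x))"
  unfolding multilin_def
proof safe
  fix x y :: "nat \<Rightarrow> ('b tree \<Rightarrow>\<^sub>0 'a)" assume "\<forall>j\<in>{1..n}. x j = y j"
  then have "args n x = args n y" by (intro args_cong) auto
  then show "graft v (args n x) = graft v (args n y)" by simp
next
  fix x :: "nat \<Rightarrow> ('b tree \<Rightarrow>\<^sub>0 'a)" and j assume j: "j \<in> {1..n}"
  have *: "(\<Prod>i\<in>{1..n}. lookup ((x(j := a)) i) (ts ! (i - 1))) =
      lookup a (ts ! (j - 1)) *
      (\<Prod>i\<in>{1..n} - {j}. lookup (x i) (ts ! (i - 1)))" for a ts
    using j by (subst prod.remove[of _ j]) auto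
  show "Vector_Spaces.linear scal scal (\<lambda>a. graft v (args n (x(j := a))))"
    unfolding Vector_Spaces.linear_iff
  proof (intro conjI allI vector_space_scal; rule poly_mapping_eqI)
    fix a b k
    show "lookup (graft v (args n (x(j := a + b)))) k =
       lookup (graft v (args n (x(j := a))) + graft v (args n (x(j := b)))) k"
      by (cases k) (simp_all only: lookup_graft_args lookup_graft_Leaf lookup_add *, auto simp: algebra_simps)
  next
    fix c a k
    show "lookup (graft v (args n (x(j := scal c a)))) k =
       lookup (scal c (graft v (args n (x(j := a))))) k"
      by (cases k) (simp_all only: lookup_graft_args lookup_graft_Leaf lookup_scal *, auto simp: algebra_simps)
  qed
qed

lemma linear_graft: "Vector_Spaces.linear scal scal (\<lambda>v. graft v fs)"
  unfolding Vector_Spaces.linear_iff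
proof (intro conjI allI vector_space_scal; rule poly_mapping_eqI)
  fix v v' :: "'b \<Rightarrow>\<^sub>0 'a" and k
  show "lookup (graft (v + v') fs) k =
    lookup (graft v fs + graft v' fs) k"
    by (cases k) (auto simp: lookup_graft_Node lookup_add algebra_simps)
next
  fix c and v :: "'b \<Rightarrow>\<^sub>0 'a" and k
  show "lookup (graft (scal c v) fs) k = lookup (scal c (graft v fs)) k"
    by (cases k) (auto simp: lookup_graft_Node lookup_add algebra_simps)
qed

lemma graft_vec: "graft (vec w) (args n (\<lambda>j. vec (t j))) = vec (Node w (args n t))"
proof (rule poly_mapping_eqI)
  fix k
  show "lookup (graft (vec w) (args n (\<lambda>j. vec (t j)))) k =
    lookup (vec (Node w (args n t))) k"
  proof (cases k)
    case (Node w' ts)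
    have "(\<Prod>j\<in>{1..n}. (1 when t j = ts ! (j - 1))) = ((1::'b) when (\<forall>j\<in>{1..n}. t j = ts ! (j - 1)))"
    proof (cases "\<forall>j\<in>{1..n}. t j = ts ! (j - 1)")
      case True then show ?thesis by simp
    next
      case False
      then obtain j where "j \<in> {1..n}" "t j \<noteq> ts ! (j - 1)" by auto
      then show ?thesis by (auto simp: when_def intro!: prod_zero)
    qed
    moreover have "args n t = ts \<longleftrightarrow> length ts = n \<and> (\<forall>j\<in>{1..n}. t j = ts ! (j - 1))"
    proof safe
      assume "\<forall>j\<in>{1..length ts}. t j = ts ! (j - 1)"
      then show "args (length ts) t = ts" by (intro nth_equalityI) auto
    qed auto
    ultimately show ?thesis using Node by (auto simp: lookup_graft_args lookup_single when_def)
  qed (simp add: lookup_single)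
qed

text \<open>Multilinearity of grafting in the arguments and linearity in \<open>v\<close> reduce the
  claim to single trees, where it is the assumption on \<open>h\<close>.\<close>

lemma lin_to_graft:
  assumes s: "vector_space s"
    and M: "\<And>w. w \<in> keys v \<Longrightarrow> multilin s s n (M w)"
    and h: "\<And>w t. w \<in> keys v \<Longrightarrow> h (Node w (args n t)) = M w (\<lambda>j. h (t j))"
  shows "lin_to s h (graft v (args n x)) = lin_to s (\<lambda>w. M w (\<lambda>j. lin_to s h (x j))) v"
proof -
  interpret vector_space s by fact
  have base: "lin_to s h (graft (vec w) (args n x)) = M w (\<lambda>j. lin_to s h (x j))"
    if w: "w \<in> keys v" for w
    by (rule multilin_eq[OF linear_multilin_compose[OF linear_lin_to multilin_graft]
          multilin_compose[OF M[OF w] linear_lin_to] s]) (simp add: graft_vec h[OF w])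
  show ?thesis
    by (rule linear_eq_on_keys[where X = "keys v" and s = s])
      (auto intro!: linear_lin_to Vector_Spaces.linear_compose[OF linear_graft linear_lin_to, unfolded o_def] simp: base)
qed

section \<open>Quotients of operads\<close>

lemma cring_base_field: "cring (base_field :: 'k::field ring)"
proof -
  have "\<exists>y. (y::'k) + x = 0" for x by (rule exI[of _ "- x"]) simp
  then show ?thesis
    by (intro cringI abelian_groupI comm_monoidI) (auto simp: base_field_def algebra_simps)
qed

lemma base_field_simps [simp]:
  "carrier base_field = UNIV" "add base_field = (+)" "monoid.mult base_field = (*)"
  "one base_field = 1" "zero base_field = 0"
  by (simp_all add: base_field_def)

context operad
begin

lemma zero_closed: "n \<ge> 1 \<Longrightarrow> \<zero>\<^bsub>comps \<O> n\<^esub> \<in> carrier (comps \<O> n)"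
  using module[of n] by (simp add: Module.module_def abelian_group_def abelian_monoid.zero_closed)

lemma smult_zero: "n \<ge> 1 \<Longrightarrow> c \<odot>\<^bsub>comps \<O> n\<^esub> \<zero>\<^bsub>comps \<O> n\<^esub> = \<zero>\<^bsub>comps \<O> n\<^esub>"
  using Module.module.smult_r_null[OF module, of n c] by simp

lemma zero_smult: "n \<ge> 1 \<Longrightarrow> \<mu> \<in> carrier (comps \<O> n) \<Longrightarrow> 0 \<odot>\<^bsub>comps \<O> n\<^esub> \<mu> = \<zero>\<^bsub>comps \<O> n\<^esub>"
  using Module.module.smult_l_null[OF module, of n \<mu>] by simp

lemma sact_zero:
  assumes "n \<ge> 1" "\<sigma> permutes {1..n}"
  shows "sact \<O> n \<sigma> \<zero>\<^bsub>comps \<O> n\<^esub> = \<zero>\<^bsub>comps \<O> n\<^esub>"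
  using sact_smult[OF assms zero_closed[OF assms(1)], of 0] assms
  by (simp only: zero_smult zero_closed sact_closed)

lemma pcomp_zero_left:
  assumes "n \<ge> 1" "i \<in> {1..m}" "\<nu> \<in> carrier (comps \<O> n)"
  shows "pcomp \<O> m n i \<zero>\<^bsub>comps \<O> m\<^esub> \<nu> = \<zero>\<^bsub>comps \<O> (m + n - 1)\<^esub>"
proof -
  have m: "m \<ge> 1" "m + n - 1 \<ge> 1" using assms by auto
  show ?thesis
    using pcomp_smult_left[OF assms(1,2) zero_closed[OF m(1)] assms(3), of 0] assms m
    by (simp only: zero_smult zero_closed pcomp_closed)
qed

lemma pcomp_zero_right:
  assumes "n \<ge> 1" "i \<in> {1..m}" "\<mu> \<in> carrier (comps \<O> m)"
  shows "pcomp \<O> m n i \<mu> \<zero>\<^bsub>comps \<O> n\<^esub> = \<zero>\<^bsub>comps \<O> (m + n - 1)\<^esub>"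
proof -
  have m: "m \<ge> 1" "m + n - 1 \<ge> 1" using assms by auto
  show ?thesis
    using pcomp_smult_right[OF assms zero_closed[OF assms(1)], of 0] assms m
    by (simp only: zero_smult zero_closed pcomp_closed)
qed

end

text \<open>The axioms are identities between expressions formed from the operations, so they
  descend along a family of surjections compatible with these operations. The permutation properties
  enter because the action on the image is controlled only for permutations of the inputs.\<close>

lemma operad_image:
  fixes \<O> :: "('k::field, 'a) operad" and \<Q> :: "('k, 'b) operad"
  assumes "operad \<O>" and "\<And>n. n \<ge> 1 \<Longrightarrow> Module.module base_field (comps \<Q> n)"
    and surj: "\<And>n. n \<ge> 1 \<Longrightarrow> carrier (comps \<Q> n) = f n ` carrier (comps \<O> n)"
    and f_add: "\<And>n \<mu> \<nu>. \<lbrakk>n \<ge> 1; \<mu> \<in> carrier (comps \<O> n); \<nu> \<in> carrier (comps \<O> n)\<rbrakk>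
      \<Longrightarrow> f n \<mu> \<oplus>\<^bsub>comps \<Q> n\<^esub> f n \<nu> = f n (\<mu> \<oplus>\<^bsub>comps \<O> n\<^esub> \<nu>)"
    and f_smult: "\<And>n c \<mu>. \<lbrakk>n \<ge> 1; \<mu> \<in> carrier (comps \<O> n)\<rbrakk>
      \<Longrightarrow> c \<odot>\<^bsub>comps \<Q> n\<^esub> f n \<mu> = f n (c \<odot>\<^bsub>comps \<O> n\<^esub> \<mu>)"
    and f_unit: "unit \<Q> = f 1 (unit \<O>)"
    and f_pcomp: "\<And>m n i \<mu> \<nu>. \<lbrakk>n \<ge> 1; i \<in> {1..m}; \<mu> \<in> carrier (comps \<O> m); \<nu> \<in> carrier (comps \<O> n)\<rbrakk>
      \<Longrightarrow> pcomp \<Q> m n i (f m \<mu>) (f n \<nu>) = f (m + n - 1) (pcomp \<O> m n i \<mu> \<nu>)"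
    and f_sact: "\<And>n \<sigma> \<mu>. \<lbrakk>n \<ge> 1; \<sigma> permutes {1..n}; \<mu> \<in> carrier (comps \<O> n)\<rbrakk>
      \<Longrightarrow> sact \<Q> n \<sigma> (f n \<mu>) = f n (sact \<O> n \<sigma> \<mu>)"
    and perms: "\<And>m n i \<sigma>. \<lbrakk>n \<ge> 1; i \<in> {1..m}; \<sigma> permutes {1..m}\<rbrakk>
      \<Longrightarrow> outer_perm i n \<sigma> permutes {1..m + n - 1}"
      "\<And>m n i \<tau>. \<lbrakk>n \<ge> 1; i \<in> {1..m}; \<tau> permutes {1..n}\<rbrakk>
      \<Longrightarrow> inner_perm i n \<tau> permutes {1..m + n - 1}"
  shows "operad_hom \<O> \<Q> f"
proof -
  interpret operad \<O> by fact
  have madd: "\<mu> \<oplus>\<^bsub>comps \<O> n\<^esub> \<nu> \<in> carrier (comps \<O> n)"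
    if "n \<ge> 1" "\<mu> \<in> carrier (comps \<O> n)" "\<nu> \<in> carrier (comps \<O> n)" for n \<mu> \<nu>
    using module[OF that(1)] that by (simp add: Module.module_def abelian_group_def abelian_monoid.a_closed)
  have msmult: "c \<odot>\<^bsub>comps \<O> n\<^esub> \<mu> \<in> carrier (comps \<O> n)"
    if "n \<ge> 1" "\<mu> \<in> carrier (comps \<O> n)" for n c \<mu>
    using module[OF that(1)] that by (simp add: Module.module.smult_closed)
  have pos: "m + n - 1 \<ge> 1" "m \<ge> 1" if "i \<in> {1..m}" "n \<ge> 1" for i m n :: nat
    using that by auto
  note r = f_add f_smult f_pcomp f_sact madd msmult pcomp_closed sact_closed pos perms
  note rr = r unit_closed
  have "operad \<Q>"
  proof (rule operad.intro)
    fix n :: nat assume n: "n \<ge> 1"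
    show "Module.module base_field (comps \<Q> n)" using n assms by blast
  next
    fix n i m \<mu> \<nu> assume a: "n \<ge> 1" "i \<in> {1..m}" "\<mu> \<in> carrier (comps \<Q> m)" "\<nu> \<in> carrier (comps \<Q> n)"
    then have m: "m \<ge> 1" "m + n - 1 \<ge> 1" by auto
    from a m obtain \<mu>' \<nu>' where e: "\<mu> = f m \<mu>'" "\<mu>' \<in> carrier (comps \<O> m)"
      "\<nu> = f n \<nu>'" "\<nu>' \<in> carrier (comps \<O> n)" by (auto simp: surj)
    show "pcomp \<Q> m n i \<mu> \<nu> \<in> carrier (comps \<Q> (m + n - 1))"
      unfolding surj[OF m(2)] e f_pcomp[OF a(1,2) e(2,4)] using a e by (intro imageI pcomp_closed)
    show "pcomp \<Q> m n i (c \<odot>\<^bsub>comps \<Q> m\<^esub> \<mu>) \<nu> = c \<odot>\<^bsub>comps \<Q> (m + n - 1)\<^esub> pcomp \<Q> m n i \<mu> \<nu>" for c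
      unfolding e using a m e by (simp only: r pcomp_smult_left[OF a(1,2) e(2,4)])
    show "pcomp \<Q> m n i \<mu> (c \<odot>\<^bsub>comps \<Q> n\<^esub> \<nu>) = c \<odot>\<^bsub>comps \<Q> (m + n - 1)\<^esub> pcomp \<Q> m n i \<mu> \<nu>" for c
      unfolding e using a m e by (simp only: r pcomp_smult_right[OF a(1,2) e(2,4)])
    show "pcomp \<Q> m n (\<sigma> i) (sact \<Q> m \<sigma> \<mu>) \<nu> =
          sact \<Q> (m + n - 1) (outer_perm i n \<sigma>) (pcomp \<Q> m n i \<mu> \<nu>)" if s: "\<sigma> permutes {1..m}" for \<sigma>
    proof -
      have "\<sigma> i \<in> {1..m}" using a(2) s by (simp only: permutes_in_image)
      then show ?thesis
        unfolding e using a m e s by (simp only: r equivariant_outer[OF a(1,2) s e(2,4)])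
    qed
    show "pcomp \<Q> m n i \<mu> (sact \<Q> n \<tau> \<nu>) =
          sact \<Q> (m + n - 1) (inner_perm i n \<tau>) (pcomp \<Q> m n i \<mu> \<nu>)" if s: "\<tau> permutes {1..n}" for \<tau>
      unfolding e using a m e s by (simp only: r equivariant_inner[OF a(1,2) s e(2,4)])
  next
    fix n i m \<mu> \<mu>' \<nu> assume a: "n \<ge> 1" "i \<in> {1..m}" "\<mu> \<in> carrier (comps \<Q> m)"
      "\<mu>' \<in> carrier (comps \<Q> m)" "\<nu> \<in> carrier (comps \<Q> n)"
    then have m: "m \<ge> 1" "m + n - 1 \<ge> 1" by auto
    from a m obtain x y z where e: "\<mu> = f m x" "x \<in> carrier (comps \<O> m)"
      "\<mu>' = f m y" "y \<in> carrier (comps \<O> m)" "\<nu> = f n z" "z \<in> carrier (comps \<O> n)"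
      by (auto simp: surj)
    show "pcomp \<Q> m n i (\<mu> \<oplus>\<^bsub>comps \<Q> m\<^esub> \<mu>') \<nu> =
      pcomp \<Q> m n i \<mu> \<nu> \<oplus>\<^bsub>comps \<Q> (m + n - 1)\<^esub> pcomp \<Q> m n i \<mu>' \<nu>"
      unfolding e using a m e by (simp only: r pcomp_add_left[OF a(1,2) e(2,4,6)])
  next
    fix n i m \<mu> \<nu>' \<nu> assume a: "n \<ge> 1" "i \<in> {1..m}" "\<mu> \<in> carrier (comps \<Q> m)"
      "\<nu> \<in> carrier (comps \<Q> n)" "\<nu>' \<in> carrier (comps \<Q> n)"
    then have m: "m \<ge> 1" "m + n - 1 \<ge> 1" by auto
    from a m obtain x y z where e: "\<mu> = f m x" "x \<in> carrier (comps \<O> m)"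
      "\<nu> = f n y" "y \<in> carrier (comps \<O> n)" "\<nu>' = f n z" "z \<in> carrier (comps \<O> n)"
      by (auto simp: surj)
    show "pcomp \<Q> m n i \<mu> (\<nu> \<oplus>\<^bsub>comps \<Q> n\<^esub> \<nu>') =
      pcomp \<Q> m n i \<mu> \<nu> \<oplus>\<^bsub>comps \<Q> (m + n - 1)\<^esub> pcomp \<Q> m n i \<mu> \<nu>'"
      unfolding e using a m e by (simp only: r pcomp_add_right[OF a(1,2) e(2,4,6)])
  next
    show "unit \<Q> \<in> carrier (comps \<Q> 1)" by (simp only: surj[OF order_refl] f_unit imageI unit_closed)
  next
    fix n \<nu> assume a: "n \<ge> 1" "\<nu> \<in> carrier (comps \<Q> n)"
    then obtain x where e: "\<nu> = f n x" "x \<in> carrier (comps \<O> n)" by (auto simp: surj)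
    show "pcomp \<Q> 1 n 1 (unit \<Q>) \<nu> = \<nu>"
      using f_pcomp[of n 1 1 "unit \<O>" x] a e unit_left[OF a(1) e(2)] unit_closed by (simp add: f_unit)
    show "sact \<Q> n id \<nu> = \<nu>" using a e by (simp add: f_sact permutes_id sact_id)
  next
    fix i m \<mu> assume a: "i \<in> {1..m}" "\<mu> \<in> carrier (comps \<Q> m)"
    then have "m \<ge> 1" by auto
    with a obtain x where e: "\<mu> = f m x" "x \<in> carrier (comps \<O> m)" by (auto simp: surj)
    show "pcomp \<Q> m 1 i \<mu> (unit \<Q>) = \<mu>"
      using f_pcomp[of 1 i m x "unit \<O>"] a e unit_right[OF a(1) e(2)] unit_closed by (simp add: f_unit)
  next
    fix n i l j m \<kappa> \<mu> \<nu> assume a: "n \<ge> 1" "i \<in> {1..l}" "j \<in> {1..m}" "\<kappa> \<in> carrier (comps \<Q> l)"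
        "\<mu> \<in> carrier (comps \<Q> m)" "\<nu> \<in> carrier (comps \<Q> n)"
    \<comment> \<open>The two iterated composites have arities that agree only after resolving
      truncated subtraction, so this equality is recorded as well.\<close>
    then have m: "m \<ge> 1" "l \<ge> 1" "inner i j \<in> {1..l + m - 1}" "l + m - 1 \<ge> 1" "m + n - 1 \<ge> 1"
      "l + m - 1 + n - 1 = l + (m + n - 1) - 1" "l + (m + n - 1) - 1 \<ge> 1"
      by (auto simp: inner_def)
    from a m obtain x y z where e: "\<kappa> = f l x" "x \<in> carrier (comps \<O> l)"
      "\<mu> = f m y" "y \<in> carrier (comps \<O> m)" "\<nu> = f n z" "z \<in> carrier (comps \<O> n)"
      by (auto simp: surj)
    have "pcomp \<Q> (l + m - 1) n (inner i j) (pcomp \<Q> l m i \<kappa> \<mu>) \<nu> =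
      f (l + m - 1 + n - 1) (pcomp \<O> (l + m - 1) n (inner i j) (pcomp \<O> l m i x y) z)"
      unfolding e using a m e by (simp only: f_pcomp pcomp_closed)
    also have "\<dots> = f (l + (m + n - 1) - 1) (pcomp \<O> l (m + n - 1) i x (pcomp \<O> m n j y z))"
      using assoc_seq[OF a(1-3) e(2,4,6)] m(6) by simp
    also have "\<dots> = pcomp \<Q> l (m + n - 1) i \<kappa> (pcomp \<Q> m n j \<mu> \<nu>)"
      unfolding e using a m e by (simp only: f_pcomp pcomp_closed)
    finally show "pcomp \<Q> (l + m - 1) n (inner i j) (pcomp \<Q> l m i \<kappa> \<mu>) \<nu> =
          pcomp \<Q> l (m + n - 1) i \<kappa> (pcomp \<Q> m n j \<mu> \<nu>)" .
  next
    fix m n i j l \<kappa> \<mu> \<nu> assume a: "m \<ge> 1" "n \<ge> 1" "1 \<le> i" "i < j" "j \<le> l" "\<kappa> \<in> carrier (comps \<Q> l)"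
        "\<mu> \<in> carrier (comps \<Q> m)" "\<nu> \<in> carrier (comps \<Q> n)"
    then have m: "l \<ge> 1" "outer i m j \<in> {1..l + m - 1}" "i \<in> {1..l}" "j \<in> {1..l}" "i \<in> {1..l + n - 1}"
      "l + m - 1 \<ge> 1" "l + n - 1 \<ge> 1" "l + m - 1 + n - 1 = l + n - 1 + m - 1" 
      by (auto simp: outer_def)
    from a m obtain x y z where e: "\<kappa> = f l x" "x \<in> carrier (comps \<O> l)"
      "\<mu> = f m y" "y \<in> carrier (comps \<O> m)" "\<nu> = f n z" "z \<in> carrier (comps \<O> n)"
      by (auto simp: surj)
    have "pcomp \<Q> (l + m - 1) n (outer i m j) (pcomp \<Q> l m i \<kappa> \<mu>) \<nu> =
      f (l + m - 1 + n - 1) (pcomp \<O> (l + m - 1) n (outer i m j) (pcomp \<O> l m i x y) z)"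
      unfolding e using a m e by (simp only: f_pcomp pcomp_closed)
    also have "\<dots> = f (l + n - 1 + m - 1) (pcomp \<O> (l + n - 1) m i (pcomp \<O> l n j x z) y)"
      using assoc_par[OF a(1-5) e(2,4,6)] m(8) by simp
    also have "\<dots> = pcomp \<Q> (l + n - 1) m i (pcomp \<Q> l n j \<kappa> \<nu>) \<mu>"
      unfolding e using a m e by (simp only: f_pcomp pcomp_closed)
    finally show "pcomp \<Q> (l + m - 1) n (outer i m j) (pcomp \<Q> l m i \<kappa> \<mu>) \<nu> =
          pcomp \<Q> (l + n - 1) m i (pcomp \<Q> l n j \<kappa> \<nu>) \<mu>" .
  next
    fix n \<sigma> \<mu> assume a: "n \<ge> 1" "\<sigma> permutes {1..n}" "\<mu> \<in> carrier (comps \<Q> n)"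
    then obtain x where e: "\<mu> = f n x" "x \<in> carrier (comps \<O> n)" by (auto simp: surj)
    show "sact \<Q> n \<sigma> \<mu> \<in> carrier (comps \<Q> n)"
      unfolding surj[OF a(1)] e f_sact[OF a(1,2) e(2)] using a e by (intro imageI sact_closed)
    show "sact \<Q> n \<sigma> (c \<odot>\<^bsub>comps \<Q> n\<^esub> \<mu>) = c \<odot>\<^bsub>comps \<Q> n\<^esub> sact \<Q> n \<sigma> \<mu>" for c
      unfolding e using a e by (simp only: r sact_smult[OF a(1,2) e(2)])
    show "sact \<Q> n \<tau> (sact \<Q> n \<sigma> \<mu>) = sact \<Q> n (\<tau> \<circ> \<sigma>) \<mu>" if t: "\<tau> permutes {1..n}" for \<tau>
      unfolding e using a e t by (simp only: r permutes_compose sact_comp[OF a(1) t a(2) e(2)])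
  next
    fix n \<sigma> \<mu> \<nu> assume a: "n \<ge> 1" "\<sigma> permutes {1..n}" "\<mu> \<in> carrier (comps \<Q> n)" "\<nu> \<in> carrier (comps \<Q> n)"
    then obtain x y where e: "\<mu> = f n x" "x \<in> carrier (comps \<O> n)" "\<nu> = f n y" "y \<in> carrier (comps \<O> n)"
      by (auto simp: surj)
    show "sact \<Q> n \<sigma> (\<mu> \<oplus>\<^bsub>comps \<Q> n\<^esub> \<nu>) = sact \<Q> n \<sigma> \<mu> \<oplus>\<^bsub>comps \<Q> n\<^esub> sact \<Q> n \<sigma> \<nu>"
      unfolding e using a e by (simp only: r sact_add[OF a(1,2) e(2,4)])
  qed
  then interpret Q: operad \<Q> .
  show ?thesis
    by unfold_locales (auto simp: f_add f_smult f_unit f_pcomp f_sact surj)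
qed

section \<open>Block permutations of the inputs of a composite\<close>

lemma bij_permutes: "bij p \<Longrightarrow> (\<And>x. x \<notin> S \<Longrightarrow> p x = x) \<Longrightarrow> p permutes S"
  by (simp add: permutes_def bij_iff)

text \<open>The inverse is the block permutation of the inverse of \<open>\<sigma>\<close> at the
  position \<open>\<sigma> i\<close>, to which the block has moved. The three cases are the inputs
  before, inside and after the block.\<close>

lemma outer_perm_inverse:
  assumes "i \<in> {1..m}" "\<sigma> permutes {1..m}" "n \<ge> 1"
  shows "outer_perm (\<sigma> i) n (Hilbert_Choice.inv \<sigma>) (outer_perm i n \<sigma> q) = q"
proof -
  have inj: "\<sigma> a = \<sigma> b \<longleftrightarrow> a = b" for a b using assms(2) by (meson permutes_inj injD)
  have i: "1 \<le> i" "1 \<le> \<sigma> i" "i \<le> m" "\<sigma> i \<le> m" 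
    using assms permutes_in_image[OF assms(2), of i] by auto
  have inv: "Hilbert_Choice.inv \<sigma> (\<sigma> a) = a" for a using assms(2) by (simp add: permutes_inverses)
  consider "q < i" | "i \<le> q" "q < i + n" | "i + n \<le> q" by linarith
  then show ?thesis
  proof cases
    case 1
    then have "\<sigma> q \<noteq> \<sigma> i" by (auto simp: inj)
    with 1 i assms(3) show ?thesis
      by (cases "\<sigma> q < \<sigma> i") (auto simp: outer_perm_def outer_def inner_def inv)
  next
    case 2
    with i assms(3) show ?thesis by (auto simp: outer_perm_def outer_def inner_def inv)
  next
    case 3
    then have "\<sigma> (q + 1 - n) \<noteq> \<sigma> i" by (auto simp: inj)
    with 3 i assms(3) show ?thesis
      by (cases "\<sigma> (q + 1 - n) < \<sigma> i") (auto simp: outer_perm_def outer_def inner_def inv)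
  qed
qed

lemma outer_perm_permutes:
  assumes "n \<ge> 1" "i \<in> {1..m}" "\<sigma> permutes {1..m}"
  shows "outer_perm i n \<sigma> permutes {1..m + n - 1}"
proof (rule bij_permutes)
  have s: "\<sigma> i \<in> {1..m}" using assms by (simp only: permutes_in_image)
  have inv: "Hilbert_Choice.inv \<sigma> (\<sigma> i) = i" "Hilbert_Choice.inv (Hilbert_Choice.inv \<sigma>) = \<sigma>"
    using assms(3) by (simp_all add: permutes_inverses permutes_inv_inv)
  show "bij (outer_perm i n \<sigma>)"
    by (rule o_bij[of "outer_perm (\<sigma> i) n (Hilbert_Choice.inv \<sigma>)"])
      (use outer_perm_inverse[OF assms(2,3,1)]
        outer_perm_inverse[OF s permutes_inv[OF assms(3)] assms(1)] inv in \<open>auto simp: fun_eq_iff\<close>)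
  fix q assume q: "q \<notin> {1..m + n - 1}"
  show "outer_perm i n \<sigma> q = q"
  \<comment> \<open>Outside the range lie the index 0 and the indices from \<open>m + n\<close> on.
    The latter are lowered by \<open>n - 1\<close> to points fixed by \<open>\<sigma>\<close> and
    raised again.\<close>
  proof (cases "q = 0")
    case True
    then show ?thesis using assms s permutes_not_in[OF assms(3), of 0]
      by (auto simp: outer_perm_def outer_def)
  next
    case False
    then have "q \<ge> m + n" using q assms(2) by auto
    moreover from this have "\<sigma> (q + 1 - n) = q + 1 - n" using assms
      by (intro permutes_not_in[OF assms(3)]) auto
    ultimately show ?thesis using assms s by (auto simp: outer_perm_def outer_def)
  qed
qed

lemma inner_perm_permutes:
  assumes "n \<ge> 1" "i \<in> {1..m}" "\<tau> permutes {1..n}"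
  shows "inner_perm i n \<tau> permutes {1..m + n - 1}"
proof (rule bij_permutes)
  have *: "inner_perm i n (Hilbert_Choice.inv \<tau>) (inner_perm i n \<tau> q) = q" if "\<tau> permutes {1..n}" for \<tau> q
  proof (cases "i \<le> q \<and> q < i + n")
    case True
    then have "q + 1 - i \<in> {1..n}" using assms by auto
    then have "\<tau> (q + 1 - i) \<in> {1..n}" using that by (simp only: permutes_in_image)
    then show ?thesis using True assms(2) that by (auto simp: inner_perm_def inner_def permutes_inverses)
  qed (auto simp: inner_perm_def)
  have "Hilbert_Choice.inv (Hilbert_Choice.inv \<tau>) = \<tau>" using assms(3) by (rule permutes_inv_inv)
  then show "bij (inner_perm i n \<tau>)"
    by (intro o_bij[of "inner_perm i n (Hilbert_Choice.inv \<tau>)"])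
      (rule ext, simp only: o_apply id_apply *[OF assms(3)],
        rule ext, use *[OF permutes_inv[OF assms(3)]] in \<open>simp only: o_apply id_apply\<close>)
  show "inner_perm i n \<tau> q = q" if "q \<notin> {1..m + n - 1}" for q
    using that assms by (auto simp: inner_perm_def)
qed

section \<open>The quotient by an operadic ideal\<close>

locale operadic_ideal = operad \<O> for \<O> :: "('k::field, 'a) operad" +
  fixes N :: "nat \<Rightarrow> 'a set"
  assumes N_closed: "\<lbrakk>n \<ge> 1; \<mu> \<in> N n\<rbrakk> \<Longrightarrow> \<mu> \<in> carrier (comps \<O> n)"
    and N_zero: "n \<ge> 1 \<Longrightarrow> \<zero>\<^bsub>comps \<O> n\<^esub> \<in> N n"
    and N_add: "\<lbrakk>n \<ge> 1; \<mu> \<in> N n; \<nu> \<in> N n\<rbrakk> \<Longrightarrow> \<mu> \<oplus>\<^bsub>comps \<O> n\<^esub> \<nu> \<in> N n"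
    and N_smult: "\<lbrakk>n \<ge> 1; \<mu> \<in> N n\<rbrakk> \<Longrightarrow> c \<odot>\<^bsub>comps \<O> n\<^esub> \<mu> \<in> N n"
    and N_sact: "\<lbrakk>n \<ge> 1; \<mu> \<in> N n; \<sigma> permutes {1..n}\<rbrakk> \<Longrightarrow> sact \<O> n \<sigma> \<mu> \<in> N n"
    and N_pcomp_left: "\<lbrakk>n \<ge> 1; i \<in> {1..m}; \<mu> \<in> N m; \<nu> \<in> carrier (comps \<O> n)\<rbrakk>
      \<Longrightarrow> pcomp \<O> m n i \<mu> \<nu> \<in> N (m + n - 1)"
    and N_pcomp_right: "\<lbrakk>n \<ge> 1; i \<in> {1..m}; \<mu> \<in> carrier (comps \<O> m); \<nu> \<in> N n\<rbrakk>
      \<Longrightarrow> pcomp \<O> m n i \<mu> \<nu> \<in> N (m + n - 1)"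
begin

lemma abelian_group_comps: "n \<ge> 1 \<Longrightarrow> abelian_group (comps \<O> n)"
  using module by (simp add: Module.module_def)

lemma abelian_subgroup_N:
  assumes n: "n \<ge> 1"
  shows "abelian_subgroup (N n) (comps \<O> n)"
proof -
  interpret M: Module.module base_field "comps \<O> n" using n by (rule module)
  \<comment> \<open>Subgroups need negatives; these are the multiples by -1.\<close>
  have "\<ominus>\<^bsub>comps \<O> n\<^esub> x \<in> N n" if "x \<in> N n" for x
  proof -
    have x: "x \<in> carrier (comps \<O> n)" using n that by (rule N_closed)
    have "(- 1) \<odot>\<^bsub>comps \<O> n\<^esub> x \<oplus>\<^bsub>comps \<O> n\<^esub> x = (- 1 + 1) \<odot>\<^bsub>comps \<O> n\<^esub> x"
      using x M.smult_l_distr[of "- 1" 1 x] M.smult_one[OF x] by (simp del: add.left_inverse)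
    also have "\<dots> = \<zero>\<^bsub>comps \<O> n\<^esub>" using M.smult_l_null[OF x] by simp
    finally have "\<ominus>\<^bsub>comps \<O> n\<^esub> x = (- 1) \<odot>\<^bsub>comps \<O> n\<^esub> x"
      using x by (intro M.minus_equality) (auto intro: M.smult_closed)
    then show ?thesis using N_smult[OF n that] by simp
  qed
  then have "subgroup (N n) (add_monoid (comps \<O> n))"
    using n by (intro subgroup.intro) (auto simp: N_closed N_add N_zero a_inv_def)
  then have "additive_subgroup (N n) (comps \<O> n)" by (rule additive_subgroup.intro)
  then show ?thesis by (rule abelian_subgroupI3) (rule M.abelian_group_axioms)
qed

abbreviation cls :: "nat \<Rightarrow> 'a \<Rightarrow> 'a set" where
  "cls n x \<equiv> N n +>\<^bsub>comps \<O> n\<^esub> x"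

lemma mem_cls: "y \<in> cls n x \<longleftrightarrow> (\<exists>h\<in>N n. y = h \<oplus>\<^bsub>comps \<O> n\<^esub> x)"
  by (auto simp: a_r_coset_def')

lemma cls_self: "n \<ge> 1 \<Longrightarrow> x \<in> carrier (comps \<O> n) \<Longrightarrow> x \<in> cls n x"
  using abelian_subgroup_N abelian_subgroup.a_rcos_self by fastforce

lemma cls_add_left:
  assumes "n \<ge> 1" "x \<in> carrier (comps \<O> n)" "h \<in> N n"
  shows "cls n (h \<oplus>\<^bsub>comps \<O> n\<^esub> x) = cls n x"
proof -
  interpret abelian_subgroup "N n" "comps \<O> n" using assms(1) by (rule abelian_subgroup_N)
  have "h \<oplus>\<^bsub>comps \<O> n\<^esub> x \<in> cls n x" using assms mem_cls by blast
  then show ?thesis using a_repr_independence'[OF _ assms(2)] by metis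
qed

text \<open>The operations of the quotient are unions over all representatives. A union of equal
  sets over a nonempty coset is that set, so it remains to check independence of the
  representative.\<close>

lemma cls_UN:
  assumes "n \<ge> 1" "x \<in> carrier (comps \<O> n)"
    and "\<And>h. h \<in> N n \<Longrightarrow> g (h \<oplus>\<^bsub>comps \<O> n\<^esub> x) = Z"
  shows "(\<Union>y\<in>cls n x. g y) = Z"
proof -
  have "g y = Z" if "y \<in> cls n x" for y
    using that assms(3) unfolding mem_cls by blast
  then show ?thesis using cls_self[OF assms(1,2)] by blast
qed

lemma cls_add:
  assumes "n \<ge> 1" "x \<in> carrier (comps \<O> n)" "y \<in> carrier (comps \<O> n)"
  shows "cls n x <+>\<^bsub>comps \<O> n\<^esub> cls n y = cls n (x \<oplus>\<^bsub>comps \<O> n\<^esub> y)"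
proof -
  interpret abelian_subgroup "N n" "comps \<O> n" using assms(1) by (rule abelian_subgroup_N)
  show ?thesis using a_rcos_sum[OF assms(2,3)] .
qed

lemma cls_smult:
  assumes "n \<ge> 1" "x \<in> carrier (comps \<O> n)"
  shows "(\<Union>y\<in>cls n x. cls n (c \<odot>\<^bsub>comps \<O> n\<^esub> y)) = cls n (c \<odot>\<^bsub>comps \<O> n\<^esub> x)"
proof -
  interpret M: Module.module base_field "comps \<O> n" using assms(1) by (rule module)
  show ?thesis
    using assms by (intro cls_UN) (auto simp: M.smult_r_distr N_closed M.smult_closed N_smult cls_add_left)
qed

lemma cls_sact:
  assumes "n \<ge> 1" "x \<in> carrier (comps \<O> n)" "\<sigma> permutes {1..n}"
  shows "(\<Union>y\<in>cls n x. cls n (sact \<O> n \<sigma> y)) = cls n (sact \<O> n \<sigma> x)"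
  using assms by (intro cls_UN) (auto simp: sact_add N_closed sact_closed N_sact cls_add_left)

lemma cls_pcomp:
  assumes a: "n \<ge> 1" "i \<in> {1..m}" "x \<in> carrier (comps \<O> m)" "y \<in> carrier (comps \<O> n)"
  shows "(\<Union>\<mu>\<in>cls m x. \<Union>\<nu>\<in>cls n y. cls (m + n - 1) (pcomp \<O> m n i \<mu> \<nu>)) =
    cls (m + n - 1) (pcomp \<O> m n i x y)"
proof (rule cls_UN)
  show m: "m \<ge> 1" using a by auto
  have mn: "m + n - 1 \<ge> 1" using a by auto
  interpret G: abelian_group "comps \<O> m" using m by (rule abelian_group_comps)
  fix h assume h: "h \<in> N m"
  show "(\<Union>\<nu>\<in>cls n y. cls (m + n - 1) (pcomp \<O> m n i (h \<oplus>\<^bsub>comps \<O> m\<^esub> x) \<nu>)) =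
    cls (m + n - 1) (pcomp \<O> m n i x y)"
  proof (rule cls_UN)
    fix k assume k: "k \<in> N n"
    let ?hx = "h \<oplus>\<^bsub>comps \<O> m\<^esub> x"
    have c: "h \<in> carrier (comps \<O> m)" "k \<in> carrier (comps \<O> n)" "?hx \<in> carrier (comps \<O> m)"
      using h k a m N_closed by auto
    \<comment> \<open>The summand with \<open>k\<close> lies in the ideal because its right factor
      does, the one with \<open>h\<close> because its left factor does.\<close>
    have "cls (m + n - 1) (pcomp \<O> m n i ?hx (k \<oplus>\<^bsub>comps \<O> n\<^esub> y)) = cls (m + n - 1) (pcomp \<O> m n i ?hx y)"
      unfolding pcomp_add_right[OF a(1,2) c(3,2) a(4)]
      by (rule cls_add_left[OF mn pcomp_closed[OF a(1,2) c(3) a(4)] N_pcomp_right[OF a(1,2) c(3) k]])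
    also have "\<dots> = cls (m + n - 1) (pcomp \<O> m n i x y)"
      unfolding pcomp_add_left[OF a(1,2) c(1) a(3,4)]
      by (rule cls_add_left[OF mn pcomp_closed[OF a] N_pcomp_left[OF a(1,2) h a(4)]])
    finally show "cls (m + n - 1) (pcomp \<O> m n i ?hx (k \<oplus>\<^bsub>comps \<O> n\<^esub> y)) =
      cls (m + n - 1) (pcomp \<O> m n i x y)" .
  qed (use a in auto)
qed (use a in auto)

lemma quot_module_carrier: "carrier (quot_module (comps \<O> n) (N n)) = cls n ` carrier (comps \<O> n)"
  by (auto simp: quot_module_def A_RCOSETS_def')

lemma quot_module_module:
  assumes n: "n \<ge> 1"
  shows "Module.module base_field (quot_module (comps \<O> n) (N n))"
proof -
  interpret M: Module.module base_field "comps \<O> n" using n by (rule module)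
  interpret S: abelian_subgroup "N n" "comps \<O> n" using n by (rule abelian_subgroup_N)
  let ?Q = "quot_module (comps \<O> n) (N n)"
  have add: "cls n x \<oplus>\<^bsub>?Q\<^esub> cls n y = cls n (x \<oplus>\<^bsub>comps \<O> n\<^esub> y)"
    if "x \<in> carrier (comps \<O> n)" "y \<in> carrier (comps \<O> n)" for x y
    using cls_add[OF n that] by (simp add: quot_module_def)
  have zero: "\<zero>\<^bsub>?Q\<^esub> = cls n \<zero>\<^bsub>comps \<O> n\<^esub>"
    using M.a_coset_add_zero[OF S.a_subset] by (simp add: quot_module_def)
  have "abelian_group ?Q"
  proof (rule abelian_groupI)
    fix X assume "X \<in> carrier ?Q"
    then obtain x where x: "X = cls n x" "x \<in> carrier (comps \<O> n)" by (auto simp: quot_module_carrier)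
    then have "cls n (\<ominus>\<^bsub>comps \<O> n\<^esub> x) \<oplus>\<^bsub>?Q\<^esub> X = \<zero>\<^bsub>?Q\<^esub>"
      by (simp add: add zero M.l_neg)
    then show "\<exists>Y\<in>carrier ?Q. Y \<oplus>\<^bsub>?Q\<^esub> X = \<zero>\<^bsub>?Q\<^esub>"
      using x(2) by (intro bexI) (auto simp: quot_module_carrier)
  qed (auto simp: quot_module_carrier add zero M.a_ac)
  moreover have s: "c \<odot>\<^bsub>?Q\<^esub> cls n x = cls n (c \<odot>\<^bsub>comps \<O> n\<^esub> x)" if "x \<in> carrier (comps \<O> n)" for c x
    using cls_smult[OF n that] by (simp add: quot_module_def)
  ultimately show ?thesis
    using M.smult_closed M.smult_l_distr M.smult_assoc1
    by (intro moduleI cring_base_field)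
      (auto simp: quot_module_carrier M.smult_r_distr M.smult_one[simplified] add)
qed

text \<open>The projection is surjective and compatible with the operations, so it carries the
  operad axioms over; the quotient is thereby shown to be an operad at the same time.\<close>

lemma cls_hom: "operad_hom \<O> (quotient_operad \<O> N) cls"
proof (rule operad_image[OF operad_axioms])
  show "carrier (comps (quotient_operad \<O> N) n) = cls n ` carrier (comps \<O> n)" for n
    by (simp add: quotient_operad_def quot_module_carrier)
next
  show "Module.module base_field (comps (quotient_operad \<O> N) n)" if "n \<ge> 1" for n
    using quot_module_module[OF that] by (simp add: quotient_operad_def)
qed (simp_all only: quotient_operad_def operad.simps outer_perm_permutes inner_perm_permutes
      cls_add cls_smult cls_sact cls_pcomp quot_module_def partial_object.simps ring.simps module.simps)

end

section \<open>Ideals generated by relations\<close>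

lemma op_ideal_carrier:
  assumes "operad \<O>" "\<And>n. n \<ge> 1 \<Longrightarrow> S n \<subseteq> carrier (comps \<O> n)" "in_op_ideal \<O> S n \<mu>"
  shows "n \<ge> 1 \<and> \<mu> \<in> carrier (comps \<O> n)"
proof -
  interpret operad \<O> by fact
  have M: "Module.module base_field (comps \<O> n)" "abelian_monoid (comps \<O> n)" if "n \<ge> 1" for n
    using module[OF that] by (auto simp: Module.module_def abelian_group_def)
  from assms(3) show ?thesis
  proof induction
    case (pcomp_left m \<mu> n \<nu> i)
    then show ?case using pcomp_closed[of n i m \<mu> \<nu>] by auto
  next
    case (pcomp_right n \<nu> \<mu> m i)
    then show ?case using pcomp_closed[of n i m \<mu> \<nu>] by auto
  next
    case (smult n \<mu> c)
    then show ?case using Module.module.smult_closed[OF M(1), of n c \<mu>] by simp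
  qed (use assms(2) M sact_closed in \<open>auto simp: abelian_monoid.zero_closed abelian_monoid.a_closed\<close>)
qed

lemma operadic_ideal_op_ideal:
  assumes "operad \<O>" "\<And>n. n \<ge> 1 \<Longrightarrow> S n \<subseteq> carrier (comps \<O> n)"
  shows "operadic_ideal \<O> (op_ideal \<O> S)"
proof -
  interpret operad \<O> by fact
  show ?thesis
  proof
    fix n i m \<mu> \<nu>
    assume a: "n \<ge> 1" "i \<in> {1..m}" "\<mu> \<in> op_ideal \<O> S m" "\<nu> \<in> carrier (comps \<O> n)"
    then show "pcomp \<O> m n i \<mu> \<nu> \<in> op_ideal \<O> S (m + n - 1)"
      unfolding op_ideal_def mem_Collect_eq by (intro in_op_ideal.pcomp_left)
  next
    fix n i m \<mu> \<nu>
    assume a: "n \<ge> 1" "i \<in> {1..m}" "\<mu> \<in> carrier (comps \<O> m)" "\<nu> \<in> op_ideal \<O> S n"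
    then show "pcomp \<O> m n i \<mu> \<nu> \<in> op_ideal \<O> S (m + n - 1)"
      unfolding op_ideal_def mem_Collect_eq by (intro in_op_ideal.pcomp_right)
  qed (use op_ideal_carrier[OF assms] in \<open>auto simp: op_ideal_def intro: in_op_ideal.intros\<close>)
qed

section \<open>Factorization of a morphism through a quotient\<close>

context operad_hom
begin

lemma hom_zero: "n \<ge> 1 \<Longrightarrow> f n \<zero>\<^bsub>comps \<P> n\<^esub> = \<zero>\<^bsub>comps \<Q> n\<^esub>"
proof -
  assume n: "n \<ge> 1"
  interpret M: Module.module base_field "comps \<P> n" using n by (rule source.module)
  interpret M': Module.module base_field "comps \<Q> n" using n by (rule target.module)
  have z: "\<zero>\<^bsub>comps \<P> n\<^esub> \<in> carrier (comps \<P> n)" by simp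
  from hom_smult[OF n z, of 0] show ?thesis
    using M.smult_l_null[OF z] M'.smult_l_null[OF hom_closed[OF n z]] by simp
qed

text \<open>The kernel of a morphism satisfies every closure rule that generates the ideal.
  Membership in the carriers is supplied at each rule, because a morphism is controlled only
  there.\<close>

lemma in_op_ideal_zero:
  assumes S: "\<And>n. n \<ge> 1 \<Longrightarrow> S n \<subseteq> carrier (comps \<P> n)"
    and z: "\<And>n \<mu>. n \<ge> 1 \<Longrightarrow> \<mu> \<in> S n \<Longrightarrow> f n \<mu> = \<zero>\<^bsub>comps \<Q> n\<^esub>"
    and "in_op_ideal \<P> S n \<mu>"
  shows "f n \<mu> = \<zero>\<^bsub>comps \<Q> n\<^esub>"
proof -
  note c = op_ideal_carrier[OF source.operad_axioms S]
  have MQ: "Module.module base_field (comps \<Q> n)" "abelian_group (comps \<Q> n)" if "n \<ge> 1" for n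
    using target.module[OF that] by (auto simp: Module.module_def)
  from assms(3) show ?thesis
  proof induction
    case (gen n \<mu>)
    then show ?case by (rule z)
  next
    case (zero n)
    then show ?case by (rule hom_zero)
  next
    case (add n \<mu> \<nu>)
    with c[OF _ add(1)] c[OF _ add(2)] show ?case
      using target.zero_closed[of n] MQ(2)[of n] by (simp add: hom_add abelian_group_def abelian_monoid.l_zero)
  next
    case (smult n \<mu> a)
    with c[OF _ smult(1)] show ?case by (simp add: hom_smult target.smult_zero)
  next
    case (sact n \<mu> \<sigma>)
    with c[OF _ sact(1)] show ?case by (simp only: hom_sact target.sact_zero)
  next
    case (pcomp_left m \<mu> n \<nu> i)
    with c[OF _ pcomp_left(1)] show ?case
      by (simp only: hom_pcomp hom_closed target.pcomp_zero_left)
  next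
    case (pcomp_right n \<nu> \<mu> m i)
    moreover from this have "m \<ge> 1" by auto
    ultimately show ?case using c[OF _ pcomp_right(1)]
      by (simp only: hom_pcomp hom_closed target.pcomp_zero_right)
  qed
qed

lemma factor_through_quotient:
  assumes S: "\<And>n. n \<ge> 1 \<Longrightarrow> S n \<subseteq> carrier (comps \<P> n)"
    and z: "\<And>n \<mu>. n \<ge> 1 \<Longrightarrow> \<mu> \<in> S n \<Longrightarrow> f n \<mu> = \<zero>\<^bsub>comps \<Q> n\<^esub>"
  shows "\<exists>g. operad_hom (quotient_operad \<P> (op_ideal \<P> S)) \<Q> g \<and>
    (\<forall>n\<ge>1. \<forall>\<mu>\<in>carrier (comps \<P> n). g n (op_ideal \<P> S n +>\<^bsub>comps \<P> n\<^esub> \<mu>) = f n \<mu>)"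
proof -
  interpret I: operadic_ideal \<P> "op_ideal \<P> S"
    by (rule operadic_ideal_op_ideal[OF source.operad_axioms S])
  interpret C: operad_hom \<P> "quotient_operad \<P> (op_ideal \<P> S)" I.cls by (rule I.cls_hom)
  \<comment> \<open>A coset is evaluated at a chosen element. Any other choice differs by an element
    of the ideal, which \<open>f\<close> sends to zero.\<close>
  define g where "g n X = f n (SOME x. x \<in> X)" for n X
  have g: "g n (I.cls n \<mu>) = f n \<mu>" if n: "n \<ge> 1" and m: "\<mu> \<in> carrier (comps \<P> n)" for n \<mu>
  proof -
    have "abelian_group (comps \<Q> n)" using target.module[OF n] by (simp add: Module.module_def)
    then interpret G: abelian_group "comps \<Q> n" .
    have "(SOME x. x \<in> I.cls n \<mu>) \<in> I.cls n \<mu>"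
      using I.cls_self[OF n m] by (rule someI)
    then obtain h where h: "h \<in> op_ideal \<P> S n" "(SOME x. x \<in> I.cls n \<mu>) = h \<oplus>\<^bsub>comps \<P> n\<^esub> \<mu>"
      unfolding I.mem_cls by blast
    have "f n h = \<zero>\<^bsub>comps \<Q> n\<^esub>"
      using h(1) in_op_ideal_zero[OF S z] by (simp add: op_ideal_def)
    then show ?thesis
      unfolding g_def h(2) using hom_add[OF n I.N_closed[OF n h(1)] m] hom_closed[OF n m] by simp
  qed
  have carr: "carrier (comps (quotient_operad \<P> (op_ideal \<P> S)) n) = I.cls n ` carrier (comps \<P> n)" for n
    by (simp add: quotient_operad_def I.quot_module_carrier)
  have ad: "\<mu> \<oplus>\<^bsub>comps \<P> n\<^esub> \<nu> \<in> carrier (comps \<P> n)"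
    if "n \<ge> 1" "\<mu> \<in> carrier (comps \<P> n)" "\<nu> \<in> carrier (comps \<P> n)" for n \<mu> \<nu>
    using source.module[OF that(1)] that by (simp add: Module.module_def abelian_group_def abelian_monoid.a_closed)
  have sm: "c \<odot>\<^bsub>comps \<P> n\<^esub> \<mu> \<in> carrier (comps \<P> n)"
    if "n \<ge> 1" "\<mu> \<in> carrier (comps \<P> n)" for n c \<mu>
    using source.module[OF that(1)] that by (simp add: Module.module.smult_closed)
  have "operad_hom (quotient_operad \<P> (op_ideal \<P> S)) \<Q> g"
  proof
    fix n i m \<mu> \<nu> assume a: "n \<ge> 1" "i \<in> {1..m}"
      "\<mu> \<in> carrier (comps (quotient_operad \<P> (op_ideal \<P> S)) m)"
      "\<nu> \<in> carrier (comps (quotient_operad \<P> (op_ideal \<P> S)) n)"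
    then obtain x y where e: "\<mu> = I.cls m x" "x \<in> carrier (comps \<P> m)" "\<nu> = I.cls n y" "y \<in> carrier (comps \<P> n)"
      by (auto simp: carr)
    have m: "m + n - 1 \<ge> 1" "m \<ge> 1" using a by auto
    show "g (m + n - 1) (pcomp (quotient_operad \<P> (op_ideal \<P> S)) m n i \<mu> \<nu>) = pcomp \<Q> m n i (g m \<mu>) (g n \<nu>)"
      unfolding e C.hom_pcomp[OF a(1,2) e(2,4), symmetric]
      using a m e by (simp only: g source.pcomp_closed hom_pcomp)
  next
    show "g 1 (unit (quotient_operad \<P> (op_ideal \<P> S))) = unit \<Q>"
      unfolding C.hom_unit[symmetric] using g[OF _ source.unit_closed] hom_unit by simp
  qed (auto simp: carr g hom_closed C.hom_add[symmetric] C.hom_smult[symmetric] C.hom_sact[symmetric]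
      ad sm hom_add hom_smult hom_sact source.sact_closed)
  then show ?thesis using g by blast
qed

lemma comp_unary_hom:
  assumes "n \<ge> 1" "\<mu> \<in> carrier (comps \<P> n)" "\<And>i. i \<in> {1..n} \<Longrightarrow> \<nu> i \<in> carrier (comps \<P> 1)"
  shows "f n (comp_unary \<P> n \<mu> \<nu>) = comp_unary \<Q> n (f n \<mu>) (\<lambda>i. f 1 (\<nu> i))"
proof -
  \<comment> \<open>Stated for an arbitrary list of positions and an arbitrary start, so that the
    induction can follow the fold.\<close>
  have "set is \<subseteq> {1..n} \<Longrightarrow> \<mu> \<in> carrier (comps \<P> n) \<Longrightarrow>
    f n (fold (\<lambda>i \<kappa>. pcomp \<P> n 1 i \<kappa> (\<nu> i)) is \<mu>) = fold (\<lambda>i \<kappa>. pcomp \<Q> n 1 i \<kappa> (f 1 (\<nu> i))) is (f n \<mu>)" for "is"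
  proof (induction "is" arbitrary: \<mu>)
    case (Cons i "is")
    then show ?case
      using hom_pcomp[of 1 i n \<mu> "\<nu> i"] source.pcomp_closed[of 1 i n \<mu> "\<nu> i"] assms(3)[of i] by simp
  qed simp
  from this[of "[1..<Suc n]"] show ?thesis using assms(2)
    by (simp add: comp_unary_def atLeastLessThanSuc_atLeastAtMost del: upt_Suc)
qed

end

lemma (in operadic_ideal) cls_zero:
  assumes "n \<ge> 1" "\<mu> \<in> N n"
  shows "cls n \<mu> = \<zero>\<^bsub>comps (quotient_operad \<O> N) n\<^esub>"
proof -
  interpret G: abelian_group "comps \<O> n" using assms(1) by (rule abelian_group_comps)
  have "cls n (\<mu> \<oplus>\<^bsub>comps \<O> n\<^esub> \<zero>\<^bsub>comps \<O> n\<^esub>) = cls n \<zero>\<^bsub>comps \<O> n\<^esub>"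
    using assms by (intro cls_add_left) auto
  then show ?thesis
    using operad_hom.hom_zero[OF cls_hom assms(1)] N_closed[OF assms] by simp
qed

lemma operad_hom_compose:
  assumes "operad_hom \<P> \<Q> f" "operad_hom \<Q> \<R> g"
  shows "operad_hom \<P> \<R> (\<lambda>n x. g n (f n x))"
proof -
  interpret f: operad_hom \<P> \<Q> f by fact
  interpret g: operad_hom \<Q> \<R> g by fact
  show ?thesis
  proof
    fix n i m \<mu> \<nu> assume a: "n \<ge> 1" "i \<in> {1..m}" "\<mu> \<in> carrier (comps \<P> m)" "\<nu> \<in> carrier (comps \<P> n)"
    then have "m \<ge> 1" by auto
    then show "g (m + n - 1) (f (m + n - 1) (pcomp \<P> m n i \<mu> \<nu>)) = pcomp \<R> m n i (g m (f m \<mu>)) (g n (f n \<nu>))"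
      using a by (simp only: f.hom_pcomp g.hom_pcomp f.hom_closed)
  qed (use f.hom_unit g.hom_unit in \<open>auto simp: f.hom_closed g.hom_closed f.hom_add g.hom_add f.hom_smult g.hom_smult
      f.hom_sact g.hom_sact\<close>)
qed

section \<open>Decorated trees\<close>

lemma subst_subst: "subst s (subst r t) = subst (\<lambda>i. subst s (r i)) t"
  by (induction t) auto

lemma subst_cong: "(\<And>i. i \<in> Lin t \<Longrightarrow> s i = r i) \<Longrightarrow> subst s t = subst r t"
  by (induction t) auto

lemma subst_Leaf: "subst Leaf t = t"
  by (induction t) (auto intro: map_idI)

lemma relabel_Leaf [simp]: "relabel \<sigma> (Leaf i) = Leaf (\<sigma> i)"
  by (simp add: relabel_def)

lemma relabel_Node [simp]: "relabel \<sigma> (Node w ts) = Node w (map (relabel \<sigma>) ts)"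
  by (simp add: relabel_def)

lemma subst_relabel: "subst s (relabel \<sigma> t) = subst (\<lambda>i. s (\<sigma> i)) t"
  by (simp add: relabel_def subst_subst)

lemma relabel_subst: "relabel \<sigma> (subst s t) = subst (\<lambda>i. relabel \<sigma> (s i)) t"
  by (simp add: relabel_def subst_subst)

lemma relabel_relabel: "relabel \<sigma> (relabel \<tau> t) = relabel (\<lambda>i. \<sigma> (\<tau> i)) t"
  by (simp add: relabel_def subst_subst)

lemma relabel_id: "(\<And>i. i \<in> Lin t \<Longrightarrow> \<sigma> i = i) \<Longrightarrow> relabel \<sigma> t = t"
  using subst_cong[of t "\<lambda>i. Leaf (\<sigma> i)" Leaf] by (simp add: relabel_def subst_Leaf)

lemma size_relabel: "size (relabel \<sigma> t) = size t"
  by (induction t) (auto simp: size_list_conv_sum_list comp_def cong: map_cong)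

lemma leaves_subst: "leaves (subst s t) = concat (map (\<lambda>i. leaves (s i)) (leaves t))"
proof (induction t)
  case (Node w ts)
  have "concat (map (\<lambda>t. concat (map f (leaves t))) ts) = concat (map f (concat (map leaves ts)))"
    for f :: "nat \<Rightarrow> nat list"
    by (induction ts) auto
  with Node show ?case by (simp add: comp_def cong: map_cong)
qed simp

lemma leaves_relabel: "leaves (relabel \<sigma> t) = map \<sigma> (leaves t)"
  by (induction t) (auto simp: map_concat comp_def cong: map_cong)

lemma mset_leaves_subst:
  "mset (leaves (subst s t)) = (\<Sum>i\<in>#mset (leaves t). mset (leaves (s i)))"
  by (simp add: leaves_subst mset_concat comp_def sum_mset_sum_list[symmetric])

lemma decorated_subst:
  "decorated \<Omega> (subst s t) \<longleftrightarrow> decorated \<Omega> t \<and> (\<forall>i\<in>Lin t. decorated \<Omega> (s i))"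
  by (induction t) auto

lemma decorated_relabel [simp]: "decorated \<Omega> (relabel \<sigma> t) \<longleftrightarrow> decorated \<Omega> t"
  by (simp add: relabel_def decorated_subst)

lemma mset_leaves_Node:
  "mset (leaves (Node w ts)) = (\<Sum>i\<in>{1..length ts}. mset (leaves (ts ! (i - 1))))"
proof -
  have "mset (leaves (Node w ts)) = (\<Sum>i<length ts. mset (leaves (ts ! i)))"
    by (simp add: mset_concat comp_def sum_list_sum_nth atLeast0LessThan)
  also have "\<dots> = (\<Sum>i\<in>{1..length ts}. mset (leaves (ts ! (i - 1))))"
    by (rule sum.reindex_bij_witness[of _ "\<lambda>i. i - 1" Suc]) auto
  finally show ?thesis .
qed

text \<open>Distinctness and the set of labels merge into one equation of multisets. In this form
  the condition is additive under grafting and substitution and insensitive to the order of the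
  subtrees.\<close>

lemma labeled_trees_iff:
  "t \<in> labeled_trees \<Omega> n \<longleftrightarrow> decorated \<Omega> t \<and> mset (leaves t) = mset_set {1..n}"
proof -
  have "distinct (leaves t) \<and> Lin t = {1..n} \<longleftrightarrow> mset (leaves t) = mset_set {1..n}"
  proof
    assume "distinct (leaves t) \<and> Lin t = {1..n}"
    then show "mset (leaves t) = mset_set {1..n}" using mset_set_set by metis
  next
    assume a: "mset (leaves t) = mset_set {1..n}"
    then have s: "set_mset (mset (leaves t)) = {1..n}" by simp
    have "distinct (leaves t)"
      unfolding distinct_count_atmost_1 count_mset[symmetric] a 
      using s by (auto simp: count_mset_set')
    with s show "distinct (leaves t) \<and> Lin t = {1..n}" by simp
  qed
  then show ?thesis by (auto simp: labeled_trees_def)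
qed

lemma labeled_trees_Lin: "t \<in> labeled_trees \<Omega> n \<Longrightarrow> Lin t = {1..n}"
  by (simp add: labeled_trees_def)

lemma labeled_trees_decorated: "t \<in> labeled_trees \<Omega> n \<Longrightarrow> decorated \<Omega> t"
  by (simp add: labeled_trees_def)

lemma Leaf_labeled: "Leaf 1 \<in> labeled_trees \<Omega> 1"
  by (simp add: labeled_trees_def)

text \<open>The condition for \<open>subst s\<close> to turn labels \<open>1, ..., m\<close> into
  labels \<open>1, ..., N\<close>. It refers to \<open>s\<close> alone, so one tree decides it for
  all trees of arity \<open>m\<close>.\<close>

definition labeled_subst :: "(nat \<Rightarrow> 'v set) \<Rightarrow> nat \<Rightarrow> (nat \<Rightarrow> 'v tree) \<Rightarrow> nat \<Rightarrow> bool" where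
  "labeled_subst \<Omega> m s N \<longleftrightarrow>
     (\<forall>j\<in>{1..m}. decorated \<Omega> (s j)) \<and> (\<Sum>j\<in>{1..m}. mset (leaves (s j))) = mset_set {1..N}"

lemma subst_labeled_iff:
  assumes "t \<in> labeled_trees \<Omega> m"
  shows "subst s t \<in> labeled_trees \<Omega> N \<longleftrightarrow> labeled_subst \<Omega> m s N"
proof -
  have "mset (leaves (subst s t)) = (\<Sum>j\<in>{1..m}. mset (leaves (s j)))"
    using assms by (simp add: mset_leaves_subst labeled_trees_iff sum_unfold_sum_mset)
  then show ?thesis
    using assms labeled_trees_Lin[OF assms]
    by (auto simp: labeled_trees_iff decorated_subst labeled_subst_def)
qed

lemma sum_mset_set_inj:
  "inj_on f A \<Longrightarrow> (\<Sum>j\<in>A. {#f j#}) = mset_set (f ` A)"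
  by (simp add: image_mset_mset_set[symmetric] sum_unfold_sum_mset)

text \<open>The labels of \<open>u\<close> fill the block from \<open>i\<close> to
  \<open>i + n - 1\<close> and the remaining labels its complement, so that the two images partition
  the range.\<close>

lemma tree_comp_labeled_subst:
  assumes "u \<in> labeled_trees \<Omega> n" "n \<ge> 1" "i \<in> {1..m}"
  shows "labeled_subst \<Omega> m (\<lambda>j. if j = i then relabel (inner i) u else Leaf (outer i n j)) (m + n - 1)"
proof -
  let ?s = "\<lambda>j. if j = i then relabel (inner i) u else Leaf (outer i n j)"
  have "(\<Sum>j\<in>{1..m}. mset (leaves (?s j))) =
    mset (leaves (?s i)) + (\<Sum>j\<in>{1..m} - {i}. mset (leaves (?s j)))"
    using assms by (subst sum.remove[of _ i]) auto
  also have "mset (leaves (?s i)) = mset_set (inner i ` {1..n})"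
    using assms by (simp add: leaves_relabel labeled_trees_iff mset_map)
      (subst image_mset_mset_set, auto simp: inj_on_def inner_def)
  also have "(\<Sum>j\<in>{1..m} - {i}. mset (leaves (?s j))) = (\<Sum>j\<in>{1..m} - {i}. {#outer i n j#})"
    by (rule sum.cong) auto
  also have "\<dots> = mset_set (outer i n ` ({1..m} - {i}))"
    using assms by (intro sum_mset_set_inj) (auto simp: inj_on_def outer_def split: if_splits)
  also have "mset_set (inner i ` {1..n}) + mset_set (outer i n ` ({1..m} - {i})) =
    mset_set (inner i ` {1..n} \<union> outer i n ` ({1..m} - {i}))"
    using assms by (intro mset_set_Union[symmetric]) (auto simp: inner_def outer_def split: if_splits)
  also have "inner i ` {1..n} \<union> outer i n ` ({1..m} - {i}) = {1..m + n - 1}"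
  proof (intro equalityI subsetI)
    fix q assume q: "q \<in> {1..m + n - 1}"
    consider "q < i" | "i \<le> q" "q < i + n" | "i + n \<le> q" by linarith
    then show "q \<in> inner i ` {1..n} \<union> outer i n ` ({1..m} - {i})"
    proof cases
      case 1
      then show ?thesis using q assms by (intro UnI2 image_eqI[of _ _ q]) (auto simp: outer_def)
    next
      case 2
      then show ?thesis using q assms by (intro UnI1 image_eqI[of _ _ "q + 1 - i"]) (auto simp: inner_def)
    next
      case 3
      then show ?thesis using q assms by (intro UnI2 image_eqI[of _ _ "q + 1 - n"]) (auto simp: outer_def)
    qed
  qed (use assms in \<open>auto simp: inner_def outer_def split: if_splits\<close>)
  finally show ?thesis using assms by (auto simp: labeled_subst_def labeled_trees_iff)
qed

lemma tree_comp_labeled: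
  assumes "t \<in> labeled_trees \<Omega> m" "u \<in> labeled_trees \<Omega> n" "n \<ge> 1" "i \<in> {1..m}"
  shows "tree_comp n i t u \<in> labeled_trees \<Omega> (m + n - 1)"
  unfolding tree_comp_def using subst_labeled_iff[OF assms(1)] tree_comp_labeled_subst[OF assms(2-4)] by blast

lemma relabel_labeled:
  assumes "t \<in> labeled_trees \<Omega> n" "\<sigma> permutes {1..n}"
  shows "relabel \<sigma> t \<in> labeled_trees \<Omega> n"
proof -
  have "(\<Sum>j\<in>{1..n}. {#\<sigma> j#}) = mset_set (\<sigma> ` {1..n})"
    using assms(2) by (intro sum_mset_set_inj) (auto simp: permutes_inj_on)
  then have "labeled_subst \<Omega> n (\<lambda>i. Leaf (\<sigma> i)) n"
    using permutes_image[OF assms(2)] by (simp add: labeled_subst_def)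
  then show ?thesis unfolding relabel_def using subst_labeled_iff[OF assms(1)] by blast
qed

text \<open>Both sides are substitutions into \<open>t\<close>, so they are compared leaf by leaf.
  At the leaf \<open>i\<close> the comparison continues with the leaves of \<open>u\<close>; the
  other leaves are only renumbered.\<close>

lemma tree_comp_assoc_seq:
  assumes "i \<in> {1..l}" "j \<in> {1..m}" "n \<ge> 1"
    and t: "t \<in> labeled_trees \<Omega> l" "u \<in> labeled_trees \<Omega> m" "v \<in> labeled_trees \<Omega> n"
  shows "tree_comp n (inner i j) (tree_comp m i t u) v = tree_comp (m + n - 1) i t (tree_comp n j u v)"
  unfolding tree_comp_def subst_subst
proof (rule subst_cong)
  fix k assume "k \<in> Lin t"
  then have k: "k \<in> {1..l}" using t labeled_trees_Lin by blast
  let ?s = "\<lambda>k. if k = inner i j then relabel (inner (inner i j)) v else Leaf (outer (inner i j) n k)"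
  show "subst ?s (if k = i then relabel (inner i) u else Leaf (outer i m k)) =
    (if k = i then relabel (inner i) (subst (\<lambda>k. if k = j then relabel (inner j) v else Leaf (outer j n k)) u)
     else Leaf (outer i (m + n - 1) k))"
  proof (cases "k = i")
    case True
    have "subst (\<lambda>k. ?s (inner i k)) u =
      subst (\<lambda>k. relabel (inner i) (if k = j then relabel (inner j) v else Leaf (outer j n k))) u"
    proof (rule subst_cong)
      fix q assume "q \<in> Lin u"
      then have q: "q \<in> {1..m}" using t labeled_trees_Lin by blast
      have "relabel (inner (inner i j)) v = relabel (\<lambda>q. inner i (inner j q)) v"
        unfolding relabel_def using assms labeled_trees_Lin[OF t(3)]
        by (intro subst_cong) (auto simp: inner_def)
      then show "?s (inner i q) = relabel (inner i) (if q = j then relabel (inner j) v else Leaf (outer j n q))"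
        using q assms by (auto simp: relabel_relabel inner_def outer_def)
    qed
    then show ?thesis using True by (simp add: subst_relabel relabel_subst)
  next
    case False
    then show ?thesis using k assms by (auto simp: inner_def outer_def)
  qed
qed

text \<open>Since \<open>i < j\<close>, the labels inserted at \<open>i\<close> are smaller than the
  later insertion point and stay untouched, while the labels inserted at \<open>j\<close> are
  shifted by \<open>m - 1\<close>.\<close>

lemma tree_comp_assoc_par:
  assumes "1 \<le> i" "i < j" "j \<le> l" "m \<ge> 1" "n \<ge> 1"
    and t: "t \<in> labeled_trees \<Omega> l" "u \<in> labeled_trees \<Omega> m" "v \<in> labeled_trees \<Omega> n"
  shows "tree_comp n (outer i m j) (tree_comp m i t u) v = tree_comp m i (tree_comp n j t v) u"
  unfolding tree_comp_def subst_subst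
proof (rule subst_cong)
  fix k assume "k \<in> Lin t"
  then have k: "k \<in> {1..l}" using t labeled_trees_Lin by blast
  let ?r = "\<lambda>k. if k = outer i m j then relabel (inner (outer i m j)) v else Leaf (outer (outer i m j) n k)"
  let ?s = "\<lambda>k. if k = i then relabel (inner i) u else Leaf (outer i m k)"
  have u: "subst (\<lambda>k. ?r (inner i k)) u = relabel (inner i) u"
    unfolding relabel_def using assms labeled_trees_Lin[OF t(2)]
    by (intro subst_cong) (auto simp: inner_def outer_def)
  have v: "subst (\<lambda>k. ?s (inner j k)) v = relabel (inner (outer i m j)) v"
    unfolding relabel_def using assms labeled_trees_Lin[OF t(3)]
    by (intro subst_cong) (auto simp: inner_def outer_def)
  show "subst ?r (if k = i then relabel (inner i) u else Leaf (outer i m k)) =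
    subst ?s (if k = j then relabel (inner j) v else Leaf (outer j n k))"
  proof -
    consider "k = i" | "k = j" | "k \<noteq> i" "k \<noteq> j" by blast
    then show ?thesis
    proof cases
      case 1
      have "outer j n i = i" using assms(2) by (simp add: outer_def)
      then show ?thesis using 1 u assms(2) by (simp add: subst_relabel)
    next
      case 2
      then show ?thesis using v assms(2) by (simp add: subst_relabel)
    next
      case 3
      have "outer i m k \<noteq> outer i m j" "outer j n k \<noteq> i"
        "outer (outer i m j) n (outer i m k) = outer i m (outer j n k)"
        using 3 assms(1-5) by (auto simp: outer_def)
      then show ?thesis using 3 by simp
    qed
  qed
qed

lemma tree_comp_relabel_outer:
  assumes "i \<in> {1..m}" "\<sigma> permutes {1..m}" "n \<ge> 1"
    and t: "t \<in> labeled_trees \<Omega> m" "u \<in> labeled_trees \<Omega> n"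
  shows "tree_comp n (\<sigma> i) (relabel \<sigma> t) u = relabel (outer_perm i n \<sigma>) (tree_comp n i t u)"
  unfolding tree_comp_def subst_relabel relabel_subst
proof (rule subst_cong)
  fix k assume "k \<in> Lin t"
  then have k: "k \<in> {1..m}" using t labeled_trees_Lin by blast
  have inj: "\<sigma> a = \<sigma> b \<longleftrightarrow> a = b" for a b using assms(2) by (meson permutes_inj injD)
  have "relabel (inner (\<sigma> i)) u = relabel (\<lambda>q. outer_perm i n \<sigma> (inner i q)) u"
    unfolding relabel_def using assms labeled_trees_Lin[OF t(2)]
    by (intro subst_cong) (auto simp: inner_def outer_perm_def)
  then show "(if \<sigma> k = \<sigma> i then relabel (inner (\<sigma> i)) u else Leaf (outer (\<sigma> i) n (\<sigma> k))) =
    relabel (outer_perm i n \<sigma>) (if k = i then relabel (inner i) u else Leaf (outer i n k))"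
    using k assms(1,3) by (cases "k = i") (auto simp: inj relabel_relabel, auto simp: outer_def outer_perm_def)
qed

lemma tree_comp_relabel_inner:
  assumes "i \<in> {1..m}" "\<tau> permutes {1..n}" "n \<ge> 1"
    and t: "t \<in> labeled_trees \<Omega> m" "u \<in> labeled_trees \<Omega> n"
  shows "tree_comp n i t (relabel \<tau> u) = relabel (inner_perm i n \<tau>) (tree_comp n i t u)"
  unfolding tree_comp_def relabel_subst
proof (rule subst_cong)
  fix k assume "k \<in> Lin t"
  then have k: "k \<in> {1..m}" using t labeled_trees_Lin by blast
  have "relabel (\<lambda>q. inner i (\<tau> q)) u = relabel (\<lambda>q. inner_perm i n \<tau> (inner i q)) u"
    unfolding relabel_def using assms labeled_trees_Lin[OF t(2)]
    by (intro subst_cong) (auto simp: inner_def inner_perm_def)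
  then show "(if k = i then relabel (inner i) (relabel \<tau> u) else Leaf (outer i n k)) =
    relabel (inner_perm i n \<tau>) (if k = i then relabel (inner i) u else Leaf (outer i n k))"
    using k assms(1,3) by (cases "k = i") (auto simp: relabel_relabel, auto simp: outer_def inner_perm_def)
qed

lemma tree_comp_unit_left:
  assumes "u \<in> labeled_trees \<Omega> n"
  shows "tree_comp n 1 (Leaf 1) u = u"
  by (simp add: tree_comp_def inner_def relabel_id)

lemma tree_comp_unit_right:
  assumes "t \<in> labeled_trees \<Omega> m" "i \<in> {1..m}"
  shows "tree_comp 1 i t (Leaf 1) = t"
proof -
  have "tree_comp 1 i t (Leaf 1) = subst Leaf t"
    unfolding tree_comp_def by (rule subst_cong) (auto simp: inner_def outer_def)
  then show ?thesis by (simp add: subst_Leaf)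
qed

section \<open>Isomorphism of trees\<close>

locale symmetric_basis =
  fixes \<Omega> :: "nat \<Rightarrow> 'v set" and act :: "nat \<Rightarrow> (nat \<Rightarrow> nat) \<Rightarrow> 'v \<Rightarrow> 'v"
  assumes sym: "sym_action \<Omega> act"
begin

lemma act_id: "n \<ge> 1 \<Longrightarrow> w \<in> \<Omega> n \<Longrightarrow> act n id w = w"
  and act_closed: "n \<ge> 1 \<Longrightarrow> w \<in> \<Omega> n \<Longrightarrow> \<sigma> permutes {1..n} \<Longrightarrow> act n \<sigma> w \<in> \<Omega> n"
  and act_comp: "n \<ge> 1 \<Longrightarrow> w \<in> \<Omega> n \<Longrightarrow> \<sigma> permutes {1..n} \<Longrightarrow> \<tau> permutes {1..n} \<Longrightarrow>
    act n \<sigma> (act n \<tau> w) = act n (\<sigma> \<circ> \<tau>) w"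
  using sym unfolding sym_action_def by blast+

abbreviation iso where "iso \<equiv> tree_iso \<Omega> act"
abbreviation cl where "cl \<equiv> iso_class \<Omega> act"

lemma iso_decorated: "iso t u \<Longrightarrow> decorated \<Omega> t \<and> decorated \<Omega> u"
proof (induction rule: tree_iso.induct)
  case (2 n ts us w \<sigma>)
  have "decorated \<Omega> (ts ! k)" if "k < n" for k
  proof -
    \<comment> \<open>Surjectivity of \<open>\<sigma>\<close> is what reaches every subtree on the
      left.\<close>
    have "Suc k \<in> \<sigma> ` {1..n}" unfolding permutes_image[OF 2(5)] using that by auto
    then obtain i where "i \<in> {1..n}" "\<sigma> i = Suc k" by auto
    with "2.IH"[of i] show ?thesis by auto
  qed
  moreover have "decorated \<Omega> (us ! k)" if "k < n" for k
    using "2.IH"[of "Suc k"] that by auto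
  ultimately show ?case using 2 act_closed[of n w \<sigma>] by (auto simp: in_set_conv_nth)
qed simp

lemma iso_refl: "decorated \<Omega> t \<Longrightarrow> iso t t"
proof (induction t)
  case (Node w ts)
  then have "iso (Node (act (length ts) id w) ts) (Node w ts)"
    by (intro tree_iso.intros(2)) (auto simp: permutes_id Suc_le_eq intro!: Node.IH)
  then show ?case using Node by (simp add: act_id Suc_le_eq)
qed (auto intro: tree_iso.intros)

lemma iso_sym: "iso t u \<Longrightarrow> iso u t"
proof (induction rule: tree_iso.induct)
  case (2 n ts us w \<sigma>)
  let ?\<sigma>' = "inv_into UNIV \<sigma>"
  have p: "?\<sigma>' permutes {1..n}" using 2(5) by (rule permutes_inv)
  have "iso (Node (act n ?\<sigma>' (act n \<sigma> w)) us) (Node (act n \<sigma> w) ts)"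
  proof (rule tree_iso.intros(2))
    fix i assume i: "i \<in> {1..n}"
    then have "?\<sigma>' i \<in> {1..n}" using p by (simp only: permutes_in_image)
    from "2.IH"[OF this] show "iso (us ! (?\<sigma>' i - 1)) (ts ! (i - 1))"
      using permutes_inverses(1)[OF 2(5)] by simp
  qed (use 2 p act_closed in auto)
  moreover have "act n ?\<sigma>' (act n \<sigma> w) = w"
    using 2 p act_comp[of n w ?\<sigma>' \<sigma>] act_id by (simp add: permutes_inv_o)
  ultimately show ?case by simp
qed (rule tree_iso.intros)

text \<open>At the root the permutations compose to \<open>\<sigma> \<circ> \<tau>\<close>, in the
  order fixed by the convention for the action.\<close>

lemma iso_trans: "iso t u \<Longrightarrow> iso u v \<Longrightarrow> iso t v"
proof (induction arbitrary: v rule: tree_iso.induct)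
  case (2 n ts us w \<sigma>)
  note B = "2.hyps" and IH = "2.IH"
  from "2.prems" show ?case
  proof (cases rule: tree_iso.cases)
    case (2 n' vs w' \<tau>)
    have n: "n' = n" using 2 B by simp
    have "iso (Node (act n (\<sigma> \<circ> \<tau>) w') ts) (Node w' vs)"
    proof (rule tree_iso.intros(2))
      show "\<sigma> \<circ> \<tau> permutes {1..n}" using 2 B n by (intro permutes_compose) auto
      fix i assume i: "i \<in> {1..n}"
      then have t: "\<tau> i \<in> {1..n}" using 2 n by (simp only: permutes_in_image)
      have "iso (us ! (\<tau> i - 1)) (vs ! (i - 1))" using 2 i n by auto
      from IH[OF t this] show "iso (ts ! ((\<sigma> \<circ> \<tau>) i - 1)) (vs ! (i - 1))" by simp
    qed (use 2 B n in auto)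
    then show ?thesis using 2 B n by (simp add: act_comp)
  qed
qed

lemma iso_mset_leaves: "iso t u \<Longrightarrow> mset (leaves t) = mset (leaves u)"
proof (induction rule: tree_iso.induct)
  case (2 n ts us w \<sigma>)
  have "(\<Sum>i\<in>{1..n}. mset (leaves (ts ! (i - 1)))) = (\<Sum>i\<in>{1..n}. mset (leaves (ts ! (\<sigma> i - 1))))"
    by (rule sum.permute[OF 2(5), unfolded o_def])
  also have "\<dots> = (\<Sum>i\<in>{1..n}. mset (leaves (us ! (i - 1))))"
    by (rule sum.cong) (use 2 in auto)
  finally show ?case using 2(2,3) unfolding mset_leaves_Node by simp
qed simp

lemma iso_labeled: "iso t u \<Longrightarrow> t \<in> labeled_trees \<Omega> n \<Longrightarrow> u \<in> labeled_trees \<Omega> n"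
  using iso_decorated iso_mset_leaves by (simp add: labeled_trees_iff)

text \<open>Partial composition and relabeling are substitutions, so this is what makes both well
  defined on isomorphism classes.\<close>

lemma iso_subst:
  "iso t u \<Longrightarrow> (\<And>j. j \<in> Lin t \<Longrightarrow> iso (s j) (s' j)) \<Longrightarrow> iso (subst s t) (subst s' u)"
proof (induction rule: tree_iso.induct)
  case (2 n ts us w \<sigma>)
  show ?case unfolding subst.simps
  proof (rule tree_iso.intros(2))
    fix i assume i: "i \<in> {1..n}"
    then have "\<sigma> i \<in> {1..n}" using 2(5) by (simp only: permutes_in_image)
    then have m: "\<sigma> i - 1 < length ts" "i - 1 < length us" using i 2 by auto
    then have sub: "Lin (ts ! (\<sigma> i - 1)) \<subseteq> Lin (Node (act n \<sigma> w) ts)"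
      using nth_mem[OF m(1)] by (simp only: leaves.simps set_concat set_map) blast
    have "iso (subst s (ts ! (\<sigma> i - 1))) (subst s' (us ! (i - 1)))"
    proof (rule "2.IH"[OF i])
      fix j assume "j \<in> Lin (ts ! (\<sigma> i - 1))"
      with sub have "j \<in> Lin (Node (act n \<sigma> w) ts)" ..
      then show "iso (s j) (s' j)" by (rule "2.prems")
    qed
    then show "iso (map (subst s) ts ! (\<sigma> i - 1)) (map (subst s') us ! (i - 1))"
      using m by simp
  qed (use 2 in auto)
qed auto

text \<open>Isomorphism relates decorated trees only, so every tree that is not decorated has the
  empty class; the assumption on \<open>u\<close> excludes this coincidence.\<close>

lemma cl_eq_iff: "decorated \<Omega> u \<Longrightarrow> cl t = cl u \<longleftrightarrow> iso t u"
proof -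
  assume u: "decorated \<Omega> u"
  show "cl t = cl u \<longleftrightarrow> iso t u"
  proof
    assume "cl t = cl u"
    then show "iso t u" using iso_refl[OF u] unfolding iso_class_def by blast
  next
    assume "iso t u"
    then show "cl t = cl u" unfolding iso_class_def
      using iso_trans[OF \<open>iso t u\<close>] iso_trans[OF iso_sym[OF \<open>iso t u\<close>]] by blast
  qed
qed

lemma cl_eqI: "iso t u \<Longrightarrow> cl t = cl u"
  using cl_eq_iff iso_decorated by blast

lemma iso_representative: "decorated \<Omega> t \<Longrightarrow> iso t (representative (cl t))"
proof -
  assume "decorated \<Omega> t"
  then have "t \<in> cl t" unfolding iso_class_def by (simp add: iso_refl)
  then have "representative (cl t) \<in> cl t" unfolding representative_def by (rule someI[of "\<lambda>u. u \<in> cl t"])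
  then show "iso t (representative (cl t))" unfolding iso_class_def by simp
qed

lemma representative_labeled:
  "t \<in> labeled_trees \<Omega> n \<Longrightarrow> representative (cl t) \<in> labeled_trees \<Omega> n"
  using iso_labeled iso_representative labeled_trees_decorated by blast

lemma iso_tree_comp: "iso t t' \<Longrightarrow> iso u u' \<Longrightarrow> iso (tree_comp n i t u) (tree_comp n i t' u')"
proof -
  assume t: "iso t t'" and u: "iso u u'"
  have "iso (relabel (inner i) u) (relabel (inner i) u')"
    unfolding relabel_def by (rule iso_subst[OF u]) (rule tree_iso.intros(1))
  then show "iso (tree_comp n i t u) (tree_comp n i t' u')"
    unfolding tree_comp_def by (intro iso_subst[OF t]) (simp add: tree_iso.intros(1))
qed

lemma iso_relabel: "iso t t' \<Longrightarrow> iso (relabel \<sigma> t) (relabel \<sigma> t')"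
  unfolding relabel_def by (rule iso_subst) (auto intro: tree_iso.intros(1))

end

section \<open>The free operad\<close>

lemma free_module_simps [simp]:
  "carrier (free_module X) = {f. keys f \<subseteq> X}"
  "\<zero>\<^bsub>free_module X\<^esub> = 0" "f \<oplus>\<^bsub>free_module X\<^esub> g = f + g" "c \<odot>\<^bsub>free_module X\<^esub> f = scal c f"
  by (simp_all add: free_module_def)

lemma module_free_module:
  "Module.module base_field (free_module X :: ('k::field, 'b \<Rightarrow>\<^sub>0 'k) module)"
proof -
  have ad: "keys (f + g) \<subseteq> X"
    if "keys f \<subseteq> X" "keys g \<subseteq> X" for f g :: "'b \<Rightarrow>\<^sub>0 'k"
    using that Poly_Mapping.keys_add[of f g] by blast
  have sc: "keys (scal c f) \<subseteq> X"
    if "keys f \<subseteq> X" for c and f :: "'b \<Rightarrow>\<^sub>0 'k"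
    using that keys_scal[of c f] by blast
  have ne: "\<exists>g. keys g \<subseteq> X \<and> f + g = 0"
    if "keys f \<subseteq> X" for f :: "'b \<Rightarrow>\<^sub>0 'k"
    using that by (intro exI[of _ "- f"]) (simp add: keys_minus)
  show ?thesis
    by (intro moduleI cring_base_field abelian_groupI)
      (use ad sc ne in \<open>auto simp: PM.scale_left_distrib PM.scale_right_distrib algebra_simps\<close>)
qed

lemma free_operad_simps [simp]:
  "comps (free_operad \<Omega> act) n = free_module (iso_class \<Omega> act ` labeled_trees \<Omega> n)"
  "unit (free_operad \<Omega> act) = vec (iso_class \<Omega> act (Leaf 1))"
  by (simp_all add: free_operad_def)

lemma linear_pcomp_left: "Vector_Spaces.linear scal scal (\<lambda>f. pcomp (free_operad \<Omega> act) m n i f g)"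
  by (simp add: free_operad_def linear_lin_ext)

lemma linear_pcomp_right: "Vector_Spaces.linear scal scal (\<lambda>g. pcomp (free_operad \<Omega> act) m n i f g)"
  unfolding free_operad_def operad.simps
  by (intro linear_lin_ext_arg linear_lin_ext vector_space_scal)

lemma linear_sact: "Vector_Spaces.linear scal scal (sact (free_operad \<Omega> act) n \<sigma>)"
  by (simp add: free_operad_def linear_lin_ext)

context symmetric_basis
begin

text \<open>The definition composes chosen representatives. By congruence, any planar trees in the
  two classes give the same result, so later computations never meet the choice.\<close>

lemma pcomp_vec:
  assumes "t \<in> labeled_trees \<Omega> m" "u \<in> labeled_trees \<Omega> n"
  shows "pcomp (free_operad \<Omega> act) m n i (vec (cl t)) (vec (cl u)) = vec (cl (tree_comp n i t u))"
proof -
  have "iso (tree_comp n i t u) (tree_comp n i (representative (cl t)) (representative (cl u)))"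
    using assms by (intro iso_tree_comp iso_representative labeled_trees_decorated)
  then show ?thesis by (simp add: free_operad_def cl_eqI)
qed

lemma sact_vec:
  assumes "t \<in> labeled_trees \<Omega> n"
  shows "sact (free_operad \<Omega> act) n \<sigma> (vec (cl t)) = vec (cl (relabel \<sigma> t))"
proof -
  have "iso (relabel \<sigma> t) (relabel \<sigma> (representative (cl t)))"
    using assms by (intro iso_relabel iso_representative labeled_trees_decorated)
  then show ?thesis by (simp add: free_operad_def cl_eqI)
qed

text \<open>Every axiom is linear in each of its arguments, so the arguments are specialized one
  after the other to classes of trees, where the axiom is an identity of planar trees for
  \<open>tree_comp\<close> and \<open>relabel\<close>.\<close>

lemma operad_free: "operad (free_operad \<Omega> act :: ('k::field, 'v tree set \<Rightarrow>\<^sub>0 'k) operad)"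
proof (rule operad.intro, goal_cases)
  case (1 n)
  then show ?case by (simp add: module_free_module)
next
  case (2 n i m \<mu> \<nu>)
  have "keys (pcomp (free_operad \<Omega> act) m n i \<mu> \<nu>) \<subseteq> cl ` labeled_trees \<Omega> (m + n - 1)"
    unfolding free_operad_def operad.simps
  proof (intro keys_lin_ext)
    fix X Y assume "X \<in> keys \<mu>" "Y \<in> keys \<nu>"
    then have "X \<in> cl ` labeled_trees \<Omega> m" "Y \<in> cl ` labeled_trees \<Omega> n"
      using 2(3,4) by auto
    then obtain t u where "X = cl t" "t \<in> labeled_trees \<Omega> m" "Y = cl u" "u \<in> labeled_trees \<Omega> n"
      by blast
    then have "tree_comp n i (representative X) (representative Y) \<in> labeled_trees \<Omega> (m + n - 1)"
      using 2(1,2) by (intro tree_comp_labeled) (auto intro: representative_labeled)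
    then show "keys (vec (cl (tree_comp n i (representative X) (representative Y))))
      \<subseteq> cl ` labeled_trees \<Omega> (m + n - 1)" by simp
  qed
  then show ?case by simp
next
  case (3 n i m \<mu> \<mu>' \<nu>)
  then show ?case using linear_add[OF linear_pcomp_left] by simp
next
  case (4 n i m \<mu> \<nu> \<nu>')
  then show ?case using linear_add[OF linear_pcomp_right] by simp
next
  case (5 n i m \<mu> \<nu> c)
  then show ?case using linear_scale[OF linear_pcomp_left] by simp
next
  case (6 n i m \<mu> \<nu> c)
  then show ?case using linear_scale[OF linear_pcomp_right] by simp
next
  case 7
  then show ?case using imageI[OF Leaf_labeled, of cl] by simp
next
  case (8 n \<nu>)
  then have k: "keys \<nu> \<subseteq> cl ` labeled_trees \<Omega> n" by simp
  show ?case unfolding free_operad_simps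
    by (rule linear_eq_on_keys[OF linear_pcomp_right PM.linear_ident _ k])
      (auto simp: pcomp_vec[OF Leaf_labeled, simplified] tree_comp_unit_left[simplified])
next
  case (9 i m \<mu>)
  then have k: "keys \<mu> \<subseteq> cl ` labeled_trees \<Omega> m" by simp
  show ?case unfolding free_operad_simps
    by (rule linear_eq_on_keys[OF linear_pcomp_left PM.linear_ident _ k])
      (use 9 in \<open>auto simp: pcomp_vec[OF _ Leaf_labeled, simplified] tree_comp_unit_right[simplified]\<close>)
next
  case (10 n i l j m \<kappa> \<mu> \<nu>)
  then have k: "keys \<kappa> \<subseteq> cl ` labeled_trees \<Omega> l" "keys \<mu> \<subseteq> cl ` labeled_trees \<Omega> m"
    "keys \<nu> \<subseteq> cl ` labeled_trees \<Omega> n" by simp_all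
  let ?F = "free_operad \<Omega> act :: ('k, 'v tree set \<Rightarrow>\<^sub>0 'k) operad"
  show ?case
  proof (rule linear_eq_on_keys[OF _ _ _ k(1), where s = scal])
    fix X assume "X \<in> cl ` labeled_trees \<Omega> l"
    then obtain t where t: "X = cl t" "t \<in> labeled_trees \<Omega> l" by auto
    show "pcomp ?F (l + m - 1) n (inner i j) (pcomp ?F l m i (vec X) \<mu>) \<nu> =
        pcomp ?F l (m + n - 1) i (vec X) (pcomp ?F m n j \<mu> \<nu>)"
    proof (rule linear_eq_on_keys[OF _ _ _ k(2), where s = scal])
      fix Y assume "Y \<in> cl ` labeled_trees \<Omega> m"
      then obtain u where u: "Y = cl u" "u \<in> labeled_trees \<Omega> m" by auto
      show "pcomp ?F (l + m - 1) n (inner i j) (pcomp ?F l m i (vec X) (vec Y)) \<nu> =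
        pcomp ?F l (m + n - 1) i (vec X) (pcomp ?F m n j (vec Y) \<nu>)"
      proof (rule linear_eq_on_keys[OF _ _ _ k(3), where s = scal])
        fix Z assume "Z \<in> cl ` labeled_trees \<Omega> n"
        then obtain v where v: "Z = cl v" "v \<in> labeled_trees \<Omega> n" by auto
        have m: "m \<ge> 1" using 10(3) by auto
        have "tree_comp m i t u \<in> labeled_trees \<Omega> (l + m - 1)"
          "tree_comp n j u v \<in> labeled_trees \<Omega> (m + n - 1)"
          using t u v 10(1-3) m by (auto intro!: tree_comp_labeled simp del: One_nat_def)
        then show "pcomp ?F (l + m - 1) n (inner i j) (pcomp ?F l m i (vec X) (vec Y)) (vec Z) =
        pcomp ?F l (m + n - 1) i (vec X) (pcomp ?F m n j (vec Y) (vec Z))"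
          using t u v 10(1-3) by (simp only: pcomp_vec tree_comp_assoc_seq)
      qed (intro linear_pcomp_right linear_comp[OF linear_pcomp_right linear_pcomp_right])+
    qed (rule linear_comp[OF linear_pcomp_left linear_pcomp_right]
        linear_comp[OF linear_pcomp_right linear_pcomp_left])+
  qed (rule linear_comp[OF linear_pcomp_left linear_pcomp_left] linear_pcomp_left)+
next
  case (11 m n i j l \<kappa> \<mu> \<nu>)
  then have k: "keys \<kappa> \<subseteq> cl ` labeled_trees \<Omega> l" "keys \<mu> \<subseteq> cl ` labeled_trees \<Omega> m"
    "keys \<nu> \<subseteq> cl ` labeled_trees \<Omega> n" by simp_all
  let ?F = "free_operad \<Omega> act :: ('k, 'v tree set \<Rightarrow>\<^sub>0 'k) operad"
  show ?case
  proof (rule linear_eq_on_keys[OF _ _ _ k(1), where s = scal])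
    fix X assume "X \<in> cl ` labeled_trees \<Omega> l"
    then obtain t where t: "X = cl t" "t \<in> labeled_trees \<Omega> l" by auto
    show "pcomp ?F (l + m - 1) n (outer i m j) (pcomp ?F l m i (vec X) \<mu>) \<nu> =
        pcomp ?F (l + n - 1) m i (pcomp ?F l n j (vec X) \<nu>) \<mu>"
    proof (rule linear_eq_on_keys[OF _ _ _ k(2), where s = scal])
      fix Y assume "Y \<in> cl ` labeled_trees \<Omega> m"
      then obtain u where u: "Y = cl u" "u \<in> labeled_trees \<Omega> m" by auto
      show "pcomp ?F (l + m - 1) n (outer i m j) (pcomp ?F l m i (vec X) (vec Y)) \<nu> =
        pcomp ?F (l + n - 1) m i (pcomp ?F l n j (vec X) \<nu>) (vec Y)"
      proof (rule linear_eq_on_keys[OF _ _ _ k(3), where s = scal])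
        fix Z assume "Z \<in> cl ` labeled_trees \<Omega> n"
        then obtain v where v: "Z = cl v" "v \<in> labeled_trees \<Omega> n" by auto
        have "i \<in> {1..l}" "j \<in> {1..l}" using 11(3-5) by auto
        then have "tree_comp m i t u \<in> labeled_trees \<Omega> (l + m - 1)"
          "tree_comp n j t v \<in> labeled_trees \<Omega> (l + n - 1)"
          using t u v 11(1,2) by (auto intro!: tree_comp_labeled simp del: One_nat_def)
        then show "pcomp ?F (l + m - 1) n (outer i m j) (pcomp ?F l m i (vec X) (vec Y)) (vec Z) =
        pcomp ?F (l + n - 1) m i (pcomp ?F l n j (vec X) (vec Z)) (vec Y)"
          using t u v 11(1-5) by (simp only: pcomp_vec tree_comp_assoc_par)
      qed (rule linear_pcomp_right linear_comp[OF linear_pcomp_left linear_pcomp_right])+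
    qed (rule linear_comp[OF linear_pcomp_left linear_pcomp_right] linear_pcomp_right)+
  qed (rule linear_comp[OF linear_pcomp_left linear_pcomp_left])+
next
  case (12 n \<sigma> \<mu>)
  have "keys (sact (free_operad \<Omega> act) n \<sigma> \<mu>) \<subseteq> cl ` labeled_trees \<Omega> n"
    unfolding free_operad_def operad.simps
  proof (intro keys_lin_ext)
    fix X assume "X \<in> keys \<mu>"
    then have "X \<in> cl ` labeled_trees \<Omega> n" using 12(3) by auto
    then obtain t where "X = cl t" "t \<in> labeled_trees \<Omega> n" by blast
    then have "relabel \<sigma> (representative X) \<in> labeled_trees \<Omega> n"
      using 12(2) by (auto intro!: relabel_labeled representative_labeled)
    then show "keys (vec (cl (relabel \<sigma> (representative X)))) \<subseteq> cl ` labeled_trees \<Omega> n" by simp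
  qed
  then show ?case by simp
next
  case (13 n \<sigma> \<mu> \<nu>)
  then show ?case using linear_add[OF linear_sact] by simp
next
  case (14 n \<sigma> \<mu> c)
  then show ?case using linear_scale[OF linear_sact] by simp
next
  case (15 n \<mu>)
  then have k: "keys \<mu> \<subseteq> cl ` labeled_trees \<Omega> n" by simp
  show ?case
    by (rule linear_eq_on_keys[OF linear_sact PM.linear_ident _ k]) (auto simp: sact_vec relabel_id)
next
  case (16 n \<sigma> \<tau> \<mu>)
  then have k: "keys \<mu> \<subseteq> cl ` labeled_trees \<Omega> n" by simp
  show ?case
    by (rule linear_eq_on_keys[OF linear_comp[OF linear_sact linear_sact] linear_sact _ k])
      (use 16 in \<open>auto simp: sact_vec relabel_labeled relabel_relabel o_def\<close>)
next
  case (17 n i m \<sigma> \<mu> \<nu>)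
  then have k: "keys \<mu> \<subseteq> cl ` labeled_trees \<Omega> m"
    "keys \<nu> \<subseteq> cl ` labeled_trees \<Omega> n" by simp_all
  let ?F = "free_operad \<Omega> act :: ('k, 'v tree set \<Rightarrow>\<^sub>0 'k) operad"
  show ?case
  proof (rule linear_eq_on_keys[OF _ _ _ k(1), where s = scal])
    fix X assume "X \<in> cl ` labeled_trees \<Omega> m"
    then obtain t where t: "X = cl t" "t \<in> labeled_trees \<Omega> m" by auto
    show "pcomp ?F m n (\<sigma> i) (sact ?F m \<sigma> (vec X)) \<nu> =
      sact ?F (m + n - 1) (outer_perm i n \<sigma>) (pcomp ?F m n i (vec X) \<nu>)"
    proof (rule linear_eq_on_keys[OF _ _ _ k(2), where s = scal])
      fix Y assume "Y \<in> cl ` labeled_trees \<Omega> n"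
      then obtain u where u: "Y = cl u" "u \<in> labeled_trees \<Omega> n" by auto
      show "pcomp ?F m n (\<sigma> i) (sact ?F m \<sigma> (vec X)) (vec Y) =
        sact ?F (m + n - 1) (outer_perm i n \<sigma>) (pcomp ?F m n i (vec X) (vec Y))"
        using t u 17(1-3)
        by (simp only: pcomp_vec sact_vec relabel_labeled tree_comp_labeled tree_comp_relabel_outer)
    qed (rule linear_pcomp_right linear_comp[OF linear_sact linear_pcomp_right])+
  qed (rule linear_comp[OF linear_pcomp_left linear_sact] linear_comp[OF linear_sact linear_pcomp_left])+
next
  case (18 n i m \<tau> \<mu> \<nu>)
  then have k: "keys \<mu> \<subseteq> cl ` labeled_trees \<Omega> m"
    "keys \<nu> \<subseteq> cl ` labeled_trees \<Omega> n" by simp_all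
  let ?F = "free_operad \<Omega> act :: ('k, 'v tree set \<Rightarrow>\<^sub>0 'k) operad"
  show ?case
  proof (rule linear_eq_on_keys[OF _ _ _ k(1), where s = scal])
    fix X assume "X \<in> cl ` labeled_trees \<Omega> m"
    then obtain t where t: "X = cl t" "t \<in> labeled_trees \<Omega> m" by auto
    show "pcomp ?F m n i (vec X) (sact ?F n \<tau> \<nu>) =
      sact ?F (m + n - 1) (inner_perm i n \<tau>) (pcomp ?F m n i (vec X) \<nu>)"
    proof (rule linear_eq_on_keys[OF _ _ _ k(2), where s = scal])
      fix Y assume "Y \<in> cl ` labeled_trees \<Omega> n"
      then obtain u where u: "Y = cl u" "u \<in> labeled_trees \<Omega> n" by auto
      show "pcomp ?F m n i (vec X) (sact ?F n \<tau> (vec Y)) =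
        sact ?F (m + n - 1) (inner_perm i n \<tau>) (pcomp ?F m n i (vec X) (vec Y))"
        using t u 18(1-3)
        by (simp only: pcomp_vec sact_vec relabel_labeled tree_comp_labeled tree_comp_relabel_inner)
    qed (rule linear_comp[OF linear_pcomp_right linear_sact] linear_comp[OF linear_sact linear_pcomp_right])+
  qed (rule linear_pcomp_left linear_comp[OF linear_sact linear_pcomp_left])+
qed

end

section \<open>Morphisms from the free operad\<close>

lemma poly_mapping_keys_induct [consumes 1, case_names zero vec add scal]:
  assumes "keys f \<subseteq> X"
    and "P 0" "\<And>b. b \<in> X \<Longrightarrow> P (vec b)"
    and "\<And>f g. \<lbrakk>keys f \<subseteq> X; keys g \<subseteq> X; P f; P g\<rbrakk> \<Longrightarrow> P (f + g)"
    and "\<And>c f. \<lbrakk>keys f \<subseteq> X; P f\<rbrakk> \<Longrightarrow> P (scal c f)"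
  shows "P (f :: 'b \<Rightarrow>\<^sub>0 'k::field)"
proof -
  have "keys (\<Sum>b\<in>S. scal (lookup f b) (vec b)) \<subseteq> X \<and>
    P (\<Sum>b\<in>S. scal (lookup f b) (vec b))" if "finite S" "S \<subseteq> X" for S
    using that
  proof (induction S)
    case (insert b S)
    let ?g = "scal (lookup f b) (vec b)" and ?h = "\<Sum>b\<in>S. scal (lookup f b) (vec b)"
    have k: "keys ?g \<subseteq> X" using keys_scal[of _ "vec b"] insert by fastforce
    moreover have "P ?g" using insert assms by simp
    moreover have "keys (?g + ?h) \<subseteq> X"
      using k insert Poly_Mapping.keys_add[of ?g ?h] by blast
    ultimately show ?case using insert assms(4)[of ?g ?h] by simp
  qed (use assms in simp)
  from this[of "keys f"] assms(1) show ?thesis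
    using vec_expand[of f] by simp
qed

text \<open>By additivity and homogeneity, compatibility with composition and with the action needs
  checking only on classes of trees, where it can be read off from planar representatives.\<close>

lemma (in symmetric_basis) free_operad_homI:
  fixes \<Q> :: "('k::field, 'q) operad"
  assumes "operad \<Q>"
    and closed: "\<And>n f. n \<ge> 1 \<Longrightarrow> keys f \<subseteq> cl ` labeled_trees \<Omega> n \<Longrightarrow> h n f \<in> carrier (comps \<Q> n)"
    and add: "\<And>n f g. \<lbrakk>n \<ge> 1; keys f \<subseteq> cl ` labeled_trees \<Omega> n; keys g \<subseteq> cl ` labeled_trees \<Omega> n\<rbrakk>
      \<Longrightarrow> h n (f + g) = h n f \<oplus>\<^bsub>comps \<Q> n\<^esub> h n g"
    and smult: "\<And>n c f. \<lbrakk>n \<ge> 1; keys f \<subseteq> cl ` labeled_trees \<Omega> n\<rbrakk>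
      \<Longrightarrow> h n (scal c f) = c \<odot>\<^bsub>comps \<Q> n\<^esub> h n f"
    and h_unit: "h 1 (vec (cl (Leaf 1))) = unit \<Q>"
    and h_pcomp: "\<And>m n i t u. \<lbrakk>n \<ge> 1; i \<in> {1..m}; t \<in> labeled_trees \<Omega> m; u \<in> labeled_trees \<Omega> n\<rbrakk>
      \<Longrightarrow> h (m + n - 1) (vec (cl (tree_comp n i t u))) = pcomp \<Q> m n i (h m (vec (cl t))) (h n (vec (cl u)))"
    and h_sact: "\<And>n \<sigma> t. \<lbrakk>n \<ge> 1; \<sigma> permutes {1..n}; t \<in> labeled_trees \<Omega> n\<rbrakk>
      \<Longrightarrow> h n (vec (cl (relabel \<sigma> t))) = sact \<Q> n \<sigma> (h n (vec (cl t)))"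
  shows "operad_hom (free_operad \<Omega> act) \<Q> h"
proof -
  interpret F: operad "free_operad \<Omega> act :: ('k, 'v tree set \<Rightarrow>\<^sub>0 'k) operad" by (rule operad_free)
  interpret Q: operad \<Q> by fact
  let ?F = "free_operad \<Omega> act :: ('k, 'v tree set \<Rightarrow>\<^sub>0 'k) operad"
  have h_zero: "h n 0 = \<zero>\<^bsub>comps \<Q> n\<^esub>" if "n \<ge> 1" for n
    using smult[OF that, of 0 0] closed[OF that, of 0] that by (simp add: Q.zero_smult)
  have carr: "f \<in> carrier (comps ?F n) \<longleftrightarrow> keys f \<subseteq> cl ` labeled_trees \<Omega> n" for n f by simp
  have cc: "keys (pcomp ?F m n i f g) \<subseteq> cl ` labeled_trees \<Omega> (m + n - 1)"
    if "n \<ge> 1" "i \<in> {1..m}" "keys f \<subseteq> cl ` labeled_trees \<Omega> m"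
      "keys g \<subseteq> cl ` labeled_trees \<Omega> n" for m n i f g
    using F.pcomp_closed[of n i m f g] that unfolding carr by blast
  have cs: "keys (sact ?F n \<sigma> f) \<subseteq> cl ` labeled_trees \<Omega> n"
    if "n \<ge> 1" "\<sigma> permutes {1..n}" "keys f \<subseteq> cl ` labeled_trees \<Omega> n" for n \<sigma> f
    using F.sact_closed[of n \<sigma> f] that unfolding carr by blast
  have kv: "keys (vec (cl t) :: _ \<Rightarrow>\<^sub>0 'k) \<subseteq> cl ` labeled_trees \<Omega> n" if "t \<in> labeled_trees \<Omega> n" for t n
    using that by simp
  show ?thesis
  proof
    fix n i m \<mu> \<nu> assume a: "n \<ge> 1" "i \<in> {1..m}" "\<mu> \<in> carrier (comps ?F m)" "\<nu> \<in> carrier (comps ?F n)"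
    then have m: "m \<ge> 1" "m + n - 1 \<ge> 1" by auto
    have k: "keys \<mu> \<subseteq> cl ` labeled_trees \<Omega> m" "keys \<nu> \<subseteq> cl ` labeled_trees \<Omega> n"
      using a by simp_all
    from k(1) show "h (m + n - 1) (pcomp ?F m n i \<mu> \<nu>) = pcomp \<Q> m n i (h m \<mu>) (h n \<nu>)"
    proof (induction \<mu> rule: poly_mapping_keys_induct)
      case zero
      have "pcomp ?F m n i 0 \<nu> = 0"
        using F.pcomp_zero_left[OF a(1,2,4)] by simp
      then show ?case using Q.pcomp_zero_left[OF a(1,2) closed[OF a(1) k(2)]] m h_zero by simp
    next
      case (vec X)
      then obtain t where t: "X = cl t" "t \<in> labeled_trees \<Omega> m" by auto
      from k(2) show ?case
      proof (induction \<nu> rule: poly_mapping_keys_induct)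
        case zero
        have "pcomp ?F m n i (vec X) 0 = 0"
          using F.pcomp_zero_right[OF a(1,2), of "vec X"] t by simp
        then show ?case using Q.pcomp_zero_right[OF a(1,2) closed[OF m(1) kv[OF t(2)]]] m a(1) t h_zero by simp
      next
        case (vec Y)
        then obtain u where u: "Y = cl u" "u \<in> labeled_trees \<Omega> n" by auto
        then show ?case using t a(1,2) by (simp only: pcomp_vec h_pcomp)
      next
        case (add f g)
        then show ?case
          unfolding linear_add[OF linear_pcomp_right] t(1)
          using a(1,2) m kv[OF t(2)] by (simp only: assms(3) cc closed Q.pcomp_add_right)
      next
        case (scal c f)
        then show ?case
          unfolding linear_scale[OF linear_pcomp_right] t(1)
          using a(1,2) m kv[OF t(2)] by (simp only: smult cc closed Q.pcomp_smult_right)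
      qed
    next
      case (add f g)
      then show ?case
        unfolding linear_add[OF linear_pcomp_left]
        using a(1,2) m k(2) by (simp only: assms(3) cc closed Q.pcomp_add_left)
    next
      case (scal c f)
      then show ?case
        unfolding linear_scale[OF linear_pcomp_left]
        using a(1,2) m k(2) by (simp only: smult cc closed Q.pcomp_smult_left)
    qed
  next
    fix n \<sigma> \<mu> assume a: "n \<ge> 1" "\<sigma> permutes {1..n}" "\<mu> \<in> carrier (comps ?F n)"
    then have "keys \<mu> \<subseteq> cl ` labeled_trees \<Omega> n" by simp
    then show "h n (sact ?F n \<sigma> \<mu>) = sact \<Q> n \<sigma> (h n \<mu>)"
    proof (induction \<mu> rule: poly_mapping_keys_induct)
      case zero
      have "sact ?F n \<sigma> 0 = 0" using F.sact_zero[OF a(1,2)] by simp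
      then show ?case using Q.sact_zero[OF a(1,2)] a(1) h_zero by simp
    next
      case (vec X)
      then obtain t where t: "X = cl t" "t \<in> labeled_trees \<Omega> n" by auto
      then show ?case using a(1,2) by (simp only: sact_vec h_sact)
    next
      case (add f g)
      then show ?case
        unfolding linear_add[OF linear_sact] using a(1,2) by (simp only: assms(3) cs closed Q.sact_add)
    next
      case (scal c f)
      then show ?case
        unfolding linear_scale[OF linear_sact] using a(1,2) by (simp only: smult cs closed Q.sact_smult)
    qed
  qed (use closed add smult h_unit in auto)
qed

section \<open>Iterated substitution\<close>

lemma decorated_leaves: "decorated \<Omega> t \<Longrightarrow> leaves t \<noteq> []"
proof (induction t)
  case (Node w ts)
  then show ?case by (cases ts) auto
qed simp

lemma labeled_trees_pos: "t \<in> labeled_trees \<Omega> n \<Longrightarrow> n \<ge> 1"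
  using decorated_leaves[of \<Omega> t] by (cases n) (auto simp: labeled_trees_def)

text \<open>Any bijection of the labels with \<open>1, ..., n\<close> serves, since a different one
  changes the tree only by a permutation of its inputs.\<close>

lemma standardize:
  assumes "decorated \<Omega> t" "distinct (leaves t)"
  obtains n \<beta> \<rho> where "relabel \<beta> t \<in> labeled_trees \<Omega> n"
    "\<And>x. x \<in> Lin t \<Longrightarrow> \<rho> (\<beta> x) = x" "\<And>x. x \<in> Lin t \<Longrightarrow> \<beta> x \<in> {1..n}"
    "\<And>l. l \<in> {1..n} \<Longrightarrow> \<beta> (\<rho> l) = l" "\<And>l. l \<in> {1..n} \<Longrightarrow> \<rho> l \<in> Lin t"
proof -
  obtain \<rho> where \<rho>: "bij_betw \<rho> {1..card (Lin t)} (Lin t)"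
    using ex_bij_betw_nat_finite_1[of "Lin t"] by auto
  let ?n = "card (Lin t)" and ?\<beta> = "inv_into {1..card (Lin t)} \<rho>"
  have \<beta>: "bij_betw ?\<beta> (Lin t) {1..?n}" using \<rho> by (rule bij_betw_inv_into)
  have "mset (leaves (relabel ?\<beta> t)) = image_mset ?\<beta> (mset_set (Lin t))"
    using assms(2) by (simp add: leaves_relabel mset_set_set)
  also have "\<dots> = mset_set {1..?n}"
    using \<beta> by (simp add: image_mset_mset_set bij_betw_def)
  finally have "relabel ?\<beta> t \<in> labeled_trees \<Omega> ?n" using assms(1) by (simp add: labeled_trees_iff)
  then show thesis
  proof (rule that)
    show "\<rho> (?\<beta> x) = x" if "x \<in> Lin t" for x using \<rho> that by (rule bij_betw_inv_into_right)
    show "?\<beta> x \<in> {1..?n}" if "x \<in> Lin t" for x using \<beta> that by (rule bij_betwE[rule_format])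
    show "?\<beta> (\<rho> l) = l" if "l \<in> {1..?n}" for l using \<rho> that by (rule bij_betw_inv_into_left)
    show "\<rho> l \<in> Lin t" if "l \<in> {1..?n}" for l using \<rho> that by (rule bij_betwE[rule_format])
  qed
qed

lemma distinct_countI:
  assumes "\<And>a. count (mset xs) a \<le> 1"
  shows "distinct xs"
proof -
  have "count (mset xs) a \<ge> 1" if "a \<in> set xs" for a
    using that by (simp add: Suc_le_eq)
  then show ?thesis
    using assms by (auto simp: distinct_count_atmost_1 intro!: order_antisym)
qed

lemma labeled_subst_distinct:
  assumes "labeled_subst \<Omega> m s N" "j \<in> {1..m}"
  shows "distinct (leaves (s j))"
proof -
  have "mset (leaves (s j)) \<subseteq># (\<Sum>j\<in>{1..m}. mset (leaves (s j)))"
    using assms(2) by (subst sum.remove[of _ j]) auto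
  then have "mset (leaves (s j)) \<subseteq># mset_set {1..N}" using assms(1) by (simp add: labeled_subst_def)
  then have "count (mset (leaves (s j))) a \<le> count (mset_set {1..N}) a" for a
    by (rule mset_subset_eq_count)
  moreover have "count (mset_set {1..N}) a \<le> 1" for a
    by (simp add: count_mset_set')
  ultimately show ?thesis
    by (meson distinct_countI le_trans)
qed

definition is_leaf :: "'v tree \<Rightarrow> bool" where
  "is_leaf t \<longleftrightarrow> (\<exists>i. t = Leaf i)"

text \<open>
  A substitution decomposes into partial compositions, performed one at a time, followed by a
  permutation of the leaves: in the step, the tree put at the leaf \<open>i\<close> is first standardized to \<open>u\<close>.
\<close>

lemma labeled_subst_induct [consumes 2, case_names perm step]:
  assumes "labeled_trees \<Omega> m \<noteq> {}" and "labeled_subst \<Omega> m s N"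
    and perm: "\<And>s \<sigma>. \<lbrakk>\<sigma> permutes {1..N}; \<And>j. j \<in> {1..N} \<Longrightarrow> s j = Leaf (\<sigma> j)\<rbrakk> \<Longrightarrow> Q N s"
    and step: "\<And>m s i n u \<rho> s'. \<lbrakk>i \<in> {1..m}; n \<ge> 1; u \<in> labeled_trees \<Omega> n; s i = relabel \<rho> u;
        \<And>l. l \<in> {1..n} \<Longrightarrow> s' (inner i l) = Leaf (\<rho> l);
        \<And>j. j \<in> {1..m} \<Longrightarrow> j \<noteq> i \<Longrightarrow> s' (outer i n j) = s j;
        \<And>t. t \<in> labeled_trees \<Omega> m \<Longrightarrow> subst s t = subst s' (tree_comp n i t u);
        Q (m + n - 1) s'\<rbrakk> \<Longrightarrow> Q m s"
  shows "Q m s"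
  using assms(1,2)
\<comment> \<open>The measure counts the positions at which something other than a leaf is
  inserted.\<close>
proof (induction "card {j \<in> {1..m}. \<not> is_leaf (s j)}" arbitrary: m s rule: less_induct)
  case less
  show ?case
  proof (cases "\<exists>i\<in>{1..m}. \<not> is_leaf (s i)")
    case False
    then have "\<forall>j. \<exists>k. j \<in> {1..m} \<longrightarrow> s j = Leaf k" by (auto simp: is_leaf_def)
    from choice[OF this] obtain k where k: "\<And>j. j \<in> {1..m} \<Longrightarrow> s j = Leaf (k j)" by blast
    \<comment> \<open>Only labels are exchanged here, and comparing the multisets of labels forces
      \<open>m = N\<close> and makes \<open>k\<close> a bijection.\<close>
    have "(\<Sum>j\<in>{1..m}. {#k j#}) = mset_set {1..N}"
      using less.prems(2) k by (simp add: labeled_subst_def)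
    then have e: "image_mset k (mset_set {1..m}) = mset_set {1..N}"
      by (simp add: sum_unfold_sum_mset)
    have "size (image_mset k (mset_set {1..m})) = m" by simp
    with e have m: "m = N" by simp
    have "set_mset (image_mset k (mset_set {1..m})) = k ` {1..m}" by simp
    with e m have im: "k ` {1..N} = {1..N}" by simp
    then have "bij_betw k {1..N} {1..N}" by (simp add: bij_betw_def finite_surj_inj)
    define \<sigma> where "\<sigma> j = (if j \<in> {1..N} then k j else j)" for j
    have "bij_betw \<sigma> {1..N} {1..N}"
      using \<open>bij_betw k {1..N} {1..N}\<close> by (subst bij_betw_cong[of _ _ k]) (auto simp: \<sigma>_def)
    then have "\<sigma> permutes {1..N}" by (rule bij_imp_permutes) (auto simp: \<sigma>_def)
    from perm[OF this] k m show ?thesis by (simp add: \<sigma>_def)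
  next
    case True
    then obtain i where i: "i \<in> {1..m}" "\<not> is_leaf (s i)" by blast
    have "decorated \<Omega> (s i)" using less.prems(2) i by (auto simp: labeled_subst_def)
    then obtain n \<beta> \<rho> where st: "relabel \<beta> (s i) \<in> labeled_trees \<Omega> n"
      "\<And>x. x \<in> Lin (s i) \<Longrightarrow> \<rho> (\<beta> x) = x"
      using labeled_subst_distinct[OF less.prems(2) i(1)] by (rule standardize) blast
    let ?u = "relabel \<beta> (s i)"
    have n: "n \<ge> 1" using st(1) by (rule labeled_trees_pos)
    have u: "s i = relabel \<rho> ?u" using st(2) by (simp add: relabel_relabel relabel_id)
    \<comment> \<open>After inserting \<open>?u\<close> at \<open>i\<close>, the positions from
      \<open>i\<close> to \<open>i + n - 1\<close> are its leaves, which still have to receive their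
      original labels; the later entries of \<open>s\<close> move up by
      \<open>n - 1\<close>.\<close>
    define s' where "s' q = (if q < i then s q else if q < i + n then Leaf (\<rho> (q + 1 - i)) else s (q + 1 - n))" for q
    have inn: "s' (inner i l) = Leaf (\<rho> l)" if "l \<in> {1..n}" for l
      using that i by (auto simp: s'_def inner_def)
    have out: "s' (outer i n j) = s j" if "j \<in> {1..m}" "j \<noteq> i" for j
      using that i n by (auto simp: s'_def outer_def)
    have sub: "subst s t = subst s' (tree_comp n i t ?u)" if "t \<in> labeled_trees \<Omega> m" for t
      unfolding tree_comp_def subst_subst
    proof (rule subst_cong)
      fix j assume "j \<in> Lin t"
      then have j: "j \<in> {1..m}" using labeled_trees_Lin[OF that] by simp
      have "subst (\<lambda>l. s' (inner i l)) ?u = relabel \<rho> ?u"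
        unfolding relabel_def[of \<rho>] using inn labeled_trees_Lin[OF st(1)] by (intro subst_cong) simp
      then show "s j = subst s' (if j = i then relabel (inner i) ?u else Leaf (outer i n j))"
        using j out u by (simp add: subst_relabel)
    qed
    obtain t where t: "t \<in> labeled_trees \<Omega> m" using less.prems(1) by blast
    have t': "tree_comp n i t ?u \<in> labeled_trees \<Omega> (m + n - 1)"
      using t st(1) n i(1) by (rule tree_comp_labeled)
    have lab: "labeled_subst \<Omega> (m + n - 1) s' N"
      using subst_labeled_iff[OF t] subst_labeled_iff[OF t'] sub[OF t] less.prems(2) by metis
    \<comment> \<open>The inserted block contributes leaves only, so the remaining nontrivial
      insertions come from positions other than \<open>i\<close>, and the measure drops.\<close>
    have "{q \<in> {1..m + n - 1}. \<not> is_leaf (s' q)} \<subseteq> outer i n ` ({j \<in> {1..m}. \<not> is_leaf (s j)} - {i})"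
    proof
      fix q assume q: "q \<in> {q \<in> {1..m + n - 1}. \<not> is_leaf (s' q)}"
      consider "q < i" | "i \<le> q" "q < i + n" | "i + n \<le> q" by linarith
      then show "q \<in> outer i n ` ({j \<in> {1..m}. \<not> is_leaf (s j)} - {i})"
      proof cases
        case 1
        then show ?thesis using q i by (intro image_eqI[of _ _ q]) (auto simp: outer_def s'_def)
      next
        case 2
        then show ?thesis using q by (auto simp: s'_def is_leaf_def)
      next
        case 3
        then show ?thesis using q i n by (intro image_eqI[of _ _ "q + 1 - n"]) (auto simp: outer_def s'_def)
      qed
    qed
    then have "card {q \<in> {1..m + n - 1}. \<not> is_leaf (s' q)} \<le>
      card (outer i n ` ({j \<in> {1..m}. \<not> is_leaf (s j)} - {i}))" by (intro card_mono) auto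
    also have "\<dots> \<le> card ({j \<in> {1..m}. \<not> is_leaf (s j)} - {i})" by (rule card_image_le) simp
    also have "\<dots> < card {j \<in> {1..m}. \<not> is_leaf (s j)}" using i by (intro card_Diff1_less) auto
    finally have "Q (m + n - 1) s'" using t' lab by (intro less.hyps) auto
    from step[OF i(1) n st(1) u inn out sub this] show ?thesis .
  qed
qed

section \<open>Ideals of the free operad\<close>

text \<open>Contexts are trees in which the leaf \<open>0\<close> is the hole and the leaf \<open>j + 1\<close> stands for the leaf \<open>j\<close>.\<close>

definition plug :: "'v tree \<Rightarrow> 'v tree \<Rightarrow> 'v tree" where
  "plug T t = subst (\<lambda>i. case i of 0 \<Rightarrow> t | Suc j \<Rightarrow> Leaf j) T"

lemma linear_tree_elem: "Vector_Spaces.linear scal scal (tree_elem \<Omega> act)"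
  unfolding tree_elem_def by (rule linear_lin_ext)

lemma tree_elem_vec [simp]: "tree_elem \<Omega> act (vec t) = vec (iso_class \<Omega> act t)"
  by (simp add: tree_elem_def)

context symmetric_basis
begin

lemma tree_elem_comp_left:
  assumes "keys f \<subseteq> labeled_trees \<Omega> m" "u \<in> labeled_trees \<Omega> n"
  shows "tree_elem \<Omega> act (map_basis (\<lambda>t. tree_comp n i t u) f) =
    pcomp (free_operad \<Omega> act) m n i (tree_elem \<Omega> act f) (vec (cl u))"
  by (rule linear_eq_on_keys[OF linear_comp[OF linear_tree_elem linear_map_basis]
        linear_comp[OF linear_pcomp_left linear_tree_elem] _ assms(1)])
    (use assms(2) in \<open>simp add: pcomp_vec\<close>)

lemma tree_elem_comp_right:
  assumes "keys f \<subseteq> labeled_trees \<Omega> n" "t \<in> labeled_trees \<Omega> m"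
  shows "tree_elem \<Omega> act (map_basis (\<lambda>u. tree_comp n i t u) f) =
    pcomp (free_operad \<Omega> act) m n i (vec (cl t)) (tree_elem \<Omega> act f)"
  by (rule linear_eq_on_keys[OF linear_comp[OF linear_tree_elem linear_map_basis]
        linear_comp[OF linear_pcomp_right linear_tree_elem] _ assms(1)])
    (use assms(2) in \<open>simp add: pcomp_vec\<close>)

lemma tree_elem_relabel:
  assumes "keys f \<subseteq> labeled_trees \<Omega> n"
  shows "tree_elem \<Omega> act (map_basis (relabel \<sigma>) f) = sact (free_operad \<Omega> act) n \<sigma> (tree_elem \<Omega> act f)"
  by (rule linear_eq_on_keys[OF linear_comp[OF linear_tree_elem linear_map_basis]
        linear_comp[OF linear_sact linear_tree_elem] _ assms(1)])
    (simp add: sact_vec)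

text \<open>Each step in the decomposition of \<open>s\<close> is a partial composition with a tree,
  under which the ideal is stable, and what remains at the end is the action of a
  permutation.\<close>

lemma ideal_subst:
  fixes N :: "nat \<Rightarrow> ('v tree set \<Rightarrow>\<^sub>0 'k::field) set"
  assumes I: "operadic_ideal (free_operad \<Omega> act) N"
    and "labeled_trees \<Omega> m \<noteq> {}" "labeled_subst \<Omega> m s l"
    and "keys f \<subseteq> labeled_trees \<Omega> m" "tree_elem \<Omega> act f \<in> N m"
  shows "tree_elem \<Omega> act (map_basis (subst s) f) \<in> N l"
proof -
  interpret operadic_ideal "free_operad \<Omega> act" N by (rule I)
  obtain t where "t \<in> labeled_trees \<Omega> m" using assms(2) by blast
  then have m: "m \<ge> 1" by (rule labeled_trees_pos)
  show ?thesis
    using assms(2,3,4,5) m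
  proof (induction arbitrary: f rule: labeled_subst_induct)
    case (perm s \<sigma>)
    have "map_basis (subst s) f = map_basis (relabel \<sigma>) f"
      unfolding relabel_def using perm(2) perm(3) labeled_trees_Lin
      by (intro map_basis_cong subst_cong) blast
    then show ?case
      using N_sact[OF perm(5,4,1)] tree_elem_relabel[OF perm(3)] by simp
  next
    case (step m s i n u \<rho> s')
    have e: "map_basis (subst s) f = map_basis (subst s') (map_basis (\<lambda>t. tree_comp n i t u) f)"
      unfolding map_basis_map_basis using step(7,9) by (intro map_basis_cong) blast
    show ?case unfolding e
    proof (rule step(8))
      show "keys (map_basis (\<lambda>t. tree_comp n i t u) f) \<subseteq> labeled_trees \<Omega> (m + n - 1)"
        by (rule keys_map_basis[OF step(9)]) (rule tree_comp_labeled[OF _ step(3,2,1)])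
      have "vec (cl u) \<in> carrier (comps (free_operad \<Omega> act) n)" using step(3) by simp
      then show "tree_elem \<Omega> act (map_basis (\<lambda>t. tree_comp n i t u) f) \<in> N (m + n - 1)"
        unfolding tree_elem_comp_left[OF step(9,3)] using step(2,1,10) by (intro N_pcomp_left)
      show "m + n - 1 \<ge> 1" using step by auto
    qed
  qed
qed

text \<open>Standardizing the context turns it into an element of the operad. Composing
  \<open>f\<close> into its hole is absorbed by the ideal, and the rest of the plugging is a
  substitution into the composite.\<close>

lemma ideal_plug:
  fixes N :: "nat \<Rightarrow> ('v tree set \<Rightarrow>\<^sub>0 'k::field) set"
  assumes I: "operadic_ideal (free_operad \<Omega> act) N"
    and f: "keys f \<subseteq> labeled_trees \<Omega> m" "tree_elem \<Omega> act f \<in> N m"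
    and t: "t \<in> labeled_trees \<Omega> m" "plug T (subst s t) \<in> labeled_trees \<Omega> l"
    and hole: "count (mset (leaves T)) 0 = 1"
  shows "tree_elem \<Omega> act (map_basis (\<lambda>t. plug T (subst s t)) f) \<in> N l"
proof -
  interpret operadic_ideal "free_operad \<Omega> act" N by (rule I)
  let ?c = "\<lambda>i. case i of 0 \<Rightarrow> subst s t | Suc j \<Rightarrow> Leaf j"
  have dec: "decorated \<Omega> T" using t(2) by (simp add: plug_def labeled_trees_iff decorated_subst)
  have "(\<Sum>i\<in>#mset (leaves T). mset (leaves (?c i))) = mset_set {1..l}"
    using t(2) by (simp add: plug_def labeled_trees_iff mset_leaves_subst)
  then have le: "count (\<Sum>i\<in>#mset (leaves T). mset (leaves (?c i))) a \<le> 1" for a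
    by (simp add: count_mset_set')
  \<comment> \<open>A label \<open>Suc a\<close> occurring twice in \<open>T\<close> would give the
    label \<open>a\<close> twice in the plugged tree; the hole 0 occurs once by assumption.\<close>
  have "count (mset (leaves T)) x \<le> 1" for x
  proof (cases x)
    case (Suc a)
    have "count (mset (leaves T)) x \<le> count (\<Sum>i\<in>#M. mset (leaves (?c i))) a" if "M = mset (leaves T)" for M
      unfolding that[symmetric] using Suc by (induction M) auto
    with le[of a] show ?thesis by (meson le_trans)
  qed (use hole in simp)
  then have "distinct (leaves T)" by (rule distinct_countI)
  with dec obtain M \<beta> \<rho> where st: "relabel \<beta> T \<in> labeled_trees \<Omega> M"
    "\<And>x. x \<in> Lin T \<Longrightarrow> \<rho> (\<beta> x) = x" "\<And>x. x \<in> Lin T \<Longrightarrow> \<beta> x \<in> {1..M}"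
    by (rule standardize) blast
  have z: "0 \<in> Lin T" using hole by (metis count_eq_zero_iff set_mset_mset zero_neq_one)
  let ?T = "relabel \<beta> T" and ?h = "\<beta> 0"
  have h: "?h \<in> {1..M}" using st(3)[OF z] .
  have m: "m \<ge> 1" using t(1) by (rule labeled_trees_pos)
  \<comment> \<open>The leaves of the inserted tree form the block of length \<open>m\<close> from
    \<open>?h\<close> on, where \<open>s\<close> acts. Elsewhere \<open>\<rho>\<close> recovers the
    label in \<open>T\<close>, and \<open>- 1\<close> undoes the shift that reserves 0 for the
    hole.\<close>
  define s' where "s' q = (if q < ?h then Leaf (\<rho> q - 1) else if q < ?h + m then s (q + 1 - ?h)
    else Leaf (\<rho> (q + 1 - m) - 1))" for q
  have e: "plug T (subst s u) = subst s' (tree_comp m ?h ?T u)" if u: "u \<in> labeled_trees \<Omega> m" for u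
    unfolding plug_def tree_comp_def subst_subst subst_relabel
  proof (rule subst_cong)
    fix x assume x: "x \<in> Lin T"
    show "(case x of 0 \<Rightarrow> subst s u | Suc j \<Rightarrow> Leaf j) =
      subst s' (if \<beta> x = ?h then relabel (inner ?h) u else Leaf (outer ?h m (\<beta> x)))"
    proof (cases x)
      case 0
      have "subst (\<lambda>l. s' (inner ?h l)) u = subst s u"
        using labeled_trees_Lin[OF u] h by (intro subst_cong) (auto simp: s'_def inner_def)
      then show ?thesis using 0 by (simp add: subst_relabel)
    next
      case (Suc j)
      then have "\<beta> x \<noteq> ?h" using st(2)[OF x] st(2)[OF z] by auto
      moreover have "s' (outer ?h m (\<beta> x)) = Leaf (\<rho> (\<beta> x) - 1)"
        using calculation m h by (auto simp: s'_def outer_def)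
      ultimately show ?thesis using Suc st(2)[OF x] by simp
    qed
  qed
  have tc: "tree_comp m ?h ?T u \<in> labeled_trees \<Omega> (M + m - 1)" if "u \<in> labeled_trees \<Omega> m" for u
    using st(1) that m h by (rule tree_comp_labeled)
  let ?f = "map_basis (\<lambda>u. tree_comp m ?h ?T u) f"
  have "map_basis (\<lambda>t. plug T (subst s t)) f = map_basis (subst s') ?f"
    unfolding map_basis_map_basis using e f(1) by (intro map_basis_cong) blast
  moreover have "tree_elem \<Omega> act (map_basis (subst s') ?f) \<in> N l"
  proof (rule ideal_subst[OF I])
    show "labeled_trees \<Omega> (M + m - 1) \<noteq> {}" using tc[OF t(1)] by blast
    \<comment> \<open>The condition does not depend on the tree, so the given \<open>t\<close>
      decides it.\<close>
    show "labeled_subst \<Omega> (M + m - 1) s' l"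
      using subst_labeled_iff[OF tc[OF t(1)]] e[OF t(1)] t(2) by metis
    show "keys ?f \<subseteq> labeled_trees \<Omega> (M + m - 1)"
      using tc by (intro keys_map_basis[OF f(1)])
    have "vec (cl ?T) \<in> carrier (comps (free_operad \<Omega> act) M)" using st(1) by simp
    then show "tree_elem \<Omega> act ?f \<in> N (M + m - 1)"
      unfolding tree_elem_comp_right[OF f(1) st(1)] using m h f(2) by (intro N_pcomp_right)
  qed
  ultimately show ?thesis by simp
qed

end

section \<open>Evaluation of trees\<close>

primrec tree_eval :: "(nat \<Rightarrow> 'w \<Rightarrow> (nat \<Rightarrow> 'a) \<Rightarrow> 'a) \<Rightarrow> (nat \<Rightarrow> 'a) \<Rightarrow> 'w tree \<Rightarrow> 'a" where
  "tree_eval M x (Leaf i) = x i"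
| "tree_eval M x (Node w ts) = M (length ts) w (\<lambda>j. map (tree_eval M x) ts ! (j - 1))"

text \<open>\<open>tree_eval\<close> reads the arguments off a list, so outside
  \<open>{1..n}\<close> the argument family has no meaning. Operations that look at the inputs
  \<open>1, ..., n\<close> only do not notice this.\<close>

definition local_ops :: "(nat \<Rightarrow> 'w set) \<Rightarrow> (nat \<Rightarrow> 'w \<Rightarrow> (nat \<Rightarrow> 'a) \<Rightarrow> 'a) \<Rightarrow> bool" where
  "local_ops \<Omega> M \<longleftrightarrow> (\<forall>n. \<forall>w\<in>\<Omega> n. \<forall>x y. (\<forall>j\<in>{1..n}. x j = y j) \<longrightarrow> M n w x = M n w y)"

lemma local_opsD: "local_ops \<Omega> M \<Longrightarrow> w \<in> \<Omega> n \<Longrightarrow> (\<And>j. j \<in> {1..n} \<Longrightarrow> x j = y j) \<Longrightarrow> M n w x = M n w y"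
  by (simp add: local_ops_def)

lemma tree_eval_Node:
  assumes "local_ops \<Omega> M" "w \<in> \<Omega> (length ts)"
  shows "tree_eval M x (Node w ts) = M (length ts) w (\<lambda>j. tree_eval M x (ts ! (j - 1)))"
  using assms by (auto intro!: local_opsD[OF assms])

lemma tree_eval_cong: "(\<And>i. i \<in> Lin t \<Longrightarrow> x i = y i) \<Longrightarrow> tree_eval M x t = tree_eval M y t"
proof (induction t)
  case (Node w ts)
  then have "map (tree_eval M x) ts = map (tree_eval M y) ts" by (intro map_cong) auto
  then show ?case by (simp only: tree_eval.simps)
qed simp

lemma tree_eval_subst: "tree_eval M x (subst s t) = tree_eval M (\<lambda>i. tree_eval M x (s i)) t"
proof (induction t)
  case (Node w ts)
  then have "map (tree_eval M x) (map (subst s) ts) = map (tree_eval M (\<lambda>i. tree_eval M x (s i))) ts" by simp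
  then show ?case by (simp only: tree_eval.simps subst.simps length_map)
qed simp

lemma tree_eval_relabel: "tree_eval M x (relabel \<sigma> t) = tree_eval M (\<lambda>i. x (\<sigma> i)) t"
  by (simp add: relabel_def tree_eval_subst)

text \<open>Passing from \<open>act n \<sigma> w\<close> to \<open>w\<close> permutes the inputs of
  the operation exactly as the isomorphism permutes the subtrees.\<close>

lemma tree_eval_iso:
  assumes loc: "local_ops \<Omega> M"
    and eqv: "\<And>n w \<sigma> x. \<lbrakk>n \<ge> 1; w \<in> \<Omega> n; \<sigma> permutes {1..n}\<rbrakk> \<Longrightarrow> M n (act n \<sigma> w) x = M n w (\<lambda>i. x (\<sigma> i))"
  shows "tree_iso \<Omega> act t u \<Longrightarrow> tree_eval M x t = tree_eval M x u"
proof (induction rule: tree_iso.induct)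
  case (2 n ts us w \<sigma>)
  have "tree_eval M x (Node (act n \<sigma> w) ts) = M n w (\<lambda>i. map (tree_eval M x) ts ! (\<sigma> i - 1))"
    using 2 by (simp add: eqv)
  also have "\<dots> = M n w (\<lambda>i. map (tree_eval M x) us ! (i - 1))"
  proof (rule local_opsD[OF loc 2(4)])
    fix j assume j: "j \<in> {1..n}"
    then have "\<sigma> j \<in> {1..n}" using 2(5) by (simp only: permutes_in_image)
    then have "\<sigma> j - 1 < length ts" "j - 1 < length us" using j 2 by auto
    then show "map (tree_eval M x) ts ! (\<sigma> j - 1) = map (tree_eval M x) us ! (j - 1)"
      using "2.IH"[OF j] by simp
  qed
  finally show ?case using 2 by simp
qed simp

definition multilinear_ops ::
  "(nat \<Rightarrow> 'w set) \<Rightarrow> ('k::field \<Rightarrow> 'a::ab_group_add \<Rightarrow> 'a) \<Rightarrow> (nat \<Rightarrow> 'w \<Rightarrow> (nat \<Rightarrow> 'a) \<Rightarrow> 'a) \<Rightarrow> bool" where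
  "multilinear_ops \<Omega> scale M \<longleftrightarrow> (\<forall>n. \<forall>w\<in>\<Omega> n. multilinear scale n (M n w))"

lemma multilinear_ops_local: "multilinear_ops \<Omega> scale M \<Longrightarrow> local_ops \<Omega> M"
  unfolding multilinear_ops_def local_ops_def multilinear_def by blast

text \<open>A label that occurs once lies in exactly one subtree, so only one input of the operation
  at the root varies with it.\<close>

lemma linear_tree_eval:
  assumes "vector_space scale" and M: "multilinear_ops \<Omega> scale M"
  shows "decorated \<Omega> t \<Longrightarrow> distinct (leaves t) \<Longrightarrow> j \<in> Lin t \<Longrightarrow>
    Vector_Spaces.linear scale scale (\<lambda>a. tree_eval M (x(j := a)) t)"
proof (induction t)
  case (Leaf i)
  then show ?case using assms(1) by (simp add: vector_space.linear_ident)
next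
  case (Node w ts)
  note loc = multilinear_ops_local[OF M]
  have w: "w \<in> \<Omega> (length ts)" using Node.prems by simp
  obtain t where "t \<in> set ts" "j \<in> Lin t" using Node.prems(3) by auto
  then obtain k where k: "k < length ts" "j \<in> Lin (ts ! k)" by (auto simp: in_set_conv_nth)
  have d: "decorated \<Omega> (ts ! k)" "distinct (leaves (ts ! k))"
    using Node.prems(1,2) k(1) by (auto simp: distinct_concat_iff)
  \<comment> \<open>If a second subtree contained \<open>j\<close>, the multiplicity of
    \<open>j\<close> would be at least two.\<close>
  have other: "j \<notin> Lin (ts ! k')" if "k' < length ts" "k' \<noteq> k" for k'
  proof -
    have "mset (leaves (Node w ts)) = (\<Sum>i<length ts. mset (leaves (ts ! i)))"
      by (simp add: mset_concat comp_def sum_list_sum_nth atLeast0LessThan)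
    also have "\<dots> = mset (leaves (ts ! k)) + (mset (leaves (ts ! k')) +
        (\<Sum>i\<in>{..<length ts} - {k} - {k'}. mset (leaves (ts ! i))))"
      using k that by (subst sum.remove[of _ k], simp, simp, subst sum.remove[of _ k'], auto)
    finally have "count (mset (leaves (Node w ts))) j \<ge> count (mset (leaves (ts ! k))) j + count (mset (leaves (ts ! k'))) j"
      by simp
    moreover have "count (mset (leaves (Node w ts))) j = 1"
      using Node.prems by (simp add: distinct_count_atmost_1)
    moreover have "count (mset (leaves (ts ! k))) j \<ge> 1" using k(2) d(2) by (simp add: distinct_count_atmost_1)
    ultimately have "count (mset (leaves (ts ! k'))) j = 0" by linarith
    then show ?thesis by (simp add: count_eq_zero_iff)
  qed
  let ?y = "\<lambda>i. tree_eval M x (ts ! (i - 1))"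
  have eq: "tree_eval M (x(j := a)) (Node w ts) = M (length ts) w (?y(Suc k := tree_eval M (x(j := a)) (ts ! k)))" for a
    unfolding tree_eval_Node[of \<Omega>, OF loc w]
  proof (rule local_opsD[of \<Omega>, OF loc w])
    fix i assume i: "i \<in> {1..length ts}"
    show "tree_eval M (x(j := a)) (ts ! (i - 1)) = (?y(Suc k := tree_eval M (x(j := a)) (ts ! k))) i"
    proof (cases "i = Suc k")
      case False
      then have "j \<notin> Lin (ts ! (i - 1))" using i by (intro other) auto
      then show ?thesis using False by (auto intro!: tree_eval_cong)
    qed simp
  qed
  have A: "Vector_Spaces.linear scale scale (\<lambda>b. M (length ts) w (?y(Suc k := b)))"
    using M w k(1) unfolding multilinear_ops_def multilinear_def by auto
  have B: "Vector_Spaces.linear scale scale (\<lambda>a. tree_eval M (x(j := a)) (ts ! k))"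
    using Node.IH[OF nth_mem[OF k(1)] d k(2)] .
  show ?case unfolding eq by (rule linear_comp[OF A B])
qed

lemma multilinear_tree_eval:
  assumes "vector_space scale" "multilinear_ops \<Omega> scale M" "t \<in> labeled_trees \<Omega> n"
  shows "multilinear scale n (\<lambda>x. tree_eval M x t)"
  unfolding multilinear_def
  using assms(3) linear_tree_eval[OF assms(1,2)]
  by (auto simp: labeled_trees_def intro: tree_eval_cong)

lemma End_operad_simps [simp]:
  "carrier (comps (End_operad scale) n) = {f. multilinear scale n f}"
  "f \<oplus>\<^bsub>comps (End_operad scale) n\<^esub> g = (\<lambda>x. f x + g x)"
  "c \<odot>\<^bsub>comps (End_operad scale) n\<^esub> f = (\<lambda>x. scale c (f x))"
  "\<zero>\<^bsub>comps (End_operad scale) n\<^esub> = (\<lambda>x. 0)"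
  "pcomp (End_operad scale) m n i f g = (\<lambda>x. f (\<lambda>j. if j = i then g (\<lambda>l. x (inner i l)) else x (outer i n j)))"
  "sact (End_operad scale) n \<sigma> f = (\<lambda>x. f (x \<circ> \<sigma>))"
  "unit (End_operad scale) = (\<lambda>x. x 1)"
  by (simp_all add: End_operad_def)

lemma multilinear_lin_to:
  assumes vs: "vector_space scale" and "\<And>b. b \<in> keys f \<Longrightarrow> multilinear scale n (h b)"
  shows "multilinear scale n (\<lambda>x. lin_to scale (\<lambda>b. h b x) f)"
proof -
  interpret vector_space scale by fact
  have "h b x = h b y" if "b \<in> keys f" "\<forall>j\<in>{1..n}. x j = y j" for b x y
    using assms(2)[OF that(1)] that(2) unfolding multilinear_def by blast
  moreover have "Vector_Spaces.linear scale scale (\<lambda>a. h b (x(j := a)))"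
    if "b \<in> keys f" "j \<in> {1..n}" for b x j
    using assms(2)[OF that(1)] that(2) unfolding multilinear_def by blast
  ultimately show ?thesis
    unfolding multilinear_def lin_to_def Vector_Spaces.linear_iff
    using vs by (auto intro!: sum.cong simp: scale_right_distrib sum.distrib scale_sum_right scale_left_commute)
qed

definition corolla :: "nat \<Rightarrow> 'w \<Rightarrow> 'w tree" where
  "corolla n w = Node w (args n Leaf)"

context symmetric_basis
begin

text \<open>Universal property of the free operad with values in an endomorphism operad:
  equivariance of the operations makes evaluation constant on isomorphism classes. That
  \<open>End_operad scale\<close> is an operad will be taken from the given algebra
  structure.\<close>

lemma tree_eval_hom:
  fixes scale :: "'k::field \<Rightarrow> 'a::ab_group_add \<Rightarrow> 'a"
  assumes vs: "vector_space scale" and "operad (End_operad scale)"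
    and M: "multilinear_ops \<Omega> scale M"
    and eqv: "\<And>n w \<sigma> x. \<lbrakk>n \<ge> 1; w \<in> \<Omega> n; \<sigma> permutes {1..n}\<rbrakk> \<Longrightarrow> M n (act n \<sigma> w) x = M n w (\<lambda>i. x (\<sigma> i))"
  shows "\<exists>h. operad_hom (free_operad \<Omega> act) (End_operad scale) h \<and>
    (\<forall>n f. keys f \<subseteq> labeled_trees \<Omega> n \<longrightarrow>
      h n (tree_elem \<Omega> act f) = (\<lambda>x. lin_to scale (tree_eval M x) f))"
proof -
  interpret vector_space scale by fact
  note loc = multilinear_ops_local[OF M]
  let ?h = "\<lambda>n f x. lin_to scale (\<lambda>X. tree_eval M x (representative X)) f"
  have rep: "tree_eval M x (representative (cl t)) = tree_eval M x t" if "t \<in> labeled_trees \<Omega> n" for t n x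
    using tree_eval_iso[OF loc eqv iso_representative[OF labeled_trees_decorated[OF that]]] by simp
  have "operad_hom (free_operad \<Omega> act) (End_operad scale) ?h"
  proof (rule free_operad_homI)
    fix n f assume k: "keys (f :: _ \<Rightarrow>\<^sub>0 'k) \<subseteq> cl ` labeled_trees \<Omega> n"
    have "multilinear scale n (?h n f)"
    proof (rule multilinear_lin_to[OF vs])
      fix X assume "X \<in> keys f"
      then have "X \<in> cl ` labeled_trees \<Omega> n" using k by blast
      then have "representative X \<in> labeled_trees \<Omega> n" by (auto intro: representative_labeled)
      then show "multilinear scale n (\<lambda>x. tree_eval M x (representative X))"
        by (rule multilinear_tree_eval[OF vs M])
    qed
    then show "?h n f \<in> carrier (comps (End_operad scale) n)" by simp
  next
    fix m n i t u assume a: "n \<ge> 1" "i \<in> {1..m}" "t \<in> labeled_trees \<Omega> m" "u \<in> labeled_trees \<Omega> n"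
    show "?h (m + n - 1) (vec (cl (tree_comp n i t u))) =
      pcomp (End_operad scale) m n i (?h m (vec (cl t))) (?h n (vec (cl u)))"
      using rep[OF tree_comp_labeled[OF a(3,4,1,2)]] rep[OF a(3)] rep[OF a(4)]
      by (auto simp: fun_eq_iff tree_comp_def tree_eval_subst tree_eval_relabel intro!: tree_eval_cong)
  next
    fix n \<sigma> t assume a: "n \<ge> 1" "\<sigma> permutes {1..n}" "t \<in> labeled_trees \<Omega> n"
    show "?h n (vec (cl (relabel \<sigma> t))) = sact (End_operad scale) n \<sigma> (?h n (vec (cl t)))"
      using rep[OF relabel_labeled[OF a(3,2)]] rep[OF a(3)] by (simp add: fun_eq_iff tree_eval_relabel o_def)
  qed (use rep[OF Leaf_labeled] in \<open>simp_all add: assms fun_eq_iff lin_to_add lin_to_scale\<close>)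
  moreover have "?h n (tree_elem \<Omega> act f) x = lin_to scale (tree_eval M x) f"
    if "keys f \<subseteq> labeled_trees \<Omega> n" for n f x
    by (rule linear_eq_on_keys[OF linear_comp[OF linear_lin_to linear_tree_elem] linear_lin_to _ that])
      (simp add: rep)
  ultimately show ?thesis by blast
qed

lemma corolla_labeled: "n \<ge> 1 \<Longrightarrow> w \<in> \<Omega> n \<Longrightarrow> corolla n w \<in> labeled_trees \<Omega> n"
proof -
  assume n: "n \<ge> 1" "w \<in> \<Omega> n"
  have l: "leaves (corolla n w) = [1..<Suc n]"
    by (simp add: corolla_def args_def comp_def del: upt_Suc)
  have "decorated \<Omega> (corolla n w)"
    using n by (auto simp: corolla_def args_def)
  then show ?thesis unfolding labeled_trees_def by (simp add: l atLeastLessThanSuc_atLeastAtMost del: upt_Suc)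
qed

text \<open>A morphism is determined by its values on corollas: a tree arises by substituting its
  subtrees into the corolla of its root, and a substitution decomposes into partial compositions and
  a permutation, both respected by \<open>f\<close>.\<close>

lemma hom_End_tree_eval:
  fixes scale :: "'k::field \<Rightarrow> 'a::ab_group_add \<Rightarrow> 'a"
  assumes f: "operad_hom (free_operad \<Omega> act) (End_operad scale) f"
    and t: "t \<in> labeled_trees \<Omega> n"
  shows "f n (vec (cl t)) x = tree_eval (\<lambda>n w. f n (vec (cl (corolla n w)))) x t"
proof -
  interpret operad_hom "free_operad \<Omega> act" "End_operad scale" f by (rule f)
  define M where "M = (\<lambda>n w. f n (vec (cl (corolla n w))))"
  have f_cong: "f n (vec (cl t)) x = f n (vec (cl t)) y"
    if "t \<in> labeled_trees \<Omega> n" "\<And>j. j \<in> {1..n} \<Longrightarrow> x j = y j" for n t x y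
  proof -
    have "multilinear scale n (f n (vec (cl t)))"
      using hom_closed[OF labeled_trees_pos[OF that(1)], of "vec (cl t)"] that(1) by simp
    then show ?thesis using that(2) unfolding multilinear_def by blast
  qed
  \<comment> \<open>Arity zero is cut off: the corolla without inputs is not a labeled tree, so
    nothing is known about the value of \<open>f\<close> on it.\<close>
  have loc: "local_ops (\<lambda>n. if n \<ge> 1 then \<Omega> n else {}) M"
    unfolding local_ops_def M_def
  proof (intro allI ballI impI)
    fix n w and x y :: "nat \<Rightarrow> 'a"
    assume "w \<in> (if n \<ge> 1 then \<Omega> n else {})" and e: "\<forall>j\<in>{1..n}. x j = y j"
    then have "corolla n w \<in> labeled_trees \<Omega> n" by (auto intro: corolla_labeled split: if_splits)
    then show "f n (vec (cl (corolla n w))) x = f n (vec (cl (corolla n w))) y"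
      by (rule f_cong) (use e in blast)
  qed
  have leaf: "f n (vec (cl (Leaf i))) x = tree_eval M x (Leaf i)" if "Leaf i \<in> labeled_trees \<Omega> n" for n i x
  proof -
    have "{1..n} = {i}" using labeled_trees_Lin[OF that] by simp
    then have "card {1..n} = 1" by simp
    then have "n = 1" by simp
    with \<open>{1..n} = {i}\<close> have "i = 1" by auto
    then show ?thesis using hom_unit \<open>n = 1\<close> by simp
  qed
  \<comment> \<open>A subtree with arbitrary labels is not itself an element of the operad. The
    claim is therefore quantified over all trees \<open>u\<close> with labels
    \<open>1, ..., n\<close> of which it is a relabeling.\<close>
  define good where "good t \<longleftrightarrow> (\<forall>n u \<rho> x. u \<in> labeled_trees \<Omega> n \<longrightarrow> relabel \<rho> u = t \<longrightarrow>
    f n (vec (cl u)) x = tree_eval M x u)" for t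
  have good_leaf: "good (Leaf i)" for i
    unfolding good_def
  proof (intro allI impI)
    fix n u \<rho> x assume u: "u \<in> labeled_trees \<Omega> n" "relabel \<rho> u = Leaf i"
    then obtain k where "u = Leaf k" by (cases u) auto
    then show "f n (vec (cl u)) x = tree_eval M x u" using u leaf by blast
  qed
  have sub: "f N (vec (cl (subst s t))) x = f m (vec (cl t)) (\<lambda>j. tree_eval M x (s j))"
    if "labeled_trees \<Omega> m \<noteq> {}" "labeled_subst \<Omega> m s N" "\<And>j. j \<in> {1..m} \<Longrightarrow> good (s j)"
      "t \<in> labeled_trees \<Omega> m" for m s N t x
    using that
  proof (induction arbitrary: t rule: labeled_subst_induct)
    case (perm s \<sigma>)
    have "subst s t = relabel \<sigma> t"
      unfolding relabel_def using perm(2) labeled_trees_Lin[OF perm(4)] by (intro subst_cong) simp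
    then have "f N (vec (cl (subst s t))) x = f N (vec (cl t)) (\<lambda>i. x (\<sigma> i))"
      using hom_sact[OF labeled_trees_pos[OF perm(4)] perm(1), of "vec (cl t)"] perm(4)
      by (simp add: sact_vec o_def)
    also have "\<dots> = f N (vec (cl t)) (\<lambda>j. tree_eval M x (s j))"
      using perm(2) by (intro f_cong[OF perm(4)]) simp
    finally show ?case .
  next
    case (step m s i n u \<rho> s')
    have tc: "tree_comp n i t u \<in> labeled_trees \<Omega> (m + n - 1)"
      by (rule tree_comp_labeled[OF step(10,3,2,1)])
    have gs: "good (s' q)" if q: "q \<in> {1..m + n - 1}" for q
    proof -
      consider "q < i" | "i \<le> q" "q < i + n" | "i + n \<le> q" by linarith
      then show ?thesis
      proof cases
        case 1
        then show ?thesis using step(6)[of q] step(9)[of q] q step(1) by (simp add: outer_def)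
      next
        case 2
        then have "q + 1 - i \<in> {1..n}" "inner i (q + 1 - i) = q" using step(1) by (auto simp: inner_def)
        then show ?thesis using step(5)[of "q + 1 - i"] good_leaf by simp
      next
        case 3
        then have "q + 1 - n \<in> {1..m}" "q + 1 - n \<noteq> i" "outer i n (q + 1 - n) = q"
          using step(1,2) q by (auto simp: outer_def)
        then show ?thesis using step(6)[of "q + 1 - n"] step(9)[of "q + 1 - n"] by simp
      qed
    qed
    have "f N (vec (cl (subst s t))) x = f (m + n - 1) (vec (cl (tree_comp n i t u))) (\<lambda>j. tree_eval M x (s' j))"
      unfolding step(7)[OF step(10)] by (rule step(8)[OF gs tc])
    also have "\<dots> = f m (vec (cl t)) (\<lambda>j. if j = i then f n (vec (cl u)) (\<lambda>l. tree_eval M x (s' (inner i l)))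
        else tree_eval M x (s' (outer i n j)))"
      using hom_pcomp[OF step(2,1), of "vec (cl t)" "vec (cl u)"] step(3,10) by (simp add: pcomp_vec)
    also have "\<dots> = f m (vec (cl t)) (\<lambda>j. tree_eval M x (s j))"
    proof (rule f_cong[OF step(10)])
      fix j assume j: "j \<in> {1..m}"
      have "f n (vec (cl u)) (\<lambda>l. tree_eval M x (s' (inner i l))) = tree_eval M (\<lambda>l. tree_eval M x (s' (inner i l))) u"
        using step(9)[OF step(1)] step(3,4) unfolding good_def by metis
      also have "\<dots> = tree_eval M (\<lambda>l. x (\<rho> l)) u"
        using step(5) labeled_trees_Lin[OF step(3)] by (intro tree_eval_cong) simp
      also have "\<dots> = tree_eval M x (s i)" using step(4) by (simp add: tree_eval_relabel)
      finally show "(if j = i then f n (vec (cl u)) (\<lambda>l. tree_eval M x (s' (inner i l)))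
        else tree_eval M x (s' (outer i n j))) = tree_eval M x (s j)"
        using step(6) j by simp
    qed
    finally show ?case .
  qed
  have "\<forall>n x. t \<in> labeled_trees \<Omega> n \<longrightarrow> f n (vec (cl t)) x = tree_eval M x t" for t
  proof (induction t rule: measure_induct_rule[of size])
    case (less t)
    show ?case
    proof (cases t)
      case (Leaf i)
      then show ?thesis using leaf by blast
    next
      case (Node w ts)
      show ?thesis
      proof (intro allI impI)
        fix n x assume t: "t \<in> labeled_trees \<Omega> n"
        let ?m = "length ts" and ?s = "\<lambda>j. ts ! (j - 1)"
        have w: "?m \<ge> 1" "w \<in> \<Omega> ?m" using labeled_trees_decorated[OF t] Node by (auto simp: Suc_le_eq)
        have c: "corolla ?m w \<in> labeled_trees \<Omega> ?m" using w by (rule corolla_labeled)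
        have e: "t = subst ?s (corolla ?m w)"
          unfolding Node corolla_def by (auto intro!: nth_equalityI)
        have "f n (vec (cl (subst ?s (corolla ?m w)))) x = f ?m (vec (cl (corolla ?m w))) (\<lambda>j. tree_eval M x (?s j))"
        proof (rule sub)
          show "labeled_trees \<Omega> ?m \<noteq> {}" using c by blast
          show "labeled_subst \<Omega> ?m ?s n" using subst_labeled_iff[OF c] t e by metis
          fix j assume "j \<in> {1..?m}"
          then have "ts ! (j - 1) \<in> set ts" by auto
          then have "size (ts ! (j - 1)) < size t" unfolding Node by (auto dest: size_list_estimation'[of _ _ _ size, OF _ order_refl])
          \<comment> \<open>Relabeling preserves size, so the induction hypothesis covers every
            standardization of the subtree.\<close>
          then have "size u < size t" if "relabel \<rho> u = ts ! (j - 1)" for \<rho> u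
            using size_relabel[of \<rho> u] that by simp
          then show "good (ts ! (j - 1))" unfolding good_def using less.IH by blast
        qed (rule c)
        also have "\<dots> = tree_eval M x t"
          unfolding Node using w by (subst tree_eval_Node[OF loc]) (auto simp: M_def)
        finally show "f n (vec (cl t)) x = tree_eval M x t" using e by simp
      qed
    qed
  qed
  then show ?thesis using t unfolding M_def by blast
qed

end

section \<open>Splitting by a Rota-Baxter operator\<close>

definition split_op ::
  "('a \<Rightarrow> 'a) \<Rightarrow> (nat \<Rightarrow> 'v \<Rightarrow> (nat \<Rightarrow> 'a) \<Rightarrow> 'a) \<Rightarrow> nat \<Rightarrow> 'v \<times> nat set \<Rightarrow> (nat \<Rightarrow> 'a) \<Rightarrow> 'a" where
  "split_op P M n = (\<lambda>(w, I) x. M n w (\<lambda>j. if j \<in> I then x j else P (x j)))"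

lemma tensor_e_vec [simp]: "tensor_e (vec w) I = vec (w, I)"
  by (simp add: tensor_e_def)

text \<open>
  Part (b) is the case \<open>K = {0}\<close>.  For part (a), the space consists of the combinations of planar trees
  over \<open>V\<^sub>P\<close> and \<open>K\<close> of the consequences of the relations; working modulo \<open>K\<close> avoids a quotient type.
\<close>

locale rota_baxter_mod = vector_space scale
  for scale :: "'k::field \<Rightarrow> 'a::ab_group_add \<Rightarrow> 'a" +
  fixes \<W> :: "nat \<Rightarrow> 'v set" and C :: "nat \<Rightarrow> nat set set"
    and M :: "nat \<Rightarrow> 'v \<Rightarrow> (nat \<Rightarrow> 'a) \<Rightarrow> 'a" and P :: "'a \<Rightarrow> 'a" and K :: "'a set"
  assumes M: "multilinear_ops \<W> scale M"
    and P: "Vector_Spaces.linear scale scale P"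
    and K: "subspace K"
    and M_K: "\<lbrakk>w \<in> \<W> n; j \<in> {1..n}; a \<in> K\<rbrakk> \<Longrightarrow> M n w (x(j := a)) \<in> K"
    and rb_mod: "\<lbrakk>n \<ge> 1; w \<in> \<W> n\<rbrakk> \<Longrightarrow>
      M n w (\<lambda>j. P (x j)) - P (\<Sum>I\<in>C n. M n w (\<lambda>j. if j \<in> I then x j else P (x j))) \<in> K"
begin

abbreviation Msplit where "Msplit \<equiv> split_op P M"

lemma K_zero: "0 \<in> K" and K_add: "a \<in> K \<Longrightarrow> b \<in> K \<Longrightarrow> a + b \<in> K"
  and K_diff: "a \<in> K \<Longrightarrow> b \<in> K \<Longrightarrow> a - b \<in> K"
  using K by (auto intro: subspace_0 subspace_add subspace_diff)

lemma K_trans: "a - b \<in> K \<Longrightarrow> b - c \<in> K \<Longrightarrow> a - c \<in> K"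
  using K_add[of "a - b" "b - c"] by simp

text \<open>The entries of \<open>y\<close> are exchanged for those of \<open>z\<close> one position
  at a time. By linearity in that position, each exchange changes the value by an operation with an
  element of \<open>K\<close> among its inputs.\<close>

lemma M_cong_mod:
  assumes w: "w \<in> \<W> n" and y: "\<And>j. j \<in> {1..n} \<Longrightarrow> y j - z j \<in> K"
  shows "M n w y - M n w z \<in> K"
proof -
  have m: "multilinear scale n (M n w)" using M w by (simp add: multilinear_ops_def)
  let ?h = "\<lambda>m j. if j \<le> m then z j else y j"
  have "m \<le> n \<Longrightarrow> M n w y - M n w (?h m) \<in> K" for m
  proof (induction m)
    case 0
    have "M n w (?h 0) = M n w y"
      by (rule local_opsD[OF multilinear_ops_local[OF M] w]) auto
    then show ?case using K_zero by simp
  next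
    case (Suc m)
    then have j: "Suc m \<in> {1..n}" by simp
    interpret L: Vector_Spaces.linear scale scale "\<lambda>a. M n w ((?h m)(Suc m := a))"
      using m j unfolding multilinear_def by blast
    have "M n w ((?h m)(Suc m := y (Suc m) - z (Suc m))) \<in> K"
      using w j y[OF j] by (rule M_K)
    then have "M n w ((?h m)(Suc m := y (Suc m))) - M n w ((?h m)(Suc m := z (Suc m))) \<in> K"
      by (simp only: L.diff)
    moreover have "(?h m)(Suc m := y (Suc m)) = ?h m" "(?h m)(Suc m := z (Suc m)) = ?h (Suc m)"
      by (auto simp: fun_eq_iff le_Suc_eq)
    ultimately have "M n w (?h m) - M n w (?h (Suc m)) \<in> K" by simp
    moreover have "M n w y - M n w (?h m) \<in> K" using Suc by simp
    ultimately show ?case using K_trans by blast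
  qed
  then have "M n w y - M n w (?h n) \<in> K" by simp
  moreover have "M n w (?h n) = M n w z"
    by (rule local_opsD[OF multilinear_ops_local[OF M] w]) auto
  ultimately show ?thesis by simp
qed

text \<open>Every input first passes through the identity or through \<open>P\<close>, and both are
  linear.\<close>

lemma split_op_multilinear:
  assumes w: "w \<in> \<W> n"
  shows "multilinear scale n (Msplit n (w, I))"
proof -
  have "multilin scale scale n (M n w)"
    using M w by (simp add: multilinear_ops_def multilinear_eq_multilin)
  moreover have lin: "Vector_Spaces.linear scale scale (\<lambda>a. if j \<in> I then a else P a)" for j
    using P linear_ident by (cases "j \<in> I") simp_all
  ultimately have "multilin scale scale n (\<lambda>x. M n w (\<lambda>j. if j \<in> I then x j else P (x j)))"
    using multilin_compose[of scale scale n "M n w" scale "\<lambda>j a. if j \<in> I then a else P a"] by blast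
  then show ?thesis by (simp add: split_op_def multilinear_eq_multilin)
qed

lemma split_ops_multilinear: "multilinear_ops (\<lambda>n. \<W> n \<times> UNIV) scale Msplit"
  unfolding multilinear_ops_def by (auto intro: split_op_multilinear)

abbreviation E where "E x \<equiv> lin_to scale (tree_eval Msplit x)"

lemma E_graft:
  assumes "keys v \<subseteq> \<W> n \<times> UNIV"
  shows "E x (graft v (args n y)) = lin_to scale (\<lambda>w. Msplit n w (\<lambda>j. E x (y j))) v"
proof (rule lin_to_graft[OF vector_space_axioms])
  fix w assume "w \<in> keys v"
  then have w: "w \<in> \<W> n \<times> UNIV" using assms by blast
  then show "multilin scale scale n (Msplit n w)"
    using split_ops_multilinear by (auto simp: multilinear_ops_def multilinear_eq_multilin)
  fix t
  show "tree_eval Msplit x (Node w (args n t)) = Msplit n w (\<lambda>j. tree_eval Msplit x (t j))"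
    unfolding tree_eval.simps length_args
    by (rule local_opsD[OF multilinear_ops_local[OF split_ops_multilinear] w]) auto
qed

text \<open>The sum over \<open>C n\<close> at a starred vertex is the right-hand side of the
  Rota-Baxter identity, so the outer \<open>P\<close> moves inside to all the inputs, where the
  induction hypothesis takes over.\<close>

lemma E_CSp_empty:
  assumes "decorated \<W> t"
  shows "P (E x (CSp_tree C t {})) - tree_eval M (\<lambda>i. P (x i)) t \<in> K"
  using assms
proof (induction t)
  case (Leaf i)
  then show ?case using K_zero by simp
next
  case (Node w ts)
  let ?n = "length ts"
  have n: "?n \<ge> 1" and w: "w \<in> \<W> ?n" using Node.prems by (auto simp: Suc_le_eq)
  let ?y = "\<lambda>j. E x (CSp_tree C (ts ! (j - 1)) {})"
  have star: "tensor_star C ?n (vec w) = (\<Sum>I\<in>C ?n. vec (w, I))"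
    by (simp add: tensor_star_def)
  have keys: "keys (tensor_star C ?n (vec w)) \<subseteq> \<W> ?n \<times> UNIV"
    unfolding star using w by (intro order_trans[OF keys_sum]) auto
  have "E x (CSp_tree C (Node w ts) {}) = E x (graft (tensor_star C ?n (vec w)) (args ?n (\<lambda>j. CSp_tree C (ts ! (j - 1)) {})))"
    by (simp add: map_nth_args)
  also have "\<dots> = lin_to scale (\<lambda>w. Msplit ?n w ?y) (tensor_star C ?n (vec w))"
    by (rule E_graft[OF keys])
  also have "\<dots> = (\<Sum>I\<in>C ?n. M ?n w (\<lambda>j. if j \<in> I then ?y j else P (?y j)))"
  proof -
    interpret L: Vector_Spaces.linear scal scale "lin_to scale (\<lambda>w. Msplit ?n w ?y)" by (rule linear_lin_to)
    show ?thesis unfolding star L.sum by (simp add: split_op_def del: One_nat_def)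
  qed
  finally have e: "E x (CSp_tree C (Node w ts) {}) = \<dots>" .
  have "M ?n w (\<lambda>j. P (?y j)) - P (E x (CSp_tree C (Node w ts) {})) \<in> K"
    unfolding e by (rule rb_mod[OF n w])
  then have 1: "P (E x (CSp_tree C (Node w ts) {})) - M ?n w (\<lambda>j. P (?y j)) \<in> K"
    using K_diff[OF K_zero, of "M ?n w (\<lambda>j. P (?y j)) - P (E x (CSp_tree C (Node w ts) {}))"]
    by (simp only: diff_0 minus_diff_eq)
  have "M ?n w (\<lambda>j. P (?y j)) - M ?n w (\<lambda>j. tree_eval M (\<lambda>i. P (x i)) (ts ! (j - 1))) \<in> K"
  proof (rule M_cong_mod[OF w])
    fix j assume "j \<in> {1..?n}"
    then have "ts ! (j - 1) \<in> set ts" by auto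
    then show "P (?y j) - tree_eval M (\<lambda>i. P (x i)) (ts ! (j - 1)) \<in> K"
      using Node by auto
  qed
  from K_trans[OF 1 this] show ?case
    unfolding tree_eval_Node[OF multilinear_ops_local[OF M] w] .
qed

lemma E_CSp:
  assumes "decorated \<W> t" "J \<inter> Lin t \<noteq> {}"
  shows "E x (CSp_tree C t J) - tree_eval M (\<lambda>i. if i \<in> J then x i else P (x i)) t \<in> K"
  using assms
proof (induction t arbitrary: J)
  case (Leaf i)
  then show ?case using K_zero by auto
next
  case (Node w ts)
  let ?n = "length ts" and ?I = "meet J ts"
  have n: "?n \<ge> 1" and w: "w \<in> \<W> ?n" using Node.prems by (auto simp: Suc_le_eq)
  have J: "J \<noteq> {}" using Node.prems by auto
  let ?y = "\<lambda>j. E x (CSp_tree C (ts ! (j - 1)) (J \<inter> Lin (ts ! (j - 1))))"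
  let ?z = "\<lambda>i. if i \<in> J then x i else P (x i)"
  have "E x (CSp_tree C (Node w ts) J) =
    E x (graft (vec (w, ?I)) (args ?n (\<lambda>j. CSp_tree C (ts ! (j - 1)) (J \<inter> Lin (ts ! (j - 1))))))"
    using J by (simp add: map_nth_args)
  also have "\<dots> = Msplit ?n (w, ?I) ?y"
    using w by (subst E_graft) auto
  finally have e: "E x (CSp_tree C (Node w ts) J) = M ?n w (\<lambda>j. if j \<in> ?I then ?y j else P (?y j))"
    by (simp only: split_op_def prod.case)
  show ?case
    unfolding e tree_eval_Node[OF multilinear_ops_local[OF M] w]
  proof (rule M_cong_mod[OF w])
    fix j assume j: "j \<in> {1..?n}"
    let ?t = "ts ! (j - 1)"
    have t: "?t \<in> set ts" using j by auto
    then have d: "decorated \<W> ?t" using Node.prems by simp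
    show "(if j \<in> ?I then ?y j else P (?y j)) - tree_eval M ?z ?t \<in> K"
    proof (cases "J \<inter> Lin ?t = {}")
      case True
      then have "j \<notin> ?I" by (simp add: meet_def)
      moreover have "tree_eval M ?z ?t = tree_eval M (\<lambda>i. P (x i)) ?t"
        using True by (intro tree_eval_cong) auto
      ultimately show ?thesis using E_CSp_empty[OF d, of x] True by simp
    next
      case False
      then have "j \<in> ?I" using j by (simp add: meet_def)
      \<comment> \<open>Only labels of the subtree are evaluated, so \<open>J\<close> can be cut
        down to the set used in the recursion of \<open>CSp_tree\<close>.\<close>
      moreover have "tree_eval M ?z ?t = tree_eval M (\<lambda>i. if i \<in> J \<inter> Lin ?t then x i else P (x i)) ?t"
        by (intro tree_eval_cong) auto
      moreover have "?y j - tree_eval M (\<lambda>i. if i \<in> J \<inter> Lin ?t then x i else P (x i)) ?t \<in> K"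
        using False by (intro Node.IH[OF t d]) auto
      ultimately show ?thesis by simp
    qed
  qed
qed

end

section \<open>Splitting of trees\<close>

lemma above_oneD: "w \<in> above_one \<Omega> n \<Longrightarrow> n \<ge> 2 \<and> w \<in> \<Omega> n"
  by (simp add: above_one_def split: if_splits)

lemma length_above_one: "decorated (above_one \<Omega>) (Node w ts) \<Longrightarrow> length ts \<ge> 2 \<and> w \<in> \<Omega> (length ts)"
  using above_oneD[of w \<Omega> "length ts"] by simp

lemma Lin_subtree: "u \<in> subtrees t \<Longrightarrow> Lin u \<subseteq> Lin t"
  by (induction t) auto

lemma keys_graft:
  assumes "u \<in> keys (graft v (args n y))"
  obtains w ts where "u = Node w ts" "w \<in> keys v" "length ts = n"
    "\<And>j. j \<in> {1..n} \<Longrightarrow> ts ! (j - 1) \<in> keys (y j)"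
proof (cases u)
  case (Leaf i)
  then show ?thesis using assms by (simp add: in_keys_iff)
next
  case (Node w ts)
  have "lookup (graft v (args n y)) (Node w ts) \<noteq> 0"
    using assms Node by (simp add: in_keys_iff)
  then have "length ts = n" "lookup v w \<noteq> 0"
    "(\<Prod>j\<in>{1..n}. lookup (y j) (ts ! (j - 1))) \<noteq> 0"
    unfolding lookup_graft_args by (auto split: if_splits)
  then show ?thesis using Node that by (simp add: in_keys_iff)
qed

text \<open>The closure condition of \<open>configuration\<close> for one tree and one set, without
  the left-to-right numbering of the leaves.\<close>

definition admissible :: "(nat \<Rightarrow> nat set set) \<Rightarrow> 'v tree \<Rightarrow> nat set \<Rightarrow> bool" where
  "admissible C t J \<longleftrightarrow> (\<forall>w ts. Node w ts \<in> subtrees t \<longrightarrow> meet J ts \<noteq> {} \<longrightarrow> meet J ts \<in> C (length ts))"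

text \<open>Admissibility puts the meet at each vertex into \<open>C\<close>. The last assumption
  excludes a nonempty \<open>J\<close> disjoint from the tree, which would decorate the root with
  the empty set; it persists in the recursion because \<open>J\<close> is intersected with the
  labels of each subtree.\<close>

lemma keys_CSp_tree:
  assumes "decorated (above_one \<V>) t" "admissible C t J" "J = {} \<or> J \<inter> Lin t \<noteq> {}"
  shows "keys (CSp_tree C t J :: _ \<Rightarrow>\<^sub>0 'k::field) \<subseteq>
    {u. decorated (above_one (CSp_basis \<V> C)) u \<and> leaves u = leaves t}"
  using assms
proof (induction t arbitrary: J)
  case (Leaf i)
  then show ?case by simp
next
  case (Node w ts)
  let ?n = "length ts"
  have n: "?n \<ge> 2" "w \<in> \<V> ?n" using length_above_one[OF Node.prems(1)] by auto
  let ?v = "(if J = {} then tensor_star C ?n (vec w) else tensor_e (vec w) (meet J ts)) :: _ \<Rightarrow>\<^sub>0 'k"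
  let ?y = "\<lambda>j. CSp_tree C (ts ! (j - 1)) (J \<inter> Lin (ts ! (j - 1))) :: _ \<Rightarrow>\<^sub>0 'k"
  have v: "keys ?v \<subseteq> above_one (CSp_basis \<V> C) ?n"
  proof (cases "J = {}")
    case True
    have "keys (\<Sum>I\<in>C ?n. vec (w, I) :: _ \<Rightarrow>\<^sub>0 'k) \<subseteq> above_one (CSp_basis \<V> C) ?n"
      using n by (intro order_trans[OF keys_sum]) (auto simp: above_one_def CSp_basis_def)
    then show ?thesis using True by (simp add: tensor_star_def tensor_e_def)
  next
    case False
    \<comment> \<open>A common label makes the meet at the root nonempty, as admissibility
      demands.\<close>
    then have "J \<inter> Lin (Node w ts) \<noteq> {}" using Node.prems(3) by simp
    then obtain i t where "i \<in> J" "t \<in> set ts" "i \<in> Lin t" by auto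
    moreover from this obtain k where "k < ?n" "ts ! k = t" by (auto simp: in_set_conv_nth)
    ultimately have "Suc k \<in> meet J ts" by (auto simp: meet_def)
    then have "meet J ts \<in> C ?n" using Node.prems(2) by (force simp: admissible_def)
    then show ?thesis using False n by (simp add: tensor_e_def above_one_def CSp_basis_def)
  qed
  show ?case
  proof
    fix u assume "u \<in> keys (CSp_tree C (Node w ts) J :: _ \<Rightarrow>\<^sub>0 'k)"
    then have "u \<in> keys (graft ?v (args ?n ?y))" by (simp add: map_nth_args)
    then obtain w' us where u: "u = Node w' us" "w' \<in> keys ?v" "length us = ?n"
      "\<And>j. j \<in> {1..?n} \<Longrightarrow> us ! (j - 1) \<in> keys (?y j)"
      by (rule keys_graft) blast
    have us: "decorated (above_one (CSp_basis \<V> C)) (us ! k) \<and> leaves (us ! k) = leaves (ts ! k)"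
      if k: "k < ?n" for k
    proof -
      let ?t = "ts ! k"
      have t: "?t \<in> set ts" using k by simp
      \<comment> \<open>The recursion restricts \<open>J\<close> to the labels of a subtree.
        Vertices of that subtree see only these labels, so admissibility is inherited.\<close>
      have "meet (J \<inter> Lin ?t) ts' = meet J ts'" if "Node w' ts' \<in> subtrees ?t" for w' ts'
      proof -
        have sub: "Lin (ts' ! i) \<subseteq> Lin ?t" if "i < length ts'" for i
          using Lin_subtree[OF \<open>Node w' ts' \<in> subtrees ?t\<close>] nth_mem[OF that] by auto
        then have "J \<inter> Lin ?t \<inter> Lin (ts' ! (i - 1)) = J \<inter> Lin (ts' ! (i - 1))" if "i \<in> {1..length ts'}" for i
        proof -
          have "i - 1 < length ts'" using that by auto
          from sub[OF this] show ?thesis by blast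
        qed
        then show ?thesis unfolding meet_def by (intro Collect_cong conj_cong refl) simp
      qed
      moreover have "admissible C ?t J" using Node.prems(2) t unfolding admissible_def by auto
      ultimately have "admissible C ?t (J \<inter> Lin ?t)" unfolding admissible_def by metis
      then have "keys (?y (Suc k)) \<subseteq>
        {u. decorated (above_one (CSp_basis \<V> C)) u \<and> leaves u = leaves ?t}"
        using Node.prems(1) t by (simp del: One_nat_def) (intro Node.IH; auto)
      then show ?thesis using u(4)[of "Suc k"] k by auto
    qed
    have "map leaves us = map leaves ts" using u(3) us by (intro nth_equalityI) auto
    moreover have "decorated (above_one (CSp_basis \<V> C)) u"
      using u v us n by (auto simp: in_set_conv_nth)
    ultimately show "u \<in> {u. decorated (above_one (CSp_basis \<V> C)) u \<and> leaves u = leaves (Node w ts)}"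
      using u(1) by simp
  qed
qed

lemma leaves_map_tree [simp]: "leaves (map_tree f t) = leaves t"
  by (induction t) (auto simp: comp_def cong: map_cong)

lemma subtrees_map_tree: "u \<in> subtrees t \<Longrightarrow> map_tree f u \<in> subtrees (map_tree f t)"
  by (induction t) auto

lemma subtrees_relabel: "u \<in> subtrees t \<Longrightarrow> relabel \<sigma> u \<in> subtrees (relabel \<sigma> t)"
  by (induction t) auto

lemma decorated_map_tree_UNIV: "decorated \<Omega> t \<Longrightarrow> decorated (\<lambda>_. UNIV) (map_tree f t)"
  by (induction t) auto

text \<open>Renumbering the leaves by their position is a permutation \<open>\<sigma>\<close> and
  leads to the trees that \<open>configuration\<close> speaks of. Invariance of \<open>C\<close>
  provides the image of \<open>J\<close> under \<open>\<sigma>\<close>, and the meets are unchanged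
  since the same subtrees are hit.\<close>

lemma configuration_admissible:
  assumes C: "configuration C" "S_invariant C"
    and t: "t \<in> labeled_trees \<Omega> n" and J: "J \<in> C n"
  shows "admissible C t J"
proof -
  have n: "n \<ge> 1" using t by (rule labeled_trees_pos)
  have d: "distinct (leaves t)" "set (leaves t) = {1..n}" using t by (auto simp: labeled_trees_def)
  then have len: "length (leaves t) = n" using distinct_card[OF d(1)] by simp
  have nth: "bij_betw (\<lambda>i. leaves t ! (i - 1)) {1..n} {1..n}"
  proof -
    have "bij_betw (nth (leaves t)) {..<n} {1..n}" using bij_betw_nth[OF d(1)] len d(2) by simp
    moreover have "bij_betw (\<lambda>i. i - 1) {1..n} {..<n}"
      by (rule bij_betw_byWitness[of _ Suc]) auto
    ultimately show ?thesis using bij_betw_trans by (fastforce simp: o_def)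
  qed
  \<comment> \<open>The label of a leaf is sent to the position of the leaf; the identity elsewhere
    makes this a permutation in the library's sense.\<close>
  define \<sigma> where "\<sigma> i = (if i \<in> {1..n} then inv_into {1..n} (\<lambda>i. leaves t ! (i - 1)) i else i)" for i
  have "bij_betw \<sigma> {1..n} {1..n}"
    using bij_betw_inv_into[OF nth] by (subst bij_betw_cong[where g = "inv_into {1..n} (\<lambda>i. leaves t ! (i - 1))"]) (auto simp: \<sigma>_def)
  then have perm: "\<sigma> permutes {1..n}" by (rule bij_imp_permutes) (auto simp: \<sigma>_def)
  let ?f = "\<lambda>_. ()"
  let ?t = "map_tree ?f (relabel \<sigma> t)"
  have "\<sigma> (leaves t ! k) = Suc k" if "k < n" for k
    using bij_betw_inv_into_left[OF nth, of "Suc k"] that bij_betwE[OF nth, rule_format, of "Suc k"]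
    by (simp add: \<sigma>_def)
  then have lv: "leaves ?t = [1..<Suc n]"
    using len by (intro nth_equalityI) (auto simp: leaves_relabel simp del: upt_Suc)
  have "decorated (\<lambda>_. UNIV) ?t" using t by (intro decorated_map_tree_UNIV[of \<Omega>]) (simp add: labeled_trees_def)
  then have "?t \<in> labeled_trees (\<lambda>_. UNIV) n"
    unfolding labeled_trees_def using lv
    by (simp only: mem_Collect_eq distinct_upt set_upt atLeastLessThanSuc_atLeastAtMost simp_thms)
  moreover have "\<sigma> ` J \<in> C n" using C(2) perm J n by (simp add: S_invariant_def)
  ultimately have *: "\<And>w ts. Node w ts \<in> subtrees ?t \<Longrightarrow> meet (\<sigma> ` J) ts \<noteq> {} \<Longrightarrow> meet (\<sigma> ` J) ts \<in> C (length ts)"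
    using C(1) n lv unfolding configuration_def by blast
  have inj: "inj \<sigma>" using perm by (rule permutes_inj)
  show ?thesis unfolding admissible_def
  proof (intro allI impI)
    fix w ts assume s: "Node w ts \<in> subtrees t" and ne: "meet J ts \<noteq> {}"
    let ?ts = "map (map_tree ?f) (map (relabel \<sigma>) ts)"
    have "Node () ?ts \<in> subtrees ?t"
      using subtrees_map_tree[OF subtrees_relabel[OF s, of \<sigma>], of ?f] by simp
    moreover have "meet (\<sigma> ` J) ?ts = meet J ts"
    proof -
      have "\<sigma> ` J \<inter> Lin (?ts ! k) = {} \<longleftrightarrow> J \<inter> Lin (ts ! k) = {}" if "k < length ts" for k
      proof -
        have "\<sigma> ` J \<inter> Lin (?ts ! k) = \<sigma> ` (J \<inter> Lin (ts ! k))"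
          using that inj by (simp add: leaves_relabel image_Int)
        then show ?thesis by simp
      qed
      then have eq: "\<sigma> ` J \<inter> Lin (?ts ! (i - 1)) \<noteq> {} \<longleftrightarrow> J \<inter> Lin (ts ! (i - 1)) \<noteq> {}"
        if "i \<in> {1..length ts}" for i
      proof -
        have "i - 1 < length ts" using that by auto
        with \<open>\<And>k. k < length ts \<Longrightarrow> (\<sigma> ` J \<inter> Lin (?ts ! k) = {}) = (J \<inter> Lin (ts ! k) = {})\<close>
        show ?thesis by blast
      qed
      show ?thesis unfolding meet_def length_map by (intro Collect_cong conj_cong refl eq)
    qed
    ultimately show "meet J ts \<in> C (length ts)" using * ne by fastforce
  qed
qed

lemma configuration_subset: "configuration C \<Longrightarrow> n \<ge> 1 \<Longrightarrow> I \<in> C n \<Longrightarrow> I \<subseteq> {1..n} \<and> I \<noteq> {}"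
  unfolding configuration_def by blast

lemma keys_CSp_labeled:
  assumes C: "configuration C" "S_invariant C"
    and t: "t \<in> labeled_trees (above_one \<V>) n" and J: "J \<in> C n"
  shows "keys (CSp_tree C t J :: _ \<Rightarrow>\<^sub>0 'k::field) \<subseteq> labeled_trees (above_one (CSp_basis \<V> C)) n"
proof -
  have "J \<subseteq> {1..n} \<and> J \<noteq> {}" using configuration_subset[OF C(1) labeled_trees_pos[OF t] J] .
  then have "J \<inter> Lin t \<noteq> {}" using labeled_trees_Lin[OF t] by auto
  then have "keys (CSp_tree C t J :: _ \<Rightarrow>\<^sub>0 'k) \<subseteq>
    {u. decorated (above_one (CSp_basis \<V> C)) u \<and> leaves u = leaves t}"
    using keys_CSp_tree[OF labeled_trees_decorated[OF t] configuration_admissible[OF C t J]] by blast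
  then show ?thesis using t by (auto simp: labeled_trees_def)
qed

lemma gen_tree_labeled: "n \<ge> 1 \<Longrightarrow> w \<in> \<Omega> n \<Longrightarrow> gen_tree n w \<in> labeled_trees (above_one \<Omega>) n"
  by (auto simp: gen_tree_def labeled_trees_def above_one_def comp_def atLeastLessThanSuc_atLeastAtMost simp del: upt_Suc)

lemma gen_elem_eq: "gen_elem \<Omega> act n v = tree_elem \<Omega> act (map_basis (gen_tree n) v)"
  by (simp add: gen_elem_def map_basis_def)

lemma tensor_e_eq: "tensor_e v I = map_basis (\<lambda>w. (w, I)) v"
  by (simp add: tensor_e_def map_basis_def)

lemma gen_tree_corolla: "n \<ge> 2 \<Longrightarrow> gen_tree n w = corolla n w"
  by (simp add: gen_tree_def corolla_def args_def)

lemma sym_action_above_one: "sym_action \<V> act \<Longrightarrow> symmetric_basis (above_one \<V>) act"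
  unfolding symmetric_basis_def sym_action_def above_one_def by simp

text \<open>The set component moves along with \<open>\<sigma>\<close>; invariance of
  \<open>C\<close> is what keeps it in \<open>C n\<close>.\<close>

lemma sym_action_CSp:
  assumes "sym_action \<V> act" "S_invariant C"
  shows "symmetric_basis (above_one (CSp_basis \<V> C)) (CSp_act act)"
  using assms unfolding symmetric_basis_def sym_action_def above_one_def CSp_basis_def CSp_act_def S_invariant_def
  by (auto simp: image_comp o_def)

lemma keys_tree_elem: "keys f \<subseteq> labeled_trees \<Omega> n \<Longrightarrow>
    tree_elem \<Omega> act f \<in> carrier (comps (free_operad \<Omega> act) n)"
proof -
  assume f: "keys f \<subseteq> labeled_trees \<Omega> n"
  have "keys (tree_elem \<Omega> act f) \<subseteq> iso_class \<Omega> act ` labeled_trees \<Omega> n"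
    unfolding tree_elem_def
  proof (rule keys_lin_ext)
    fix t assume "t \<in> keys f"
    then show "keys (vec (iso_class \<Omega> act t)) \<subseteq> iso_class \<Omega> act ` labeled_trees \<Omega> n"
      using f by auto
  qed
  then show "tree_elem \<Omega> act f \<in> carrier (comps (free_operad \<Omega> act) n)" by simp
qed

context symmetric_basis
begin

lemma hom_End_tree_elem:
  fixes scale :: "'k::field \<Rightarrow> 'a::ab_group_add \<Rightarrow> 'a"
  assumes vs: "vector_space scale" and f: "operad_hom (free_operad \<Omega> act) (End_operad scale) f"
    and n: "n \<ge> 1" and r: "keys r \<subseteq> labeled_trees \<Omega> n"
  shows "f n (tree_elem \<Omega> act r) x = lin_to scale (tree_eval (\<lambda>n w. f n (vec (cl (corolla n w)))) x) r"
proof -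
  interpret vector_space scale by fact
  interpret f: operad_hom "free_operad \<Omega> act" "End_operad scale" f by (rule f)
  from r show ?thesis
  proof (induction r rule: poly_mapping_keys_induct)
    case zero
    then show ?case using f.hom_zero[OF n] by (simp add: tree_elem_def lin_ext_def lin_to_def)
  next
    case (vec t)
    then show ?case using hom_End_tree_eval[OF f] by simp
  next
    case (add r r')
    then show ?case
      using f.hom_add[OF n keys_tree_elem keys_tree_elem, of r r']
      by (simp add: linear_add[OF linear_tree_elem] lin_to_add)
  next
    case (scal c r)
    then show ?case
      using f.hom_smult[OF n keys_tree_elem, of r c]
      by (simp add: linear_scale[OF linear_tree_elem] lin_to_scale)
  qed
qed

text \<open>For subtrees that are leaves, this is the defining identification of
  \<open>tree_iso\<close>. It makes the operations that a morphism attaches to corollas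
  equivariant.\<close>

lemma corolla_act:
  assumes "n \<ge> 1" "w \<in> \<Omega> n" "\<sigma> permutes {1..n}"
  shows "cl (corolla n (act n \<sigma> w)) = cl (relabel \<sigma> (corolla n w))"
proof (rule cl_eqI)
  show "iso (corolla n (act n \<sigma> w)) (relabel \<sigma> (corolla n w))"
    unfolding corolla_def relabel_Node
  proof (rule tree_iso.intros(2)[where n = n])
    fix i assume i: "i \<in> {1..n}"
    then have "\<sigma> i \<in> {1..n}" using assms(3) by (simp only: permutes_in_image)
    then show "iso (args n Leaf ! (\<sigma> i - 1)) (map (relabel \<sigma>) (args n Leaf) ! (i - 1))"
      using i by (auto intro: tree_iso.intros(1))
  qed (use assms in simp_all)
qed

end

section \<open>Rota-Baxter operators on algebras\<close>

text \<open>Pulled back to the free operad, the given algebra is evaluation in operations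
  \<open>M\<close> attached to the generators. The split operations define an algebra over the free
  operad on the split generators, and it remains to see that it kills the relations.\<close>

lemma rota_baxter_splits_algebra:
  fixes \<V> :: "nat \<Rightarrow> 'v set" and scale :: "'k::field \<Rightarrow> 'a::ab_group_add \<Rightarrow> 'a"
  assumes sym: "sym_action \<V> act" and lh: "locally_homogeneous \<V> R"
    and C: "configuration C" "S_invariant C"
    and alg: "operad_algebra (P_operad \<V> act R) scale \<phi>"
    and rb: "rota_baxter \<V> C scale (\<lambda>n v. \<phi> n (P_gen \<V> act R n v)) P"
  shows "\<exists>\<psi>. operad_algebra (CSp_operad \<V> act R C) scale \<psi> \<and>
    (\<forall>n\<ge>1. \<forall>v. keys v \<subseteq> \<V> n \<longrightarrow> (\<forall>I\<in>C n. \<forall>x.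
       \<psi> n (CSp_gen \<V> act R C n (tensor_e v I)) x =
       \<phi> n (P_gen \<V> act R n v) (\<lambda>j. if j \<in> I then x j else P (x j))))"
proof -
  let ?W = "above_one \<V>" and ?B = "above_one (CSp_basis \<V> C)"
  let ?F = "free_operad ?W act :: ('k, 'v tree set \<Rightarrow>\<^sub>0 'k) operad"
  let ?S = "P_rel \<V> act R"
  have vs: "vector_space scale" and \<phi>: "operad_hom (P_operad \<V> act R) (End_operad scale) \<phi>"
    using alg by (simp_all add: operad_algebra_def)
  interpret vector_space scale by (rule vs)
  interpret V: symmetric_basis ?W act using sym by (rule sym_action_above_one)
  interpret B: symmetric_basis ?B "CSp_act act" using sym C(2) by (rule sym_action_CSp)
  interpret \<phi>: operad_hom "P_operad \<V> act R" "End_operad scale" \<phi> by (rule \<phi>)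
  have R_keys: "keys r \<subseteq> labeled_trees ?W n" if "n \<ge> 1" "r \<in> R n" for n r
    using lh that unfolding locally_homogeneous_def by blast
  have S: "?S n \<subseteq> carrier (comps ?F n)" if "n \<ge> 1" for n
    unfolding P_rel_def using R_keys[OF that] keys_tree_elem by blast
  interpret I: operadic_ideal ?F "op_ideal ?F ?S"
    by (rule operadic_ideal_op_ideal[OF V.operad_free S])
  define f where "f n \<mu> = \<phi> n (I.cls n \<mu>)" for n \<mu>
  have f: "operad_hom ?F (End_operad scale) f"
    unfolding f_def using operad_hom_compose[OF I.cls_hom, of "End_operad scale" \<phi>] \<phi>
    by (simp add: P_operad_def presented_operad_def)
  interpret f: operad_hom ?F "End_operad scale" f by (rule f)
  have f_gen: "\<phi> n (P_gen \<V> act R n v) = f n (gen_elem ?W act n v)" for n v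
    by (simp add: f_def P_gen_def presented_class_def)
  have f_rel: "f n (tree_elem ?W act r) = (\<lambda>x. 0)" if n: "n \<ge> 1" and r: "r \<in> R n" for n r
  proof -
    have "tree_elem ?W act r \<in> op_ideal ?F ?S n"
      unfolding op_ideal_def P_rel_def using n r by (auto intro: in_op_ideal.gen)
    then show ?thesis
      using I.cls_zero[OF n] \<phi>.hom_zero[OF n] by (simp add: f_def P_operad_def presented_operad_def)
  qed
  define M where "M = (\<lambda>n w. f n (vec (V.cl (corolla n w))))"
  have corolla: "corolla n w \<in> labeled_trees ?W n" if "w \<in> ?W n" for n w
    using above_oneD[OF that] that by (intro V.corolla_labeled) auto
  have M_multi: "multilinear_ops ?W scale M"
    unfolding multilinear_ops_def
  proof (intro allI ballI)
    fix n w assume w: "w \<in> ?W n"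
    have "n \<ge> 1" using above_oneD[OF w] by simp
    from f.hom_closed[OF this, of "vec (V.cl (corolla n w))"] corolla[OF w]
    show "multilinear scale n (M n w)" by (simp add: M_def)
  qed
  have M_eqv: "M n (act n \<sigma> w) x = M n w (\<lambda>i. x (\<sigma> i))"
    if "w \<in> ?W n" "\<sigma> permutes {1..n}" for n w \<sigma> x
  proof -
    have n: "n \<ge> 1" using above_oneD[OF that(1)] by simp
    show ?thesis
      using f.hom_sact[OF n that(2), of "vec (V.cl (corolla n w))"] corolla[OF that(1)]
      by (simp add: M_def V.corolla_act[OF n that] V.sact_vec o_def)
  qed
  have P: "Vector_Spaces.linear scale scale P" using rb by (simp add: rota_baxter_def)
  interpret RB: rota_baxter_mod scale ?W C M P "{0}"
  proof
    fix n w j a and x :: "nat \<Rightarrow> 'a" assume w: "w \<in> ?W n" "j \<in> {1..n}" "a \<in> {0::'a}"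
    interpret L: Vector_Spaces.linear scale scale "\<lambda>a. M n w (x(j := a))"
      using M_multi w unfolding multilinear_ops_def multilinear_def by blast
    show "M n w (x(j := a)) \<in> {0}" using w L.zero by simp
  next
    fix n w and x :: "nat \<Rightarrow> 'a" assume n: "n \<ge> 1" and w: "w \<in> ?W n"
    have "w \<in> \<V> n" "n \<ge> 2" using above_oneD[OF w] by auto
    then have "\<phi> n (P_gen \<V> act R n (vec w)) = M n w"
      by (simp add: f_gen M_def gen_elem_eq gen_tree_corolla)
    moreover have "\<phi> n (P_gen \<V> act R n (vec w)) (\<lambda>j. P (x j)) =
        P (\<Sum>I\<in>C n. \<phi> n (P_gen \<V> act R n (vec w)) (\<lambda>j. if j \<in> I then x j else P (x j)))"
      using rb n \<open>w \<in> \<V> n\<close> unfolding rota_baxter_def by simp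
    ultimately show "M n w (\<lambda>j. P (x j)) - P (\<Sum>I\<in>C n. M n w (\<lambda>j. if j \<in> I then x j else P (x j))) \<in> {0}"
      by simp
  qed (use M_multi P in
      \<open>simp_all add: subspace_single_0 linear_add[OF P] linear_scale[OF P]\<close>)
  have split_multi: "multilinear_ops ?B scale RB.Msplit"
    using RB.split_ops_multilinear unfolding multilinear_ops_def above_one_def CSp_basis_def by auto
  have split_eqv: "RB.Msplit n (CSp_act act n \<sigma> w) x = RB.Msplit n w (\<lambda>i. x (\<sigma> i))"
    if w: "w \<in> ?B n" and p: "\<sigma> permutes {1..n}" for n w \<sigma> x
  proof -
    obtain v I where v: "w = (v, I)" "v \<in> ?W n"
      using w by (auto simp: above_one_def CSp_basis_def split: if_splits)
    \<comment> \<open>An input \<open>i\<close> is exempt from \<open>P\<close> before the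
      permutation exactly when \<open>\<sigma> i\<close> is exempt after it.\<close>
    have "\<sigma> i \<in> \<sigma> ` I \<longleftrightarrow> i \<in> I" for i using permutes_inj[OF p] by (auto dest: injD)
    then show ?thesis unfolding v by (simp add: split_op_def CSp_act_def M_eqv[OF v(2) p])
  qed
  obtain h where h: "operad_hom (free_operad ?B (CSp_act act)) (End_operad scale) h"
    and h_elem: "\<And>n g. keys g \<subseteq> labeled_trees ?B n \<Longrightarrow>
      h n (tree_elem ?B (CSp_act act) g) = (\<lambda>x. lin_to scale (tree_eval RB.Msplit x) g)"
    using B.tree_eval_hom[OF vs operad_hom.axioms(2)[OF f] split_multi split_eqv] by blast
  interpret h: operad_hom "free_operad ?B (CSp_act act)" "End_operad scale" h by (rule h)
  let ?CS = "CSp_rel \<V> act R C"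
  have CSp_keys: "keys (lin_ext (\<lambda>t. CSp_tree C t J) r :: _ \<Rightarrow>\<^sub>0 'k) \<subseteq> labeled_trees ?B n"
    if "n \<ge> 1" "r \<in> R n" "J \<in> C n" for n r J
    using R_keys[OF that(1,2)] by (intro keys_lin_ext keys_CSp_labeled[OF C _ that(3)]) auto
  have CS: "?CS n \<subseteq> carrier (comps (free_operad ?B (CSp_act act)) n)" if "n \<ge> 1" for n
    unfolding CSp_rel_def using CSp_keys[OF that] keys_tree_elem by blast
  have kill: "h n \<mu> = \<zero>\<^bsub>comps (End_operad scale) n\<^esub>" if n: "n \<ge> 1" and \<mu>: "\<mu> \<in> ?CS n" for n \<mu>
  proof -
    obtain r J where r: "r \<in> R n" "J \<in> C n" "\<mu> = tree_elem ?B (CSp_act act) (lin_ext (\<lambda>t. CSp_tree C t J) r)"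
      using \<mu> unfolding CSp_rel_def by blast
    have J: "J \<subseteq> {1..n} \<and> J \<noteq> {}" using configuration_subset[OF C(1) n r(2)] .
    have "h n \<mu> x = 0" for x
    proof -
      \<comment> \<open>The split relation takes at \<open>x\<close> the value of the original
        relation at this sequence.\<close>
      let ?x = "\<lambda>i. if i \<in> J then x i else P (x i)"
      have "h n \<mu> x = RB.E x (lin_ext (\<lambda>t. CSp_tree C t J) r)"
        using h_elem[OF CSp_keys[OF n r(1,2)]] r(3) by simp
      also have "\<dots> = lin_to scale (tree_eval M ?x) r"
      proof (rule linear_eq_on_keys[OF linear_comp[OF linear_lin_to linear_lin_ext] linear_lin_to _ R_keys[OF n r(1)]])
        fix t assume t: "t \<in> labeled_trees ?W n"
        have "J \<inter> Lin t \<noteq> {}" using labeled_trees_Lin[OF t] J by auto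
        then show "RB.E x (lin_ext (\<lambda>t. CSp_tree C t J) (vec t)) = lin_to scale (tree_eval M ?x) (vec t)"
          using RB.E_CSp[OF labeled_trees_decorated[OF t], of J x] by simp
      qed
      also have "\<dots> = f n (tree_elem ?W act r) ?x"
        using V.hom_End_tree_elem[OF vs f n R_keys[OF n r(1)]] by (simp add: M_def)
      also have "\<dots> = 0" using f_rel[OF n r(1)] by simp
      finally show ?thesis .
    qed
    then show ?thesis by (simp add: fun_eq_iff)
  qed
  obtain \<psi> where \<psi>: "operad_hom (CSp_operad \<V> act R C) (End_operad scale) \<psi>"
    and \<psi>_cls: "\<And>n \<mu>. n \<ge> 1 \<Longrightarrow> \<mu> \<in> carrier (comps (free_operad ?B (CSp_act act)) n) \<Longrightarrow>
      \<psi> n (presented_class ?B (CSp_act act) ?CS n \<mu>) = h n \<mu>"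
    using h.factor_through_quotient[OF CS kill]
    unfolding CSp_operad_def presented_operad_def presented_class_def by blast
  have "\<psi> n (CSp_gen \<V> act R C n (tensor_e v I)) x = \<phi> n (P_gen \<V> act R n v) (\<lambda>j. if j \<in> I then x j else P (x j))"
    if n: "n \<ge> 1" and v: "keys v \<subseteq> \<V> n" and I: "I \<in> C n" for n v I x
  proof -
    let ?x = "\<lambda>j. if j \<in> I then x j else P (x j)"
    let ?g = "map_basis (\<lambda>w. gen_tree n (w, I)) v :: _ \<Rightarrow>\<^sub>0 'k"
    have k: "keys ?g \<subseteq> labeled_trees ?B n"
      by (rule keys_map_basis[OF v]) (use n I in \<open>auto intro!: gen_tree_labeled simp: CSp_basis_def\<close>)
    have k': "keys (map_basis (gen_tree n) v) \<subseteq> labeled_trees ?W n"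
      by (rule keys_map_basis[OF v]) (use n in \<open>auto intro!: gen_tree_labeled\<close>)
    have "\<psi> n (CSp_gen \<V> act R C n (tensor_e v I)) x = h n (tree_elem ?B (CSp_act act) ?g) x"
      using \<psi>_cls[OF n keys_tree_elem[OF k]]
      by (simp add: CSp_gen_def gen_elem_eq tensor_e_eq map_basis_map_basis)
    also have "\<dots> = lin_to scale (tree_eval RB.Msplit x) ?g"
      using h_elem[OF k] by simp
    also have "\<dots> = lin_to scale (tree_eval M ?x) (map_basis (gen_tree n) v)"
    proof (rule linear_eq_on_keys[OF linear_comp[OF linear_lin_to linear_map_basis]
          linear_comp[OF linear_lin_to linear_map_basis] _ v])
      fix w assume w: "w \<in> \<V> n"
      \<comment> \<open>In arity one the generator is the trivial tree and \<open>I = {1}\<close>,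
        so that \<open>P\<close> does not occur on either side.\<close>
      have "tree_eval RB.Msplit x (gen_tree n (w, I)) = tree_eval M ?x (gen_tree n w)"
      proof (cases "n = 1")
        case True
        then have "I = {1}" using configuration_subset[OF C(1) n I] by auto
        then show ?thesis using True by (simp add: gen_tree_def)
      next
        case False
        then have n2: "n \<ge> 2" and w': "w \<in> ?W n" using n w by (auto simp: above_one_def)
        show ?thesis
          unfolding gen_tree_corolla[OF n2] corolla_def tree_eval.simps length_args split_op_def prod.case
          by (rule local_opsD[OF multilinear_ops_local[OF M_multi] w']) auto
      qed
      then show "lin_to scale (tree_eval RB.Msplit x) (map_basis (\<lambda>w. gen_tree n (w, I)) (vec w)) =
        lin_to scale (tree_eval M ?x) (map_basis (gen_tree n) (vec w))" by simp
    qed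
    also have "\<dots> = \<phi> n (P_gen \<V> act R n v) ?x"
      using V.hom_End_tree_elem[OF vs f n k', of ?x] by (simp add: f_gen gen_elem_eq M_def)
    finally show ?thesis .
  qed
  then show ?thesis using \<psi> vs unfolding operad_algebra_def by blast
qed

section \<open>The Rota-Baxter operad\<close>

abbreviation rb_node :: "'v rb tree \<Rightarrow> 'v rb tree" where
  "rb_node t \<equiv> Node RB [t]"

abbreviation rb_leaf :: "nat set \<Rightarrow> nat \<Rightarrow> 'v rb tree" where
  "rb_leaf I j \<equiv> (if j \<in> I then Leaf j else rb_node (Leaf j))"

definition rb_graft :: "nat \<Rightarrow> 'v \<Rightarrow> (nat \<Rightarrow> 'v rb tree) \<Rightarrow> 'v rb tree" where
  "rb_graft n w y = Node (Op w) (args n y)"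

text \<open>The map \<xi> on planar trees, before any passage to classes. It is evaluation in the
  trees over \<open>rb_basis\<close>, where splitting puts a \<open>P\<close>-vertex on each input
  outside the set that decorates a vertex.\<close>

definition rb_tree :: "('v \<times> nat set) tree \<Rightarrow> 'v rb tree" where
  "rb_tree = tree_eval (split_op rb_node rb_graft) Leaf"

lemma rb_tree_Leaf [simp]: "rb_tree (Leaf i) = Leaf i"
  by (simp add: rb_tree_def)

lemma rb_tree_Node:
  "rb_tree (Node (w, I) ts) = Node (Op w) (args (length ts) (\<lambda>j. if j \<in> I then rb_tree (ts ! (j - 1))
     else rb_node (rb_tree (ts ! (j - 1)))))"
  by (auto simp: rb_tree_def split_op_def rb_graft_def intro!: args_cong)

text \<open>The inserted \<open>P\<close>-vertices depend on the decorations only, so they do not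
  interfere with what is put at the leaves. Compatibility with relabeling and composition follows,
  as both are substitutions.\<close>

lemma rb_tree_subst: "rb_tree (subst s t) = subst (\<lambda>i. rb_tree (s i)) (rb_tree t)"
proof (induction t)
  case (Node wI ts)
  obtain w I where "wI = (w, I)" by (cases wI) auto
  with Node show ?case by (auto simp: rb_tree_Node map_args intro!: args_cong)
qed simp

lemma rb_tree_relabel: "rb_tree (relabel \<sigma> t) = relabel \<sigma> (rb_tree t)"
  by (simp add: relabel_def rb_tree_subst)

lemma rb_tree_comp: "rb_tree (tree_comp n i t u) = tree_comp n i (rb_tree t) (rb_tree u)"
  unfolding tree_comp_def rb_tree_subst by (intro subst_cong) (simp add: rb_tree_relabel)

lemma leaves_rb_tree: "leaves (rb_tree t) = leaves t"
proof (induction t)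
  case (Node wI ts)
  obtain w I where w: "wI = (w, I)" by (cases wI) auto
  have "map leaves (args (length ts) (\<lambda>j. if j \<in> I then rb_tree (ts ! (j - 1))
     else rb_node (rb_tree (ts ! (j - 1))))) = map leaves ts"
    by (rule nth_equalityI) (use Node in auto)
  then show ?case unfolding w rb_tree_Node leaves.simps by (rule arg_cong)
qed simp

lemma rb_basis_Op: "n \<ge> 2 \<Longrightarrow> w \<in> \<V> n \<Longrightarrow> Op w \<in> rb_basis \<V> n"
  by (simp add: rb_basis_def above_one_def)

lemma rb_basis_RB: "RB \<in> rb_basis \<V> (Suc 0)"
  by (simp add: rb_basis_def)

lemma decorated_rb_tree:
  "decorated (above_one (CSp_basis \<V> C)) t \<Longrightarrow> decorated (rb_basis \<V>) (rb_tree t)"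
proof (induction t)
  case (Node wI ts)
  obtain w I where w: "wI = (w, I)" by (cases wI) auto
  have n: "length ts \<ge> 2" "w \<in> \<V> (length ts)"
    using length_above_one[OF Node.prems] w by (auto simp: CSp_basis_def)
  have "decorated (rb_basis \<V>) (rb_tree (ts ! k))" if "k < length ts" for k
    using Node that by auto
  moreover have "args (length ts) y \<noteq> []" for y :: "nat \<Rightarrow> 'a rb tree"
    using n by (metis length_args length_0_conv not_numeral_le_zero)
  ultimately show ?case
    using n by (auto simp: w rb_tree_Node rb_basis_Op rb_basis_RB in_set_conv_nth)
qed simp

lemma rb_tree_labeled:
  "t \<in> labeled_trees (above_one (CSp_basis \<V> C)) n \<Longrightarrow> rb_tree t \<in> labeled_trees (rb_basis \<V>) n"
  using decorated_rb_tree by (auto simp: labeled_trees_def leaves_rb_tree)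

lemma decorated_map_Op: "decorated (above_one \<V>) t \<Longrightarrow> decorated (rb_basis \<V>) (map_tree Op t)"
proof (induction t)
  case (Node w ts)
  then show ?case using length_above_one[OF Node.prems] by (auto simp: rb_basis_Op)
qed simp

lemma map_Op_labeled:
  "t \<in> labeled_trees (above_one \<V>) n \<Longrightarrow> map_tree Op t \<in> labeled_trees (rb_basis \<V>) n"
  using decorated_map_Op by (auto simp: labeled_trees_def)

lemma map_tree_gen_tree: "map_tree f (gen_tree n w) = gen_tree n (f w)"
  by (simp add: gen_tree_def comp_def del: upt_Suc)

lemma rb_gen_tree_labeled:
  "n \<ge> 1 \<Longrightarrow> w \<in> \<V> n \<Longrightarrow> gen_tree n (Op w) \<in> labeled_trees (rb_basis \<V>) n"
  using map_Op_labeled[OF gen_tree_labeled[of n w \<V>]]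
  by (simp only: map_tree_gen_tree)

lemma sym_action_rb:
  assumes "sym_action \<V> act"
  shows "symmetric_basis (rb_basis \<V>) (rb_act act)"
  using assms unfolding symmetric_basis_def sym_action_def rb_basis_def above_one_def
  by (auto split: if_splits)

text \<open>Since \<open>\<sigma>\<close> carries \<open>I\<close> to its image, corresponding
  subtrees on the two sides either both receive a \<open>P\<close>-vertex or both do not.\<close>

lemma rb_tree_iso:
  assumes "sym_action \<V> act"
  shows "tree_iso (above_one (CSp_basis \<V> C)) (CSp_act act) t u \<Longrightarrow>
    tree_iso (rb_basis \<V>) (rb_act act) (rb_tree t) (rb_tree u)"
proof (induction rule: tree_iso.induct)
  case (1 i)
  then show ?case by (simp add: tree_iso.intros(1))
next
  case (2 n ts us wI \<sigma>)
  obtain w I where wI: "wI = (w, I)" by (cases wI) auto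
  have n: "n \<ge> 2" "w \<in> \<V> n" using 2(4) wI above_oneD by (fastforce simp: CSp_basis_def)+
  have iso_rb: "tree_iso (rb_basis \<V>) (rb_act act) (rb_node a) (rb_node b)"
    if "tree_iso (rb_basis \<V>) (rb_act act) a b" for a b
    using tree_iso.intros(2)[of 1 "[a]" "[b]" RB "rb_basis \<V>" id "rb_act act"] that
    by (simp add: rb_basis_RB permutes_id)
  have "tree_iso (rb_basis \<V>) (rb_act act) (Node (rb_act act n \<sigma> (Op w))
      (args n (\<lambda>j. if j \<in> \<sigma> ` I then rb_tree (ts ! (j - 1)) else rb_node (rb_tree (ts ! (j - 1))))))
    (Node (Op w) (args n (\<lambda>j. if j \<in> I then rb_tree (us ! (j - 1)) else rb_node (rb_tree (us ! (j - 1))))))"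
  proof (rule tree_iso.intros(2))
    fix i assume i: "i \<in> {1..n}"
    then have s: "\<sigma> i \<in> {1..n}" using 2(5) by (simp only: permutes_in_image)
    have "\<sigma> i \<in> \<sigma> ` I \<longleftrightarrow> i \<in> I" using permutes_inj[OF 2(5)] by (auto dest: injD)
    moreover have "tree_iso (rb_basis \<V>) (rb_act act) (rb_tree (ts ! (\<sigma> i - 1))) (rb_tree (us ! (i - 1)))"
      using "2.IH" i by blast
    moreover have "\<sigma> i - 1 < n" "i - 1 < n" "Suc (\<sigma> i - 1) = \<sigma> i" "Suc (i - 1) = i" using i s by auto
    ultimately show "tree_iso (rb_basis \<V>) (rb_act act)
      (args n (\<lambda>j. if j \<in> \<sigma> ` I then rb_tree (ts ! (j - 1)) else rb_node (rb_tree (ts ! (j - 1)))) ! (\<sigma> i - 1))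
      (args n (\<lambda>j. if j \<in> I then rb_tree (us ! (j - 1)) else rb_node (rb_tree (us ! (j - 1)))) ! (i - 1))"
      using iso_rb by simp
  qed (use 2 n rb_basis_Op in auto)
  then show ?case using 2(2,3) by (simp add: wI CSp_act_def rb_tree_Node)
qed

text \<open>Invariance of \<open>rb_tree\<close> under isomorphism makes it descend to classes, and
  its compatibility with substitution makes the induced map a morphism of free operads.\<close>

lemma rb_tree_hom:
  assumes "sym_action \<V> act" "S_invariant C"
  shows "\<exists>h. operad_hom (free_operad (above_one (CSp_basis \<V> C)) (CSp_act act))
      (free_operad (rb_basis \<V>) (rb_act act) :: ('k::field, 'v rb tree set \<Rightarrow>\<^sub>0 'k) operad) h \<and>
    (\<forall>n f. keys f \<subseteq> labeled_trees (above_one (CSp_basis \<V> C)) n \<longrightarrow>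
      h n (tree_elem (above_one (CSp_basis \<V> C)) (CSp_act act) f) =
      tree_elem (rb_basis \<V>) (rb_act act) (map_basis rb_tree f))"
proof -
  let ?B = "above_one (CSp_basis \<V> C)"
  interpret B: symmetric_basis ?B "CSp_act act" using assms by (rule sym_action_CSp)
  interpret Q: symmetric_basis "rb_basis \<V>" "rb_act act" using assms(1) by (rule sym_action_rb)
  let ?F = "free_operad (rb_basis \<V>) (rb_act act) :: ('k, 'v rb tree set \<Rightarrow>\<^sub>0 'k) operad"
  let ?h = "\<lambda>n::nat. map_basis (\<lambda>X. Q.cl (rb_tree (representative X)))"
  have rep: "Q.cl (rb_tree (representative (B.cl t))) = Q.cl (rb_tree t)"
    if "t \<in> labeled_trees ?B n" for t n
    using rb_tree_iso[OF assms(1) B.iso_representative[OF labeled_trees_decorated[OF that]]]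
    by (intro Q.cl_eqI[symmetric])
  have "operad_hom (free_operad ?B (CSp_act act)) ?F ?h"
  proof (rule B.free_operad_homI[OF Q.operad_free])
    fix n and f :: "_ \<Rightarrow>\<^sub>0 'k" assume k: "keys f \<subseteq> B.cl ` labeled_trees ?B n"
    have "keys (?h n f :: _ \<Rightarrow>\<^sub>0 'k) \<subseteq> Q.cl ` labeled_trees (rb_basis \<V>) n"
      by (rule keys_map_basis[OF k]) (use rep rb_tree_labeled in force)
    then show "?h n f \<in> carrier (comps ?F n)" by simp
  next
    fix m n i t u assume a: "n \<ge> 1" "i \<in> {1..m}" "t \<in> labeled_trees ?B m" "u \<in> labeled_trees ?B n"
    show "?h (m + n - 1) (vec (B.cl (tree_comp n i t u))) =
      pcomp ?F m n i (?h m (vec (B.cl t))) (?h n (vec (B.cl u)))"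
      unfolding map_basis_vec rep[OF a(3)] rep[OF a(4)] rep[OF tree_comp_labeled[OF a(3,4,1,2)]]
      by (simp add: Q.pcomp_vec[OF rb_tree_labeled[OF a(3)] rb_tree_labeled[OF a(4)]] rb_tree_comp)
  next
    fix n \<sigma> t assume a: "n \<ge> 1" "\<sigma> permutes {1..n}" "t \<in> labeled_trees ?B n"
    show "?h n (vec (B.cl (relabel \<sigma> t))) = sact ?F n \<sigma> (?h n (vec (B.cl t)))"
      unfolding map_basis_vec rep[OF a(3)] rep[OF relabel_labeled[OF a(3,2)]]
      by (simp add: Q.sact_vec[OF rb_tree_labeled[OF a(3)]] rb_tree_relabel)
  qed (use rep[OF Leaf_labeled] in \<open>simp_all add: map_basis_add map_basis_scal\<close>)
  moreover have "?h n (tree_elem ?B (CSp_act act) f) =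
      tree_elem (rb_basis \<V>) (rb_act act) (map_basis rb_tree f)"
    if "keys f \<subseteq> labeled_trees ?B n" for n and f :: "_ \<Rightarrow>\<^sub>0 'k"
    by (rule linear_eq_on_keys[OF linear_comp[OF linear_map_basis linear_tree_elem]
          linear_comp[OF linear_tree_elem linear_map_basis] _ that])
      (simp add: rep)
  ultimately show ?thesis by blast
qed

section \<open>Consequences of relations among planar trees\<close>

context symmetric_basis
begin

text \<open>A tree with one leaf is inserted each time, so positions and arity never shift, and the
  successive partial compositions add up to one simultaneous substitution.\<close>

lemma comp_unary_tree_elem:
  assumes f: "keys f \<subseteq> labeled_trees \<Omega> n" and u: "u \<in> labeled_trees \<Omega> 1"
  shows "comp_unary (free_operad \<Omega> act) n (tree_elem \<Omega> act f)
      (tensor_pow (free_operad \<Omega> act) (vec (cl u)) I) =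
    tree_elem \<Omega> act (map_basis (subst (\<lambda>j. if j \<in> I then Leaf j else relabel (\<lambda>_. j) u)) f)"
proof -
  let ?F = "free_operad \<Omega> act"
  let ?u = "\<lambda>i. if i \<in> I then Leaf 1 else u"
  let ?s = "\<lambda>A j. if j \<in> A \<and> j \<notin> I then relabel (\<lambda>_. j) u else Leaf j"
  have u1: "?u i \<in> labeled_trees \<Omega> 1" for i using u Leaf_labeled[of \<Omega>] by simp
  have tp: "tensor_pow ?F (vec (cl u)) I i = vec (cl (?u i))" for i
    by (simp add: tensor_pow_def)
  have tc: "tree_comp 1 i t (?u i) = subst (?s {i}) t" for i t
  proof -
    have "relabel (inner i) u = relabel (\<lambda>_. i) u"
      unfolding relabel_def using labeled_trees_Lin[OF u] by (intro subst_cong) (simp add: inner_def)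
    then show ?thesis
      unfolding tree_comp_def by (intro subst_cong) (auto simp: outer_def inner_def)
  qed
  \<comment> \<open>The set of processed positions determines the substitution so far. Distinctness
    ensures that a position which has already received \<open>u\<close> is not composed with
    again.\<close>
  have "\<lbrakk>set is \<subseteq> {1..n}; distinct is; keys f \<subseteq> labeled_trees \<Omega> n\<rbrakk> \<Longrightarrow>
    fold (\<lambda>i \<kappa>. pcomp ?F n 1 i \<kappa> (tensor_pow ?F (vec (cl u)) I i)) is (tree_elem \<Omega> act f) =
    tree_elem \<Omega> act (map_basis (subst (?s (set is))) f)" for "is"
  proof (induction "is" arbitrary: f)
    case Nil
    have "subst (?s (set [])) = (\<lambda>t. t)"
      by (simp add: fun_eq_iff subst_Leaf[unfolded eta_contract_eq])
    then show ?case
      using linear_eq_on_keys[OF linear_map_basis PM.linear_ident, of UNIV "\<lambda>t. t" f] by simp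
  next
    case (Cons i "is")
    let ?f = "map_basis (\<lambda>t. tree_comp 1 i t (?u i)) f"
    have "keys ?f \<subseteq> labeled_trees \<Omega> (n + 1 - 1)"
      using Cons.prems(1) by (intro keys_map_basis[OF Cons.prems(3)] tree_comp_labeled u1) auto
    then have k: "keys ?f \<subseteq> labeled_trees \<Omega> n" by simp
    have "subst (?s (set is)) (subst (?s {i}) t) = subst (?s (set (i # is))) t" for t
      unfolding subst_subst
    proof (rule subst_cong)
      fix j
      have "subst (?s (set is)) (relabel (\<lambda>_. i) u) = relabel (\<lambda>_. i) u"
        unfolding relabel_def subst_subst using Cons.prems(2) by simp
      then show "subst (?s (set is)) (?s {i} j) = ?s (set (i # is)) j" by auto
    qed
    then have e: "map_basis (subst (?s (set is))) ?f = map_basis (subst (?s (set (i # is)))) f"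
      by (simp only: map_basis_map_basis tc)
    have "pcomp ?F n 1 i (tree_elem \<Omega> act f) (tensor_pow ?F (vec (cl u)) I i) = tree_elem \<Omega> act ?f"
      by (simp only: tp tree_elem_comp_left[OF Cons.prems(3) u1])
    then show ?case
      using Cons.IH[OF _ _ k] Cons.prems e by (simp only: fold_simps) simp
  qed
  from this[of "[1..<Suc n]"] f
  have "comp_unary ?F n (tree_elem \<Omega> act f) (tensor_pow ?F (vec (cl u)) I) =
    tree_elem \<Omega> act (map_basis (subst (?s {1..n})) f)"
    unfolding comp_unary_def by (simp only: set_upt distinct_upt atLeastLessThanSuc_atLeastAtMost order_refl simp_thms)
  also have "map_basis (subst (?s {1..n})) f = map_basis (subst (\<lambda>j. if j \<in> I then Leaf j else relabel (\<lambda>_. j) u)) f"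
    using f labeled_trees_Lin by (intro map_basis_cong subst_cong) fastforce
  finally show ?thesis .
qed

text \<open>
  The leaf labels are arbitrary here, possibly repeated: this makes \<open>planar_ideal N\<close> stable under grafting
  of arbitrary trees, while its members with leaf labels \<open>1, \<dots>, l\<close> still lie in \<open>N l\<close>.
\<close>

definition planar_ideal :: "(nat \<Rightarrow> ('v tree set \<Rightarrow>\<^sub>0 'k::field) set) \<Rightarrow> ('v tree \<Rightarrow>\<^sub>0 'k) set" where
  "planar_ideal N = PM.span {map_basis (\<lambda>t. plug T (subst s t)) f |T s m f.
     keys f \<subseteq> labeled_trees \<Omega> m \<and> tree_elem \<Omega> act f \<in> N m \<and> count (mset (leaves T)) 0 = 1}"

lemma planar_ideal_gen:
  "\<lbrakk>keys f \<subseteq> labeled_trees \<Omega> m; tree_elem \<Omega> act f \<in> N m; count (mset (leaves T)) 0 = 1\<rbrakk>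
    \<Longrightarrow> map_basis (\<lambda>t. plug T (subst s t)) f \<in> planar_ideal N"
  unfolding planar_ideal_def by (intro PM.span_base) blast

lemma planar_ideal_subst:
  "\<lbrakk>keys f \<subseteq> labeled_trees \<Omega> m; tree_elem \<Omega> act f \<in> N m\<rbrakk>
    \<Longrightarrow> map_basis (subst s) f \<in> planar_ideal N"
  using planar_ideal_gen[of f m N "Leaf 0" s] by (simp add: plug_def)

lemma subspace_planar_ideal: "PM.subspace (planar_ideal N)"
  unfolding planar_ideal_def by (rule PM.subspace_span)

text \<open>A combination of generators may have all its trees labelled by \<open>1, ..., l\<close>
  although the generators do not: their other trees cancel. Projecting every generator to the trees
  with these labels removes the obstacle, because each generator is either kept or killed as a
  whole.\<close>

lemma planar_ideal_labeled:
  fixes N :: "nat \<Rightarrow> ('v tree set \<Rightarrow>\<^sub>0 'k::field) set"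
  assumes I: "operadic_ideal (free_operad \<Omega> act) N" and l: "l \<ge> 1"
    and a: "a \<in> planar_ideal N" "keys a \<subseteq> labeled_trees \<Omega> l"
  shows "tree_elem \<Omega> act a \<in> N l"
proof -
  interpret operadic_ideal "free_operad \<Omega> act" N by (rule I)
  have N0: "0 \<in> N l" and Nadd: "x \<in> N l \<Longrightarrow> y \<in> N l \<Longrightarrow> x + y \<in> N l"
    and Nscal: "x \<in> N l \<Longrightarrow> scal c x \<in> N l" for x y c
    using N_zero[OF l] N_add[OF l, of x y] N_smult[OF l, of x c] by simp_all
  \<comment> \<open>The projection to the trees with labels \<open>1, ..., l\<close>, combined with
    the passage to classes. It is defined on all of the planar ideal and agrees with
    \<open>tree_elem\<close> on \<open>a\<close>.\<close>
  let ?\<Phi> = "lin_ext (\<lambda>t. if t \<in> labeled_trees \<Omega> l then vec (cl t) else 0) :: _ \<Rightarrow> _ \<Rightarrow>\<^sub>0 'k"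
  note lin = linear_lin_ext[of "\<lambda>t. if t \<in> labeled_trees \<Omega> l then vec (cl t) else 0 :: _ \<Rightarrow>\<^sub>0 'k"]
  interpret \<Phi>: Vector_Spaces.linear scal scal ?\<Phi> by (rule lin)
  from a(1) have "?\<Phi> a \<in> N l"
    unfolding planar_ideal_def
  proof (induction rule: PM.span_induct_alt)
    case base
    then show ?case using N0 \<Phi>.zero by simp
  next
    case (step c g b)
    from step(1) obtain T s m f where g: "g = map_basis (\<lambda>t. plug T (subst s t)) f"
      "keys f \<subseteq> labeled_trees \<Omega> m" "tree_elem \<Omega> act f \<in> N m" "count (mset (leaves T)) 0 = 1"
      by blast
    have "?\<Phi> g \<in> N l"
    \<comment> \<open>The trees of arity \<open>m\<close> all have the same multiset of labels, so
      one of them having labels \<open>1, ..., l\<close> after plugging forces this for all the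
      others.\<close>
    proof (cases "\<exists>t\<in>labeled_trees \<Omega> m. plug T (subst s t) \<in> labeled_trees \<Omega> l")
      case True
      then obtain t where t: "t \<in> labeled_trees \<Omega> m" "plug T (subst s t) \<in> labeled_trees \<Omega> l" by blast
      have "plug T (subst s u) \<in> labeled_trees \<Omega> l" if u: "u \<in> labeled_trees \<Omega> m" for u
      proof -
        have "0 \<in> Lin T" using g(4) by (metis count_eq_zero_iff set_mset_mset zero_neq_one)
        then have "decorated \<Omega> (subst s t)" "decorated \<Omega> T"
          using labeled_trees_decorated[OF t(2)] by (force simp: plug_def decorated_subst)+
        then have d: "decorated \<Omega> (subst s u)" "decorated \<Omega> T"
          using u t(1) labeled_trees_Lin[OF u] labeled_trees_Lin[OF t(1)]
          by (auto simp: decorated_subst labeled_trees_decorated)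
        have "mset (leaves (subst s u)) = mset (leaves (subst s t))"
          using u t(1) by (simp add: mset_leaves_subst labeled_trees_iff)
        then have "(\<lambda>i. mset (leaves (case i of 0 \<Rightarrow> subst s u | Suc j \<Rightarrow> Leaf j))) =
          (\<lambda>i. mset (leaves (case i of 0 \<Rightarrow> subst s t | Suc j \<Rightarrow> Leaf j)))"
          by (auto simp: fun_eq_iff split: nat.split)
        then have "mset (leaves (plug T (subst s u))) = mset (leaves (plug T (subst s t)))"
          unfolding plug_def mset_leaves_subst by simp
        moreover have "decorated \<Omega> (plug T (subst s u))"
          using d by (auto simp: plug_def decorated_subst split: nat.split)
        ultimately show ?thesis using t(2) by (simp add: labeled_trees_iff)
      qed
      then have "?\<Phi> g = tree_elem \<Omega> act g"
        unfolding g(1)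
        by (intro linear_eq_on_keys[OF linear_comp[OF lin linear_map_basis]
              linear_comp[OF linear_tree_elem linear_map_basis] _ g(2)]) simp
      then show ?thesis using ideal_plug[OF I g(2,3) t g(4)] g(1) by simp
    next
      case False
      have "?\<Phi> g = 0"
        unfolding g(1)
        by (rule linear_eq_on_keys[OF linear_comp[OF lin linear_map_basis] _ _ g(2), where g = "\<lambda>_. 0"])
          (use False in \<open>auto simp: Vector_Spaces.linear_iff vector_space_scal\<close>)
      then show ?thesis using N0 by simp
    qed
    then show ?case using step(2) Nadd Nscal by (simp add: \<Phi>.add \<Phi>.scale)
  qed
  moreover have "?\<Phi> a = tree_elem \<Omega> act a"
    by (rule linear_eq_on_keys[OF lin linear_tree_elem _ a(2)]) simp
  ultimately show ?thesis by simp
qed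

text \<open>The sibling trees are shifted by \<open>Suc\<close> to keep the label 0 for the hole,
  and plugging undoes the shift.\<close>

lemma plug_graft:
  assumes "j \<in> {1..n}"
  shows "plug (Node w (args n ((\<lambda>i. relabel Suc (t i))(j := T)))) u = Node w (args n (t(j := plug T u)))"
proof -
  have "subst (\<lambda>i. case i of 0 \<Rightarrow> u | Suc j \<Rightarrow> Leaf j) (relabel Suc t) = t" for t
    by (simp add: subst_relabel subst_Leaf)
  then show ?thesis
    by (auto simp: plug_def map_args intro!: args_cong)
qed

text \<open>Shifted labels are positive, so the siblings add no hole to that of
  \<open>T\<close>.\<close>

lemma count_graft_hole:
  fixes t :: "nat \<Rightarrow> 'v tree"
  assumes "j \<in> {1..n}"
  shows "count (mset (leaves (Node w (args n ((\<lambda>i. relabel Suc (t i))(j := T)))))) 0 = count (mset (leaves T)) 0"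
proof -
  let ?y = "(\<lambda>i. relabel Suc (t i))(j := T)"
  have z: "count (mset (leaves (relabel Suc u))) 0 = 0" for u :: "'v tree"
    by (auto simp: leaves_relabel count_eq_zero_iff)
  then have z': "0 \<notin> Lin (relabel Suc u)" for u :: "'v tree"
    by (metis count_eq_zero_iff set_mset_mset)
  have "mset (leaves (Node w (args n ?y))) = (\<Sum>i\<in>{1..n}. mset (leaves (?y i)))"
    unfolding mset_leaves_Node length_args by (intro sum.cong) auto
  also have "\<dots> = mset (leaves T) + (\<Sum>i\<in>{1..n} - {j}. mset (leaves (relabel Suc (t i))))"
    using assms by (subst sum.remove[of _ j]) auto
  finally show ?thesis by (simp add: count_sum z')
qed

text \<open>By multilinearity the argument \<open>j\<close> may be taken to be a generator and the
  other arguments to be single trees. The graft is then a generator again, with the new vertex and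
  the siblings added to its context.\<close>

lemma graft_planar_ideal:
  fixes x :: "nat \<Rightarrow> ('v tree \<Rightarrow>\<^sub>0 'k::field)"
  assumes j: "j \<in> {1..n}" and a: "a \<in> planar_ideal N"
  shows "graft (vec w) (args n (x(j := a))) \<in> planar_ideal N"
proof -
  let ?G = "{map_basis (\<lambda>t. plug T (subst s t)) f |T s m f.
     keys f \<subseteq> labeled_trees \<Omega> m \<and> tree_elem \<Omega> act f \<in> N m \<and> count (mset (leaves T)) 0 = 1}"
  show ?thesis
  proof (rule multilin_span_induct[where f = "\<lambda>x. graft (vec w) (args n x)" and x = "x(j := a)"
        and B = "\<lambda>i. if i = j then ?G else range vec",
        OF multilin_graft vector_space_scal subspace_planar_ideal])
    fix i
    show "(x(j := a)) i \<in> PM.span (if i = j then ?G else range vec)"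
      using a in_span_vec_UNIV[of "x i"] by (simp add: planar_ideal_def)
  next
    fix y :: "nat \<Rightarrow> ('v tree \<Rightarrow>\<^sub>0 'k)"
    assume y: "\<And>i. i \<in> {1..n} \<Longrightarrow> y i \<in> (if i = j then ?G else range vec)"
    have "\<forall>i. \<exists>t. i \<in> {1..n} \<and> i \<noteq> j \<longrightarrow> y i = vec t" using y by fastforce
    from choice[OF this] obtain t where t: "\<And>i. i \<in> {1..n} \<Longrightarrow> i \<noteq> j \<Longrightarrow> y i = vec (t i)" by blast
    from y[OF j] obtain T s m f where f: "y j = map_basis (\<lambda>t. plug T (subst s t)) f"
      "keys f \<subseteq> labeled_trees \<Omega> m" "tree_elem \<Omega> act f \<in> N m" "count (mset (leaves T)) 0 = 1"
      by auto
    have "args n y = args n ((\<lambda>i. vec (t i))(j := y j))"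
      using t by (intro args_cong) auto
    moreover have "graft (vec w) (args n ((\<lambda>i. vec (t i))(j := map_basis (\<lambda>t. plug T (subst s t)) f))) =
      map_basis (\<lambda>u. plug (Node w (args n ((\<lambda>i. relabel Suc (t i))(j := T)))) (subst s u)) f"
    proof (rule linear_eq_on_keys[where s = scal and X = UNIV and v = f and
          f = "\<lambda>f. graft (vec w) (args n ((\<lambda>i. vec (t i))(j := map_basis (\<lambda>t. plug T (subst s t)) f)))"])
      have "Vector_Spaces.linear scal scal (\<lambda>a. graft (vec w) (args n ((\<lambda>i. vec (t i))(j := a))))"
        using multilin_graft j unfolding multilin_def by blast
      from linear_comp[OF this linear_map_basis]
      show "Vector_Spaces.linear scal scal
        (\<lambda>f. graft (vec w) (args n ((\<lambda>i. vec (t i))(j := map_basis (\<lambda>t. plug T (subst s t)) f))))" .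
      fix u
      have "graft (vec w) (args n ((\<lambda>i. vec (t i))(j := map_basis (\<lambda>t. plug T (subst s t)) (vec u)))) =
        graft (vec w) (args n (\<lambda>i. vec ((t(j := plug T (subst s u))) i)) :: (_ \<Rightarrow>\<^sub>0 'k) list)"
        unfolding map_basis_vec by (rule arg_cong[where f = "graft (vec w)"], rule args_cong) simp
      also have "\<dots> = vec (Node w (args n (t(j := plug T (subst s u)))))"
        by (rule graft_vec)
      also have "\<dots> = map_basis (\<lambda>u. plug (Node w (args n ((\<lambda>i. relabel Suc (t i))(j := T)))) (subst s u)) (vec u)"
        by (simp only: map_basis_vec plug_graft[OF j])
      finally show "graft (vec w) (args n ((\<lambda>i. vec (t i))(j := map_basis (\<lambda>t. plug T (subst s t)) (vec u)))) =
        map_basis (\<lambda>u. plug (Node w (args n ((\<lambda>i. relabel Suc (t i))(j := T)))) (subst s u)) (vec u :: _ \<Rightarrow>\<^sub>0 'k)" .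
    qed (use linear_map_basis in auto)
    moreover have "map_basis (\<lambda>u. plug (Node w (args n ((\<lambda>i. relabel Suc (t i))(j := T)))) (subst s u)) f \<in> planar_ideal N"
      using f by (intro planar_ideal_gen) (simp_all only: count_graft_hole[OF j])
    ultimately show "graft (vec w) (args n y) \<in> planar_ideal N" using f(1) by simp
  qed
qed

end

section \<open>The Rota-Baxter relations among planar trees\<close>

text \<open>A planar lift of the relation, which \<open>RB_rel\<close> states by operadic
  composition of classes; it can be substituted into trees with arbitrary labels.\<close>

definition rb_relation :: "(nat \<Rightarrow> nat set set) \<Rightarrow> nat \<Rightarrow> ('v \<Rightarrow>\<^sub>0 'k) \<Rightarrow> ('v rb tree \<Rightarrow>\<^sub>0 'k::field)" where
  "rb_relation C n v = map_basis (\<lambda>w. subst (rb_leaf {}) (gen_tree n (Op w))) v -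
     (\<Sum>I\<in>C n. map_basis (\<lambda>w. rb_node (subst (rb_leaf I) (gen_tree n (Op w)))) v)"

lemma rb_leaf_labeled_subst: "labeled_subst (rb_basis \<V>) n (rb_leaf I) n"
proof -
  have "(\<Sum>j\<in>{1..n}. mset (leaves (rb_leaf I j))) = (\<Sum>j\<in>{1..n}. {#j#})"
    by (intro sum.cong) auto
  also have "\<dots> = mset_set {1..n}" using sum_mset_set_inj[of "\<lambda>j. j" "{1..n}"] by simp
  finally show ?thesis by (auto simp: labeled_subst_def rb_basis_RB)
qed

lemma subst_rb_leaf_labeled:
  "t \<in> labeled_trees (rb_basis \<V>) n \<Longrightarrow> subst (rb_leaf I) t \<in> labeled_trees (rb_basis \<V>) n"
  using subst_labeled_iff rb_leaf_labeled_subst by blast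

lemma rb_node_labeled:
  "t \<in> labeled_trees (rb_basis \<V>) n \<Longrightarrow> rb_node t \<in> labeled_trees (rb_basis \<V>) n"
  by (simp add: labeled_trees_def rb_basis_RB)

lemma keys_rb_relation:
  assumes "n \<ge> 1" "keys v \<subseteq> \<V> n"
  shows "keys (rb_relation C n v) \<subseteq> labeled_trees (rb_basis \<V>) n"
proof -
  have g: "gen_tree n (Op w) \<in> labeled_trees (rb_basis \<V>) n" if "w \<in> \<V> n" for w
    using assms(1) that by (rule rb_gen_tree_labeled)
  have "keys (map_basis (\<lambda>w. subst (rb_leaf {}) (gen_tree n (Op w))) v) \<subseteq> labeled_trees (rb_basis \<V>) n"
    by (rule keys_map_basis[OF assms(2)]) (intro subst_rb_leaf_labeled g)
  moreover have "keys (\<Sum>I\<in>C n. map_basis (\<lambda>w. rb_node (subst (rb_leaf I) (gen_tree n (Op w)))) v)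
    \<subseteq> labeled_trees (rb_basis \<V>) n"
  proof (rule order_trans[OF keys_sum], rule UN_least)
    fix I
    show "keys (map_basis (\<lambda>w. rb_node (subst (rb_leaf I) (gen_tree n (Op w)))) v) \<subseteq> labeled_trees (rb_basis \<V>) n"
      by (rule keys_map_basis[OF assms(2)]) (intro rb_node_labeled subst_rb_leaf_labeled g)
  qed
  ultimately show ?thesis unfolding rb_relation_def by (meson keys_diff order_trans Un_least)
qed

lemma rb_op_eq: "rb_op \<V> act n v = tree_elem (rb_basis \<V>) (rb_act act) (map_basis (\<lambda>w. gen_tree n (Op w)) v)"
  by (simp add: rb_op_def gen_elem_eq map_basis_map_basis[unfolded map_basis_def[of Op]] flip: map_basis_def)

lemma comp_unary_rb_op:
  assumes "sym_action \<V> act" "n \<ge> 1" "keys v \<subseteq> \<V> n"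
  shows "comp_unary (free_operad (rb_basis \<V>) (rb_act act)) n (rb_op \<V> act n v)
      (tensor_pow (free_operad (rb_basis \<V>) (rb_act act)) (rb_P \<V> act) I) =
    tree_elem (rb_basis \<V>) (rb_act act) (map_basis (\<lambda>w. subst (rb_leaf I) (gen_tree n (Op w))) v)"
proof -
  interpret Q: symmetric_basis "rb_basis \<V>" "rb_act act" using assms(1) by (rule sym_action_rb)
  have k: "keys (map_basis (\<lambda>w. gen_tree n (Op w)) v) \<subseteq> labeled_trees (rb_basis \<V>) n"
    by (rule keys_map_basis[OF assms(3)]) (rule rb_gen_tree_labeled[OF assms(2)])
  have u: "rb_node (Leaf 1) \<in> labeled_trees (rb_basis \<V>) 1"
    by (intro rb_node_labeled Leaf_labeled)
  have e: "(\<lambda>j. if j \<in> I then Leaf j else relabel (\<lambda>_. j) (rb_node (Leaf (Suc 0)))) = rb_leaf I"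
    by auto
  show ?thesis
    using Q.comp_unary_tree_elem[OF k u, of I]
    unfolding One_nat_def e map_basis_map_basis rb_op_eq rb_P_def .
qed

text \<open>Inserting \<open>P\<close> at the inputs is a substitution and composing it on the
  outside adds a root, so each relation is the class of its planar lift.\<close>

lemma RB_rel_eq:
  assumes "sym_action \<V> act" "n \<ge> 1"
  shows "RB_rel \<V> act C n = {tree_elem (rb_basis \<V>) (rb_act act) (rb_relation C n v) |v. keys v \<subseteq> \<V> n}"
proof -
  interpret Q: symmetric_basis "rb_basis \<V>" "rb_act act" using assms(1) by (rule sym_action_rb)
  let ?F = "free_operad (rb_basis \<V>) (rb_act act)" and ?p = "rb_P \<V> act"
  let ?te = "tree_elem (rb_basis \<V>) (rb_act act)"
  interpret te: Vector_Spaces.linear scal scal ?te by (rule linear_tree_elem)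
  have "comp_unary ?F n (rb_op \<V> act n v) (tensor_pow ?F ?p {}) -
      (\<Sum>I\<in>C n. pcomp ?F 1 n 1 ?p (comp_unary ?F n (rb_op \<V> act n v) (tensor_pow ?F ?p I))) =
    ?te (rb_relation C n v)" if v: "keys v \<subseteq> \<V> n" for v
  proof -
    have "pcomp ?F 1 n 1 ?p (comp_unary ?F n (rb_op \<V> act n v) (tensor_pow ?F ?p I)) =
      ?te (map_basis (\<lambda>w. rb_node (subst (rb_leaf I) (gen_tree n (Op w)))) v)" for I
    proof -
      let ?f = "map_basis (\<lambda>w. subst (rb_leaf I) (gen_tree n (Op w))) v"
      have k: "keys ?f \<subseteq> labeled_trees (rb_basis \<V>) n"
        by (rule keys_map_basis[OF v]) (intro subst_rb_leaf_labeled rb_gen_tree_labeled assms(2))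
      have u: "rb_node (Leaf 1) \<in> labeled_trees (rb_basis \<V>) 1"
        by (intro rb_node_labeled Leaf_labeled)
      have "tree_comp n 1 (rb_node (Leaf 1)) t = rb_node t" for t :: "'a rb tree"
        by (simp add: tree_comp_def inner_def relabel_id)
      then show ?thesis
        unfolding comp_unary_rb_op[OF assms v]
        using Q.tree_elem_comp_right[OF k u, of 1] by (simp add: rb_P_def map_basis_map_basis)
    qed
    then show ?thesis
      by (simp only: rb_relation_def te.diff te.sum comp_unary_rb_op[OF assms v])
  qed
  then show ?thesis unfolding RB_rel_def Let_def setcompr_eq_image by (intro image_cong refl) simp
qed

text \<open>On combinations of planar trees over \<open>rb_basis\<close>, grafting and the addition
  of a \<open>P\<close>-vertex satisfy the Rota-Baxter identity modulo the planar ideal. The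
  comparison of a splitting with its original is then made at the generic point, with
  \<open>Leaf i\<close> as the value of the variable \<open>i\<close>.\<close>

lemma rota_baxter_splits_operad:
  fixes \<V> :: "nat \<Rightarrow> 'v set" and R :: "nat \<Rightarrow> ('v tree \<Rightarrow>\<^sub>0 'k::field) set"
  assumes sym: "sym_action \<V> act" and lh: "locally_homogeneous \<V> R"
    and C: "configuration C" "S_invariant C"
  shows "\<exists>\<xi>. operad_hom (CSp_operad \<V> act R C) (CRB_operad \<V> act R C) \<xi> \<and>
    (\<forall>n\<ge>1. \<forall>v. keys v \<subseteq> \<V> n \<longrightarrow> (\<forall>I\<in>C n.
       \<xi> n (CSp_gen \<V> act R C n (tensor_e v I)) =
       comp_unary (CRB_operad \<V> act R C) n (CRB_op \<V> act R C n v)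
         (tensor_pow (CRB_operad \<V> act R C) (CRB_P \<V> act R C) I)))"
proof -
  let ?W = "above_one \<V>" and ?B = "above_one (CSp_basis \<V> C)" and ?Q = "rb_basis \<V>"
  let ?F = "free_operad ?Q (rb_act act) :: ('k, 'v rb tree set \<Rightarrow>\<^sub>0 'k) operad"
  let ?te = "tree_elem ?Q (rb_act act) :: _ \<Rightarrow> _ \<Rightarrow>\<^sub>0 'k"
  let ?S = "CRB_rel \<V> act R C" and ?CS = "CSp_rel \<V> act R C"
  interpret B: symmetric_basis ?B "CSp_act act" using sym C(2) by (rule sym_action_CSp)
  interpret Q: symmetric_basis ?Q "rb_act act" using sym by (rule sym_action_rb)
  have R_keys: "keys r \<subseteq> labeled_trees ?W n" if "n \<ge> 1" "r \<in> R n" for n r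
    using lh that unfolding locally_homogeneous_def by blast
  have Op_keys: "keys (map_basis (map_tree Op) r) \<subseteq> labeled_trees ?Q n"
    if "n \<ge> 1" "r \<in> R n" for n r
    by (rule keys_map_basis[OF R_keys[OF that]]) (rule map_Op_labeled)
  have S_eq: "?S n = (\<lambda>r. ?te (map_basis (map_tree Op) r)) ` R n \<union>
    {?te (rb_relation C n v) |v. keys v \<subseteq> \<V> n}" if "n \<ge> 1" for n
    unfolding CRB_rel_def RB_rel_eq[OF sym that] map_basis_def ..
  have S: "?S n \<subseteq> carrier (comps ?F n)" if "n \<ge> 1" for n
    unfolding S_eq[OF that]
  proof (intro Un_least image_subsetI subsetI)
    show "?te (map_basis (map_tree Op) r) \<in> carrier (comps ?F n)" if "r \<in> R n" for r
      by (rule keys_tree_elem[OF Op_keys[OF \<open>n \<ge> 1\<close> that]])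
    fix x assume "x \<in> {?te (rb_relation C n v) |v. keys v \<subseteq> \<V> n}"
    then obtain v where v: "x = ?te (rb_relation C n v)" "keys v \<subseteq> \<V> n" by blast
    show "x \<in> carrier (comps ?F n)"
      unfolding v(1) using \<open>n \<ge> 1\<close> v(2) by (intro keys_tree_elem keys_rb_relation)
  qed
  define N where "N = op_ideal ?F ?S"
  interpret I: operadic_ideal ?F N
    unfolding N_def by (rule operadic_ideal_op_ideal[OF Q.operad_free S])
  have S_N: "\<mu> \<in> N n" if "n \<ge> 1" "\<mu> \<in> ?S n" for n \<mu>
    using that unfolding N_def op_ideal_def by (auto intro: in_op_ideal.gen)
  have CRB: "CRB_operad \<V> act R C = quotient_operad ?F N"
    by (simp add: CRB_operad_def presented_operad_def N_def)
  interpret cls: operad_hom ?F "CRB_operad \<V> act R C" I.cls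
    unfolding CRB by (rule I.cls_hom)

  let ?K = "Q.planar_ideal N"
  let ?M = "\<lambda>n w y. graft (vec (Op w)) (args n y) :: _ \<Rightarrow>\<^sub>0 'k"
  let ?P = "map_basis rb_node :: _ \<Rightarrow> 'v rb tree \<Rightarrow>\<^sub>0 'k"
  have P: "Vector_Spaces.linear scal scal ?P" by (rule linear_map_basis)
  have M_multi: "multilinear_ops ?W scal ?M"
    unfolding multilinear_ops_def multilinear_eq_multilin using multilin_graft by blast
  interpret RB: rota_baxter_mod scal ?W C ?M ?P ?K
  proof
    fix n w and x :: "nat \<Rightarrow> 'v rb tree \<Rightarrow>\<^sub>0 'k" assume n: "n \<ge> 1" and w: "w \<in> ?W n"
    have w2: "n \<ge> 2" "w \<in> \<V> n" using above_oneD[OF w] by auto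
    \<comment> \<open>The defect of the identity is multilinear in \<open>x\<close>. On trees
      \<open>t j\<close> it is the planar relation with \<open>t\<close> substituted for its leaves,
      hence in the planar ideal.\<close>
    let ?L = "\<lambda>x. ?M n w (\<lambda>j. ?P (x j)) - ?P (\<Sum>I\<in>C n. ?M n w (\<lambda>j. if j \<in> I then x j else ?P (x j)))"
    have lin_if: "Vector_Spaces.linear scal scal (\<lambda>a. if j \<in> I then a else ?P a)" for j :: nat and I
      using P PM.linear_ident by (cases "j \<in> I") simp_all
    have mM: "multilin scal scal n (?M n w)" by (rule multilin_graft)
    have "multilin scal scal n ?L"
      by (intro multilin_diff linear_multilin_compose[OF P] multilin_sum multilin_compose[OF mM]
          lin_if P vector_space_scal)
    then show "?L x \<in> ?K"
    proof (rule multilin_span_induct[where B = "\<lambda>_. range vec"])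
      fix y :: "nat \<Rightarrow> 'v rb tree \<Rightarrow>\<^sub>0 'k" assume y: "\<And>i. i \<in> {1..n} \<Longrightarrow> y i \<in> range vec"
      then have "\<forall>i. \<exists>t. i \<in> {1..n} \<longrightarrow> y i = vec t" by blast
      from choice[OF this] obtain t where t: "\<And>i. i \<in> {1..n} \<Longrightarrow> y i = vec (t i)" by blast
      have M_vec: "?M n w (\<lambda>j. if j \<in> I then y j else ?P (y j)) =
        vec (subst t (subst (rb_leaf I) (gen_tree n (Op w))))" for I
      proof -
        have "args n (\<lambda>j. if j \<in> I then y j else ?P (y j)) =
          args n (\<lambda>j. vec (if j \<in> I then t j else rb_node (t j)))"
          using t by (intro args_cong) simp
        then have "?M n w (\<lambda>j. if j \<in> I then y j else ?P (y j)) =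
          vec (Node (Op w) (args n (\<lambda>j. if j \<in> I then t j else rb_node (t j))))"
          by (simp only: graft_vec)
        also have "Node (Op w) (args n (\<lambda>j. if j \<in> I then t j else rb_node (t j))) =
          subst t (subst (rb_leaf I) (gen_tree n (Op w)))"
          by (auto simp: gen_tree_corolla[OF w2(1)] corolla_def map_args intro!: args_cong)
        finally show ?thesis .
      qed
      interpret st: Vector_Spaces.linear scal scal "map_basis (subst t)" by (rule linear_map_basis)
      interpret P: Vector_Spaces.linear scal scal ?P by (rule P)
      have "?L y = map_basis (subst t) (rb_relation C n (vec w))"
        using M_vec[of "{}"]
        by (simp add: rb_relation_def st.diff st.sum P.sum M_vec)
      also have "\<dots> \<in> ?K"
      proof (rule Q.planar_ideal_subst)
        have v: "keys (vec w :: _ \<Rightarrow>\<^sub>0 'k) \<subseteq> \<V> n" using w2 by simp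
        then show "keys (rb_relation C n (vec w) :: _ \<Rightarrow>\<^sub>0 'k) \<subseteq> labeled_trees ?Q n"
          by (rule keys_rb_relation[OF n])
        show "?te (rb_relation C n (vec w)) \<in> N n"
          using v by (intro S_N[OF n]) (auto simp: S_eq[OF n])
      qed
      finally show "?L y \<in> ?K" .
    qed (auto intro: vector_space_scal Q.subspace_planar_ideal in_span_vec_UNIV)
  next
    fix n j :: nat and w :: 'v and a and x :: "nat \<Rightarrow> 'v rb tree \<Rightarrow>\<^sub>0 'k"
    assume "j \<in> {1..n}" "a \<in> ?K"
    then show "?M n w (x(j := a)) \<in> ?K" by (rule Q.graft_planar_ideal)
  qed (use M_multi Q.subspace_planar_ideal in
      \<open>simp_all add: map_basis_add map_basis_scal\<close>)

  \<comment> \<open>At the variables \<open>Leaf i\<close>, evaluation returns trees. This and the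
    next fact turn \<open>RB.E_CSp\<close> into a congruence modulo \<open>?K\<close> between the
    image of the splitting under \<open>rb_tree\<close> and the original tree with \<open>P\<close>
    at the leaves outside \<open>J\<close>.\<close>
  have eval_split: "tree_eval RB.Msplit (\<lambda>i. vec (Leaf i)) u = vec (rb_tree u)" for u
  proof (induction u)
    case (Node wI ts)
    obtain w J where w: "wI = (w, J)" by (cases wI) auto
    have "args (length ts) (\<lambda>j. if j \<in> J then map (tree_eval RB.Msplit (\<lambda>i. vec (Leaf i))) ts ! (j - 1)
        else ?P (map (tree_eval RB.Msplit (\<lambda>i. vec (Leaf i))) ts ! (j - 1))) =
      args (length ts) (\<lambda>j. vec (if j \<in> J then rb_tree (ts ! (j - 1)) else rb_node (rb_tree (ts ! (j - 1)))))"
    proof (rule args_cong)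
      fix j assume j: "j \<in> {1..length ts}"
      then have "ts ! (j - 1) \<in> set ts" by auto
      from Node[OF this] show "(if j \<in> J then map (tree_eval RB.Msplit (\<lambda>i. vec (Leaf i))) ts ! (j - 1)
        else ?P (map (tree_eval RB.Msplit (\<lambda>i. vec (Leaf i))) ts ! (j - 1))) =
        vec (if j \<in> J then rb_tree (ts ! (j - 1)) else rb_node (rb_tree (ts ! (j - 1))))"
        unfolding map_nth_eq[OF j] by simp
    qed
    then show ?case
      unfolding w rb_tree_Node tree_eval.simps split_op_def prod.case by (simp only: graft_vec)
  qed simp
  have eval_J: "tree_eval ?M (\<lambda>i. if i \<in> J then vec (Leaf i) else ?P (vec (Leaf i))) t =
    vec (subst (rb_leaf J) (map_tree Op t))" for J t
  proof (induction t)
    case (Node w ts)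
    let ?e = "tree_eval ?M (\<lambda>i. if i \<in> J then vec (Leaf i) else ?P (vec (Leaf i)))"
    have "args (length ts) (\<lambda>j. map ?e ts ! (j - 1)) =
      args (length ts) (\<lambda>j. vec (subst (rb_leaf J) (map_tree Op (ts ! (j - 1)))))"
    proof (rule args_cong)
      fix j assume j: "j \<in> {1..length ts}"
      then have "ts ! (j - 1) \<in> set ts" by auto
      from Node[OF this] show "map ?e ts ! (j - 1) = vec (subst (rb_leaf J) (map_tree Op (ts ! (j - 1))))"
        unfolding map_nth_eq[OF j] .
    qed
    then have eq: "?e (Node w ts) = vec (Node (Op w) (args (length ts) (\<lambda>j. subst (rb_leaf J) (map_tree Op (ts ! (j - 1))))))"
      unfolding tree_eval.simps by (simp only: graft_vec)
    have "map (\<lambda>t. subst (rb_leaf J) (map_tree Op t)) ts =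
        args (length ts) (\<lambda>j. subst (rb_leaf J) (map_tree Op (ts ! (j - 1))))"
      by (rule map_nth_args)
    then have "subst (rb_leaf J) (map_tree Op (Node w ts)) =
        Node (Op w) (args (length ts) (\<lambda>j. subst (rb_leaf J) (map_tree Op (ts ! (j - 1)))))"
      by (simp add: comp_def del: One_nat_def)
    then show ?case using eq by (simp only:)
  qed simp

  obtain h where h: "operad_hom (free_operad ?B (CSp_act act)) ?F h"
    and h_elem: "\<And>n f. keys f \<subseteq> labeled_trees ?B n \<Longrightarrow>
      h n (tree_elem ?B (CSp_act act) f) = ?te (map_basis rb_tree f)"
    using rb_tree_hom[OF sym C(2)] by blast
  define g where "g n \<mu> = I.cls n (h n \<mu>)" for n \<mu>
  have g: "operad_hom (free_operad ?B (CSp_act act)) (CRB_operad \<V> act R C) g"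
    unfolding g_def by (rule operad_hom_compose[OF h cls.operad_hom_axioms])
  interpret g: operad_hom "free_operad ?B (CSp_act act)" "CRB_operad \<V> act R C" g by (rule g)
  have CSp_keys: "keys (lin_ext (\<lambda>t. CSp_tree C t J) r :: _ \<Rightarrow>\<^sub>0 'k) \<subseteq> labeled_trees ?B n"
    if "n \<ge> 1" "r \<in> R n" "J \<in> C n" for n r J
    using R_keys[OF that(1,2)] by (intro keys_lin_ext keys_CSp_labeled[OF C _ that(3)]) auto
  have CS: "?CS n \<subseteq> carrier (comps (free_operad ?B (CSp_act act)) n)" if "n \<ge> 1" for n
    unfolding CSp_rel_def using CSp_keys[OF that] keys_tree_elem by blast
  have kill: "g n \<mu> = \<zero>\<^bsub>comps (CRB_operad \<V> act R C) n\<^esub>" if n: "n \<ge> 1" and \<mu>: "\<mu> \<in> ?CS n" for n \<mu>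
  proof -
    obtain r J where r: "r \<in> R n" "J \<in> C n" "\<mu> = tree_elem ?B (CSp_act act) (lin_ext (\<lambda>t. CSp_tree C t J) r)"
      using \<mu> unfolding CSp_rel_def by blast
    have J: "J \<subseteq> {1..n} \<and> J \<noteq> {}" using configuration_subset[OF C(1) n r(2)] .
    let ?z = "map_basis rb_tree (lin_ext (\<lambda>t. CSp_tree C t J) r) :: _ \<Rightarrow>\<^sub>0 'k"
    let ?z' = "map_basis (\<lambda>t. subst (rb_leaf J) (map_tree Op t)) r :: _ \<Rightarrow>\<^sub>0 'k"
    have "?z - ?z' \<in> ?K"
    proof (rule linear_in_subspace[OF linear_sub[OF linear_comp[OF linear_map_basis linear_lin_ext] linear_map_basis]
          Q.subspace_planar_ideal _ R_keys[OF n r(1)]])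
      fix t assume t: "t \<in> labeled_trees ?W n"
      have "J \<inter> Lin t \<noteq> {}" using labeled_trees_Lin[OF t] J by auto
      from RB.E_CSp[OF labeled_trees_decorated[OF t] this, of "\<lambda>i. vec (Leaf i)"]
      show "map_basis rb_tree (lin_ext (\<lambda>t. CSp_tree C t J) (vec t)) -
        map_basis (\<lambda>t. subst (rb_leaf J) (map_tree Op t)) (vec t) \<in> ?K"
        unfolding eval_J eval_split by (simp add: map_basis_def lin_ext_eq_lin_to)
    qed
    \<comment> \<open>The term compared with is a relation of the original operad in which
      \<open>P\<close> has been substituted at the leaves outside \<open>J\<close>, hence a
      consequence of that relation.\<close>
    moreover have "map_basis (subst (rb_leaf J)) (map_basis (map_tree Op) r) \<in> ?K"
      by (rule Q.planar_ideal_subst[OF Op_keys[OF n r(1)]])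
        (use r(1) in \<open>auto intro!: S_N[OF n] simp: S_eq[OF n]\<close>)
    ultimately have "?z \<in> ?K"
      using PM.subspace_add[OF Q.subspace_planar_ideal] unfolding map_basis_map_basis by fastforce
    \<comment> \<open>All trees in \<open>?z\<close> carry the labels \<open>1, ..., n\<close>,
      which permits the passage from the planar ideal to the operadic one.\<close>
    moreover have "keys ?z \<subseteq> labeled_trees ?Q n"
      by (rule keys_map_basis[OF CSp_keys[OF n r(1,2)]]) (rule rb_tree_labeled)
    ultimately have "?te ?z \<in> N n"
      by (rule Q.planar_ideal_labeled[OF I.operadic_ideal_axioms n])
    then show ?thesis
      unfolding g_def r(3) h_elem[OF CSp_keys[OF n r(1,2)]] CRB by (rule I.cls_zero[OF n])
  qed
  obtain \<xi> where \<xi>: "operad_hom (CSp_operad \<V> act R C) (CRB_operad \<V> act R C) \<xi>"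
    and \<xi>_cls: "\<And>n \<mu>. n \<ge> 1 \<Longrightarrow> \<mu> \<in> carrier (comps (free_operad ?B (CSp_act act)) n) \<Longrightarrow>
      \<xi> n (presented_class ?B (CSp_act act) ?CS n \<mu>) = g n \<mu>"
    using g.factor_through_quotient[OF CS kill]
    unfolding CSp_operad_def presented_operad_def presented_class_def by blast
  have "\<xi> n (CSp_gen \<V> act R C n (tensor_e v I)) =
       comp_unary (CRB_operad \<V> act R C) n (CRB_op \<V> act R C n v)
         (tensor_pow (CRB_operad \<V> act R C) (CRB_P \<V> act R C) I)"
    if n: "n \<ge> 1" and v: "keys v \<subseteq> \<V> n" and I: "I \<in> C n" for n v I
  proof -
    let ?g = "map_basis (\<lambda>w. gen_tree n (w, I)) v :: _ \<Rightarrow>\<^sub>0 'k"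
    have k: "keys ?g \<subseteq> labeled_trees ?B n"
      by (rule keys_map_basis[OF v]) (use n I in \<open>auto intro!: gen_tree_labeled simp: CSp_basis_def\<close>)
    have "\<xi> n (CSp_gen \<V> act R C n (tensor_e v I)) = I.cls n (h n (tree_elem ?B (CSp_act act) ?g))"
      using \<xi>_cls[OF n keys_tree_elem[OF k]]
      by (simp add: CSp_gen_def gen_elem_eq tensor_e_eq map_basis_map_basis g_def)
    also have "\<dots> = I.cls n (?te (map_basis (\<lambda>w. subst (rb_leaf I) (gen_tree n (Op w))) v))"
    proof -
      \<comment> \<open>In arity one \<open>I = {1}\<close> and the generator is the trivial tree,
        so neither side contains \<open>P\<close>; in higher arities both sides are corollas with
        \<open>P\<close> at the inputs outside \<open>I\<close>.\<close>
      have "rb_tree (gen_tree n (w, I)) = subst (rb_leaf I) (gen_tree n (Op w))" for w :: 'v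
      proof (cases "n = 1")
        case True
        then have "I = {1}" using configuration_subset[OF C(1) n I] by auto
        then show ?thesis using True by (simp add: gen_tree_def)
      next
        case False
        then have "n \<ge> 2" using n by simp
        then show ?thesis
          by (auto simp: gen_tree_corolla corolla_def rb_tree_Node map_args intro!: args_cong)
      qed
      then show ?thesis unfolding h_elem[OF k] map_basis_map_basis by simp
    qed
    also have "\<dots> = I.cls n (comp_unary ?F n (rb_op \<V> act n v) (tensor_pow ?F (rb_P \<V> act) I))"
      unfolding comp_unary_rb_op[OF sym n v] ..
    also have "\<dots> = comp_unary (CRB_operad \<V> act R C) n (I.cls n (rb_op \<V> act n v))
        (\<lambda>i. I.cls 1 (tensor_pow ?F (rb_P \<V> act) I i))"
    proof (rule cls.comp_unary_hom[OF n])
      have "keys (map_basis (\<lambda>w. gen_tree n (Op w)) v) \<subseteq> labeled_trees ?Q n"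
        by (rule keys_map_basis[OF v]) (rule rb_gen_tree_labeled[OF n])
      then show "rb_op \<V> act n v \<in> carrier (comps ?F n)"
        unfolding rb_op_eq by (rule keys_tree_elem)
      have "rb_node (Leaf 1) \<in> labeled_trees ?Q 1" "Leaf 1 \<in> labeled_trees ?Q 1"
        by (intro rb_node_labeled Leaf_labeled)+
      then show "tensor_pow ?F (rb_P \<V> act) I i \<in> carrier (comps ?F 1)" for i
        by (auto simp: tensor_pow_def rb_P_def)
    qed
    also have "(\<lambda>i. I.cls 1 (tensor_pow ?F (rb_P \<V> act) I i)) =
      tensor_pow (CRB_operad \<V> act R C) (CRB_P \<V> act R C) I"
      using cls.hom_unit
      by (auto simp: tensor_pow_def CRB_P_def presented_class_def N_def fun_eq_iff)
    also have "I.cls n (rb_op \<V> act n v) = CRB_op \<V> act R C n v"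
      by (simp add: CRB_op_def presented_class_def N_def)
    finally show ?thesis .
  qed
  then show ?thesis using \<xi> by blast
qed

theorem theorem5p5:
  fixes \<V> :: "nat \<Rightarrow> 'v set"
    and ident :: 'v
    and act :: "nat \<Rightarrow> (nat \<Rightarrow> nat) \<Rightarrow> 'v \<Rightarrow> 'v"
    and R :: "nat \<Rightarrow> ('v tree \<Rightarrow>\<^sub>0 'k::field) set"
    and C :: "nat \<Rightarrow> nat set set"
    and scale :: "'k \<Rightarrow> 'a::ab_group_add \<Rightarrow> 'a"
    and \<phi> :: "nat \<Rightarrow> ('v tree set \<Rightarrow>\<^sub>0 'k) set \<Rightarrow> (nat \<Rightarrow> 'a) \<Rightarrow> 'a"
    and P :: "'a \<Rightarrow> 'a"
  assumes "sym_action \<V> act" and "\<V> 1 = {ident}"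
    and "locally_homogeneous \<V> R"
    and "configuration C" and "S_invariant C"
  shows "(\<exists>\<xi>. operad_hom (CSp_operad \<V> act R C) (CRB_operad \<V> act R C) \<xi> \<and>
            (\<forall>n\<ge>1. \<forall>v. Poly_Mapping.keys v \<subseteq> \<V> n \<longrightarrow> (\<forall>I\<in>C n.
               \<xi> n (CSp_gen \<V> act R C n (tensor_e v I)) =
               comp_unary (CRB_operad \<V> act R C) n (CRB_op \<V> act R C n v)
                 (tensor_pow (CRB_operad \<V> act R C) (CRB_P \<V> act R C) I)))) \<and>
         (operad_algebra (P_operad \<V> act R) scale \<phi> \<longrightarrow>
          rota_baxter \<V> C scale (\<lambda>n v. \<phi> n (P_gen \<V> act R n v)) P \<longrightarrow>
          (\<exists>\<psi>. operad_algebra (CSp_operad \<V> act R C) scale \<psi> \<and>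
            (\<forall>n\<ge>1. \<forall>v. Poly_Mapping.keys v \<subseteq> \<V> n \<longrightarrow> (\<forall>I\<in>C n. \<forall>x.
               \<psi> n (CSp_gen \<V> act R C n (tensor_e v I)) x =
               \<phi> n (P_gen \<V> act R n v) (\<lambda>j. if j \<in> I then x j else P (x j))))))"
  using rota_baxter_splits_operad[OF assms(1,3,4,5)] rota_baxter_splits_algebra[OF assms(1,3,4,5)]
  by blast

end
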